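(* Consider Smoluchowski's discrete model with $N\ge 2$ particles and threshold $\alpha(N)$ (defined in the context), started with no links. For every $t\ge 0$ and every integer $k$ with $\mathbb{P}(N n^{(N)}_t=k)>0$, conditionally on $\{N n^{(N)}_t = k\}$, the configuration in solution $C(t)$, considered up to graph isomorphism, has the law of an Erdős–Rényi random graph $ER(k,p^{(N)}_t)$ conditioned on having no connected component with at least $\alpha(N)$ vertices. Moreover, if there exists $\gamma>1/3$ such that $\alpha(N)/(N^{2/3}\log^{\gamma} N)\to\infty$ and $\alpha(N)/N\to 0$ as $N\to\infty$, then the process $(n^{(N)}_t)_{t\ge 0}$ converges in distribution in the Skorokhod space $\mathbb{D}(\mathbb{R}^+,\mathbb{R})$ to the deterministic function \[ n_t=\begin{cases}1, & t\le 1,\\ 1/t, & t\ge 1.\end{cases} \]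
   Context: Smoluchowski's discrete model: fix $N\ge 2$ and a sequence $(\alpha(N))$ with $\alpha(N)\to\infty$ and $\alpha(N)/N\to 0$. Particles are $[N]=\{1,\dots,N\}$. To each unordered pair $\{i,j\}$ of particles attach an independent exponential clock $e_{ij}$ with parameter $1/N$. Initially no links exist. When a clock $e_{ij}$ rings (the link is then called activated), the link between $i$ and $j$ is created, except if $i$ or $j$ belongs at that moment to a cluster (connected component of the graph of created links) of size at least $\alpha(N)$; in that case the link is never created. Clusters of size $\ge\alpha(N)$ are called large, the others small; particles in small clusters are in solution. $S(t)$ is the set of particles in solution at time $t$, $n^{(N)}_t=\#S(t)/N$, $p^{(N)}_t=1-e^{-t/N}$, and the configuration in solution $C(t)$ is the graph with vertex set $S(t)$ and edge set $\{\{i,j\}\subset S(t): e_{ij}\le t\}$. All processes are càdlàg. $ER(n,p)$ denotes the Erdős–Rényi graph on $n$ vertices where each edge is present independently with probability $p$. *)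

theory Defs
  imports "HOL-Probability.Probability"
begin

text \<open>A graph is a pair (vertex set, edge set); an (unordered) edge {i,j} is stored as
  the ordered pair (i,j) with i < j.\<close>

type_synonym graph = "nat set \<times> (nat \<times> nat) set"

definition pairs :: "nat \<Rightarrow> (nat \<times> nat) set" where
  "pairs N = {(i, j). 1 \<le> i \<and> i < j \<and> j \<le> N}"

definition pairs_list :: "nat \<Rightarrow> (nat \<times> nat) list" where
  "pairs_list N = concat (map (\<lambda>j. map (\<lambda>i. (i, j)) [1..<j]) [1..<Suc N])"

definition uedge :: "(nat \<times> nat) set \<Rightarrow> nat \<Rightarrow> nat \<Rightarrow> bool" where
  "uedge E i j \<longleftrightarrow> (i, j) \<in> E \<or> (j, i) \<in> E"

definition graph_cluster :: "nat set \<Rightarrow> (nat \<times> nat) set \<Rightarrow> nat \<Rightarrow> nat set" where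
  "graph_cluster V E i = {j \<in> V. (i, j) \<in> (E \<union> E\<inverse>)\<^sup>*}"

definition graph_iso :: "graph \<Rightarrow> graph \<Rightarrow> bool" where
  "graph_iso G H \<longleftrightarrow> (\<exists>f. bij_betw f (fst G) (fst H) \<and>
      (\<forall>i\<in>fst G. \<forall>j\<in>fst G. uedge (snd G) i j \<longleftrightarrow> uedge (snd H) (f i) (f j)))"

definition iso_invariant :: "(graph \<Rightarrow> bool) \<Rightarrow> bool" where
  "iso_invariant Q \<longleftrightarrow> (\<forall>G H. graph_iso G H \<longrightarrow> Q G = Q H)"

definition no_large_comp :: "real \<Rightarrow> graph \<Rightarrow> bool" where
  "no_large_comp a G \<longleftrightarrow> (\<forall>i\<in>fst G. real (card (graph_cluster (fst G) (snd G) i)) < a)"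

definition ER :: "nat \<Rightarrow> real \<Rightarrow> graph pmf" where
  "ER k p = map_pmf (\<lambda>b. ({1..k}, {x \<in> pairs k. b x}))
              (Pi_pmf (pairs k) False (\<lambda>_. bernoulli_pmf p))"

definition clock_space :: "nat \<Rightarrow> ((nat \<times> nat) \<Rightarrow> real) measure" where
  "clock_space N = PiM (pairs N) (\<lambda>_. density lborel (exponential_density (1 / real N)))"

definition cluster :: "nat \<Rightarrow> (nat \<times> nat) set \<Rightarrow> nat \<Rightarrow> nat set" where
  "cluster N E i = graph_cluster {1..N} E i"

text \<open>Set of links created up to time t: the clocks are processed in increasing order of
  their ringing times (ties, a null event, broken deterministically); an activated link is
  created unless one of its endpoints lies in a cluster of size at least a.\<close>
definition links :: "real \<Rightarrow> nat \<Rightarrow> ((nat \<times> nat) \<Rightarrow> real) \<Rightarrow> real \<Rightarrow> (nat \<times> nat) set" where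
  "links a N e t = fold
     (\<lambda>p E. if e p \<le> t \<and> real (card (cluster N E (fst p))) < a
                       \<and> real (card (cluster N E (snd p))) < a
            then insert p E else E)
     (sort_key e (pairs_list N)) {}"

definition sol :: "real \<Rightarrow> nat \<Rightarrow> ((nat \<times> nat) \<Rightarrow> real) \<Rightarrow> real \<Rightarrow> nat set" where
  "sol a N e t = {i \<in> {1..N}. real (card (cluster N (links a N e t) i)) < a}"

definition nsol :: "real \<Rightarrow> nat \<Rightarrow> ((nat \<times> nat) \<Rightarrow> real) \<Rightarrow> real \<Rightarrow> real" where
  "nsol a N e t = real (card (sol a N e t)) / real N"

definition psol :: "nat \<Rightarrow> real \<Rightarrow> real" where
  "psol N t = 1 - exp (- t / real N)"

definition config :: "real \<Rightarrow> nat \<Rightarrow> ((nat \<times> nat) \<Rightarrow> real) \<Rightarrow> real \<Rightarrow> graph" where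
  "config a N e t = (sol a N e t,
     {p \<in> pairs N. fst p \<in> sol a N e t \<and> snd p \<in> sol a N e t \<and> e p \<le> t})"

definition cadlag :: "(real \<Rightarrow> real) \<Rightarrow> bool" where
  "cadlag x \<longleftrightarrow> (\<forall>t\<ge>0. continuous (at_right t) x \<and> (t > 0 \<longrightarrow> (\<exists>l. (x \<longlongrightarrow> l) (at_left t))))"

definition time_change :: "(real \<Rightarrow> real) \<Rightarrow> bool" where
  "time_change l \<longleftrightarrow> strict_mono_on {0..} l \<and> continuous_on {0..} l \<and> l ` {0..} = {0..}"

text \<open>Convergence in the Skorokhod J1 topology of D[0,oo) (Billingsley, Thm 16.1).\<close>
definition skorokhod_conv :: "(nat \<Rightarrow> real \<Rightarrow> real) \<Rightarrow> (real \<Rightarrow> real) \<Rightarrow> bool" where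
  "skorokhod_conv xs x \<longleftrightarrow> (\<exists>ls. (\<forall>n. time_change (ls n)) \<and>
     (\<forall>\<epsilon>>0. eventually (\<lambda>n. \<forall>t\<ge>0. \<bar>ls n t - t\<bar> < \<epsilon>) sequentially) \<and>
     (\<forall>T\<ge>0. \<forall>\<epsilon>>0. eventually (\<lambda>n. \<forall>t\<in>{0..T}. \<bar>xs n (ls n t) - x t\<bar> < \<epsilon>) sequentially))"

text \<open>Continuity of a functional on D (D is metrizable, so sequential continuity suffices).\<close>
definition sk_continuous :: "((real \<Rightarrow> real) \<Rightarrow> real) \<Rightarrow> bool" where
  "sk_continuous F \<longleftrightarrow> (\<forall>xs x. (\<forall>n. cadlag (xs n)) \<and> cadlag x \<and> skorokhod_conv xs x
       \<longrightarrow> (\<lambda>n. F (xs n)) \<longlonglongrightarrow> F x)"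

definition conv_distr_D ::
  "(nat \<Rightarrow> 'a measure) \<Rightarrow> (nat \<Rightarrow> 'a \<Rightarrow> real \<Rightarrow> real) \<Rightarrow> (real \<Rightarrow> real) \<Rightarrow> bool" where
  "conv_distr_D M X x \<longleftrightarrow> (\<forall>F. bounded (range F) \<and> sk_continuous F \<longrightarrow>
      (\<lambda>N. integral\<^sup>L (M N) (\<lambda>\<omega>. F (X N \<omega>))) \<longlonglongrightarrow> F x)"

definition n_limit :: "real \<Rightarrow> real" where
  "n_limit t = (if t \<le> 1 then 1 else 1 / t)"

end

theory Submission
  imports Defs "HOL-Real_Asymp.Real_Asymp"
begin

text \<open>For the law of the configuration: the solution at time \<open>t\<close> is \<open>S\<close> if and only if the clocks inside
  \<open>S\<close> produce no large component and the process run without these clocks never touches \<open>S\<close> and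
  puts all other particles into large clusters. These two events are independent.

  For the limit: a newborn large cluster \<open>D\<close> has between \<open>a\<close> and \<open>2 a\<close> particles, is connected, and has
  no rung clock towards the rest of the solution. Removing the large clusters one after the other
  gives a history of at most \<open>N / a\<close> steps, and on a time grid there are only \<open>exp (o(N))\<close> types of
  history. By the union bound over parent functions, a step with \<open>d\<close> particles out of \<open>k\<close> at time \<open>t\<close>
  has probability at most \<open>exp (- d (x - 1 - ln x))\<close> with \<open>x = k t / N\<close>, up to negligible factors. So the
  solution cannot leave the subcritical region, while a supercritical set without large components is
  exponentially unlikely; hence the solution has about \<open>N min(1, 1 / t)\<close> particles for every \<open>t\<close>. Monotonicity makes this
  locally uniform in \<open>t\<close>, which implies Skorokhod convergence. Functionals that are
  continuous on the Skorokhod space are measurable along the paths because rounding the clocks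
  is a small time change.\<close>

text \<open>Large clusters are born at random times, and each one changes the solution that the next
  is cut from, so following the process in time would mean conditioning on its past. Histories avoid
  this: for fixed sets and cells, the links inside \<open>D\<close>, the links between
  \<open>D\<close> and \<open>S - D\<close>, and the rest of the history use disjoint sets of
  clocks, so their probabilities multiply. The price is a union bound over histories. The choice of
  \<open>D\<close> among the subsets of \<open>S\<close> is paid within its step: binomial
  coefficient, number of parent functions and missing cross links combine to exp (- d (x - 1 - ln
  x)), where the exponent vanishes only at x = 1. A polynomial factor per step remains, thus exp
  (O(N ln N / a)) for at most N / a steps; the growth hypothesis on alpha enters here, as ln N / a
  tending to 0. Grid mesh \<open>h\<close> and cluster size cost a further exp ((h + o(1)) d) per
  step. Removed clusters are disjoint, so these errors multiply to at most exp ((h + o(1)) N), which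
  is harmless once \<open>h\<close> is below the exponential rate of the event.\<close>

section \<open>Links inside and across vertex sets, clusters, spanning trees\<close>

definition ipairs :: "nat set \<Rightarrow> (nat \<times> nat) set" where
  "ipairs S = {(i, j). i < j \<and> i \<in> S \<and> j \<in> S}"

definition crossp :: "nat set \<Rightarrow> nat set \<Rightarrow> (nat \<times> nat) set" where
  "crossp D S = {(i, j) \<in> ipairs S. (i \<in> D) \<noteq> (j \<in> D)}"

text \<open>Only the links of \<open>E\<close> inside \<open>D\<close> count. The predicate can thus
  be applied to the set of all rung clocks and still depend on the clocks inside \<open>D\<close>
  alone; \<open>nolarge\<close> is restricted in the same way.\<close>

definition conn :: "nat set \<Rightarrow> (nat \<times> nat) set \<Rightarrow> bool" where
  "conn D E \<longleftrightarrow> (\<forall>x\<in>D. graph_cluster D (E \<inter> ipairs D) x = D)"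

definition nolarge :: "real \<Rightarrow> nat set \<Rightarrow> (nat \<times> nat) set \<Rightarrow> bool" where
  "nolarge a S E \<longleftrightarrow> no_large_comp a (S, E \<inter> ipairs S)"

lemma pairs_eq_ipairs: "pairs N = ipairs {1..N}"
  by (auto simp: pairs_def ipairs_def)

lemma ipairs_mono: "S \<subseteq> T \<Longrightarrow> ipairs S \<subseteq> ipairs T"
  by (auto simp: ipairs_def)

lemma finite_ipairs: "finite S \<Longrightarrow> finite (ipairs S)"
  by (rule finite_subset[of _ "S \<times> S"]) (auto simp: ipairs_def)

lemma finite_pairs: "finite (pairs N)"
  by (simp add: pairs_eq_ipairs finite_ipairs)

lemma crossp_subset: "crossp D S \<subseteq> ipairs S"
  by (auto simp: crossp_def)

lemma crossp_compl: "crossp (S - D) S = crossp D S"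
  by (auto simp: crossp_def ipairs_def)

lemma ipairs_crossp_disjoint:
  "ipairs D \<inter> crossp D S = {}" "ipairs (S - D) \<inter> crossp D S = {}" "ipairs D \<inter> ipairs (S - D) = {}"
  by (auto simp: crossp_def ipairs_def)

lemma ipairs_split: "D \<subseteq> S \<Longrightarrow> ipairs S = ipairs D \<union> ipairs (S - D) \<union> crossp D S"
  by (auto simp: crossp_def ipairs_def)

lemma card_crossp:
  assumes "finite S" "D \<subseteq> S"
  shows "card (crossp D S) = card D * (card S - card D)"
proof -
  have fD: "finite D" using assms finite_subset by blast
  \<comment> \<open>Edges are stored with the smaller end first, so the swap loses the roles of the
    two ends; membership in \<open>D\<close> recovers them.\<close>
  have "bij_betw (\<lambda>(x, y). if x < y then (x, y) else (y, x)) (D \<times> (S - D)) (crossp D S)"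
    unfolding bij_betw_def
  proof
    show "inj_on (\<lambda>(x, y). if x < y then (x, y) else (y, x)) (D \<times> (S - D))"
    proof (rule inj_onI, clarsimp)
      fix x y x' y' assume "x \<in> D" "x' \<in> D" "y \<notin> D" "y' \<notin> D"
        "(if x < y then (x, y) else (y, x)) = (if x' < y' then (x', y') else (y', x'))"
      then show "x = x' \<and> y = y'" by (cases "x < y"; cases "x' < y'") auto
    qed
    show "(\<lambda>(x, y). if x < y then (x, y) else (y, x)) ` (D \<times> (S - D)) = crossp D S"
    proof
      show "(\<lambda>(x, y). if x < y then (x, y) else (y, x)) ` (D \<times> (S - D)) \<subseteq> crossp D S"
      proof
        fix p assume "p \<in> (\<lambda>(x, y). if x < y then (x, y) else (y, x)) ` (D \<times> (S - D))"
        then obtain x y where xy: "x \<in> D" "y \<in> S" "y \<notin> D" "p = (if x < y then (x, y) else (y, x))"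
          by auto
        moreover have "x \<noteq> y" "x \<in> S" using xy assms by auto
        ultimately show "p \<in> crossp D S" by (cases "x < y") (simp_all add: crossp_def ipairs_def)
      qed
      show "crossp D S \<subseteq> (\<lambda>(x, y). if x < y then (x, y) else (y, x)) ` (D \<times> (S - D))"
      proof
        fix p assume "p \<in> crossp D S"
        then obtain i j where p: "p = (i, j)" "i < j" "i \<in> S" "j \<in> S" "(i \<in> D) \<noteq> (j \<in> D)"
          by (auto simp: crossp_def ipairs_def)
        show "p \<in> (\<lambda>(x, y). if x < y then (x, y) else (y, x)) ` (D \<times> (S - D))"
        proof (cases "i \<in> D")
          case True
          then have "(i, j) \<in> D \<times> (S - D)" using p by simp
          then show ?thesis by (rule rev_image_eqI) (use p in simp)
        next
          case False
          then have "(j, i) \<in> D \<times> (S - D)" using p by simp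
          then show ?thesis by (rule rev_image_eqI) (use p in simp)
        qed
      qed
    qed
  qed
  then have "card (crossp D S) = card (D \<times> (S - D))"
    by (rule bij_betw_same_card[symmetric])
  then show ?thesis using assms fD by (simp add: card_cartesian_product card_Diff_subset)
qed

lemma path_sym: "(x, y) \<in> (E \<union> E\<inverse>)\<^sup>* \<Longrightarrow> (y, x) \<in> (E \<union> E\<inverse>)\<^sup>*"
proof -
  assume "(x, y) \<in> (E \<union> E\<inverse>)\<^sup>*"
  moreover have "sym ((E \<union> E\<inverse>)\<^sup>*)"
    by (rule sym_rtrancl) (auto simp: sym_def)
  ultimately show ?thesis by (auto dest: symD)
qed

lemma graph_cluster_self: "i \<in> V \<Longrightarrow> i \<in> graph_cluster V E i"
  by (auto simp: graph_cluster_def)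

lemma graph_cluster_subset: "graph_cluster V E i \<subseteq> V"
  by (auto simp: graph_cluster_def)

lemma finite_graph_cluster: "finite V \<Longrightarrow> finite (graph_cluster V E i)"
  by (rule finite_subset[OF graph_cluster_subset])

lemma graph_cluster_mono: "E \<subseteq> E' \<Longrightarrow> graph_cluster V E i \<subseteq> graph_cluster V E' i"
  unfolding graph_cluster_def using rtrancl_mono[of "E \<union> E\<inverse>" "E' \<union> E'\<inverse>"] by blast

lemma graph_cluster_cong:
  assumes "j \<in> graph_cluster V E i"
  shows "graph_cluster V E j = graph_cluster V E i"
proof -
  have ij: "(i, j) \<in> (E \<union> E\<inverse>)\<^sup>*" using assms by (simp add: graph_cluster_def)
  have "(j, k) \<in> (E \<union> E\<inverse>)\<^sup>* \<longleftrightarrow> (i, k) \<in> (E \<union> E\<inverse>)\<^sup>*" for k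
    using ij path_sym[OF ij] by (meson rtrancl_trans)
  then show ?thesis by (simp add: graph_cluster_def)
qed

lemma graph_cluster_edge:
  assumes "(x, y) \<in> E" "x \<in> V" "y \<in> V"
  shows "graph_cluster V E x = graph_cluster V E y"
proof -
  have "y \<in> graph_cluster V E x" using assms by (auto simp: graph_cluster_def)
  then show ?thesis by (simp add: graph_cluster_cong)
qed

text \<open>A path from \<open>i\<close> cannot leave \<open>D\<close>: its first step out of
  \<open>D\<close> would be a link between \<open>D\<close> and the rest of
  \<open>V\<close>.\<close>

lemma graph_cluster_restrict:
  assumes "D \<subseteq> V" "E \<subseteq> ipairs V" "E \<inter> crossp D V = {}" "i \<in> D"
  shows "graph_cluster V E i = graph_cluster D (E \<inter> ipairs D) i"
proof
  show "graph_cluster D (E \<inter> ipairs D) i \<subseteq> graph_cluster V E i"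
  proof -
    have "((E \<inter> ipairs D) \<union> (E \<inter> ipairs D)\<inverse>)\<^sup>* \<subseteq> (E \<union> E\<inverse>)\<^sup>*"
      by (rule rtrancl_mono) auto
    then show ?thesis using assms(1) unfolding graph_cluster_def by auto
  qed
  have "j \<in> D \<and> (i, j) \<in> ((E \<inter> ipairs D) \<union> (E \<inter> ipairs D)\<inverse>)\<^sup>*" if "(i, j) \<in> (E \<union> E\<inverse>)\<^sup>*" for j
    using that
  proof (induction rule: rtrancl_induct)
    case base
    then show ?case using assms by simp
  next
    case (step y z)
    have yD: "y \<in> D" using step.IH by blast
    obtain q where q: "q \<in> E" "q = (y, z) \<or> q = (z, y)" using step.hyps(2) by blast
    have "q \<in> ipairs V" "q \<notin> crossp D V" using q assms by blast+
    then have zD: "z \<in> D" and "q \<in> ipairs D"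
      using q(2) yD by (auto simp: crossp_def ipairs_def)
    then have "(y, z) \<in> (E \<inter> ipairs D) \<union> (E \<inter> ipairs D)\<inverse>" using q by blast
    with step.IH zD show ?case by (blast intro: rtrancl_into_rtrancl)
  qed
  then show "graph_cluster V E i \<subseteq> graph_cluster D (E \<inter> ipairs D) i"
    unfolding graph_cluster_def by auto
qed

lemma graph_cluster_no_cross:
  assumes "E \<subseteq> ipairs V"
  shows "E \<inter> crossp (graph_cluster V E i) V = {}"
proof (rule ccontr)
  assume "E \<inter> crossp (graph_cluster V E i) V \<noteq> {}"
  then obtain x y where xy: "(x, y) \<in> E" "x \<in> V" "y \<in> V"
    "(x \<in> graph_cluster V E i) \<noteq> (y \<in> graph_cluster V E i)"
    by (auto simp: crossp_def ipairs_def)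
  have "graph_cluster V E x = graph_cluster V E y" by (rule graph_cluster_edge) (use xy in auto)
  with xy show False by (metis graph_cluster_cong graph_cluster_self)
qed

lemma conn_graph_cluster:
  assumes "E \<subseteq> ipairs V"
  shows "conn (graph_cluster V E i) E"
  unfolding conn_def
proof
  fix x assume x: "x \<in> graph_cluster V E i"
  have "graph_cluster V E x = graph_cluster (graph_cluster V E i) (E \<inter> ipairs (graph_cluster V E i)) x"
    by (rule graph_cluster_restrict) (use assms x graph_cluster_no_cross graph_cluster_subset in auto)
  then show "graph_cluster (graph_cluster V E i) (E \<inter> ipairs (graph_cluster V E i)) x = graph_cluster V E i"
    using x graph_cluster_cong by blast
qed

lemma conn_mono:
  assumes "conn D E" "E \<inter> ipairs D \<subseteq> E'"
  shows "conn D E'"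
  unfolding conn_def
proof
  fix x assume "x \<in> D"
  then have "D = graph_cluster D (E \<inter> ipairs D) x" using assms(1) unfolding conn_def by simp
  also have "... \<subseteq> graph_cluster D (E' \<inter> ipairs D) x"
    by (rule graph_cluster_mono) (use assms(2) in blast)
  finally show "graph_cluster D (E' \<inter> ipairs D) x = D"
    using graph_cluster_subset by blast
qed

text \<open>Used to recover \<open>D\<close> from the event: it must be the cluster of
  \<open>v\<close>, so the events belonging to different sets \<open>D\<close> that contain
  \<open>v\<close> are disjoint.\<close>

lemma conn_cluster_eq:
  assumes "conn D E" "D \<subseteq> S" "E \<inter> crossp D S = {}" "v \<in> D"
  shows "graph_cluster S (E \<inter> ipairs S) v = D"
proof -
  have eq: "E \<inter> ipairs S \<inter> ipairs D = E \<inter> ipairs D"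
    using ipairs_mono[OF assms(2)] by blast
  have "graph_cluster S (E \<inter> ipairs S) v = graph_cluster D (E \<inter> ipairs S \<inter> ipairs D) v"
    by (rule graph_cluster_restrict) (use assms in auto)
  then show ?thesis using assms eq unfolding conn_def by simp
qed

lemma nolarge_mono_set:
  assumes "nolarge a S E" "D \<subseteq> S" "E \<inter> crossp D S = {}"
  shows "nolarge a D E"
  unfolding nolarge_def no_large_comp_def fst_conv snd_conv
proof
  fix i assume i: "i \<in> D"
  have eq: "E \<inter> ipairs S \<inter> ipairs D = E \<inter> ipairs D"
    using ipairs_mono[OF assms(2)] by blast
  have "graph_cluster S (E \<inter> ipairs S) i = graph_cluster D (E \<inter> ipairs S \<inter> ipairs D) i"
    by (rule graph_cluster_restrict) (use assms i in auto)
  then show "real (card (graph_cluster D (E \<inter> ipairs D) i)) < a"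
    using assms(1,2) i eq unfolding nolarge_def no_large_comp_def by (metis fst_conv snd_conv subsetD)
qed

text \<open>Peels off the component of \<open>v\<close>. What remains again has no large component,
  which is the recursion behind \<open>cprob_nolarge_le\<close>.\<close>

lemma nolarge_cases:
  assumes "nolarge a S E" "v \<in> S"
  obtains D where "D \<subseteq> S" "v \<in> D" "real (card D) < a" "conn D E" "E \<inter> crossp D S = {}"
    "nolarge a (S - D) E"
proof -
  let ?D = "graph_cluster S (E \<inter> ipairs S) v"
  have sub: "?D \<subseteq> S" by (rule graph_cluster_subset)
  have c: "E \<inter> crossp ?D S = {}"
    using graph_cluster_no_cross[of "E \<inter> ipairs S" S v] crossp_subset by blast
  have "conn ?D E"
    by (rule conn_mono[OF conn_graph_cluster[of "E \<inter> ipairs S"]]) auto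
  moreover have "nolarge a (S - ?D) E"
    by (rule nolarge_mono_set[OF assms(1)]) (use c in \<open>auto simp: crossp_compl\<close>)
  moreover have "real (card ?D) < a"
    using assms unfolding nolarge_def no_large_comp_def by auto
  ultimately show thesis using that[OF sub graph_cluster_self[OF assms(2)]] c by blast
qed

definition parent_edge :: "(nat \<Rightarrow> nat) \<Rightarrow> nat \<Rightarrow> nat \<times> nat" where
  "parent_edge f x = (min x (f x), max x (f x))"

text \<open>Parents are chosen on shortest paths to the root, so the edges towards them form a
  spanning tree.\<close>
lemma conn_parent:
  assumes "conn D E" "v \<in> D"
  obtains f where "f \<in> (D - {v}) \<rightarrow>\<^sub>E D"
    "inj_on (parent_edge f) (D - {v})"
    "parent_edge f ` (D - {v}) \<subseteq> E \<inter> ipairs D"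
    "conn D (parent_edge f ` (D - {v}))"
proof -
  define G where "G = E \<inter> ipairs D"
  define R where "R = G \<union> G\<inverse>"
  have reach: "\<exists>n. (v, x) \<in> R ^^ n" if "x \<in> D" for x
  proof -
    have "x \<in> graph_cluster D G v" using assms that unfolding conn_def G_def by blast
    then have "(v, x) \<in> R\<^sup>*" by (simp add: graph_cluster_def R_def)
    then show ?thesis by (simp add: rtrancl_power)
  qed
  define dst where "dst x = (LEAST n. (v, x) \<in> R ^^ n)" for x
  have dst: "(v, x) \<in> R ^^ dst x" if "x \<in> D" for x
    unfolding dst_def using reach[OF that] by (rule LeastI_ex)
  have ex: "\<exists>y. (y, x) \<in> R \<and> dst y < dst x" if x: "x \<in> D - {v}" for x
  proof -
    have "dst x \<noteq> 0" using dst[of x] x by (auto intro!: gr0I)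
    then obtain n where n: "dst x = Suc n" by (cases "dst x") auto
    with dst[of x] x have "(v, x) \<in> R ^^ n O R" by simp
    then obtain y where y: "(v, y) \<in> R ^^ n" "(y, x) \<in> R" by blast
    have "dst y \<le> n" unfolding dst_def by (rule Least_le) (rule y(1))
    with y n show ?thesis by auto
  qed
  \<comment> \<open>The value \<open>undefined\<close> off the domain puts \<open>f\<close> into the
    extensional function space, whose cardinality enters the union bound.\<close>
  define f where "f x = (if x \<in> D - {v} then SOME y. (y, x) \<in> R \<and> dst y < dst x else undefined)" for x
  have f: "(f x, x) \<in> R" "dst (f x) < dst x" if "x \<in> D - {v}" for x
    using someI_ex[OF ex[OF that]] that unfolding f_def by auto
  have fG: "parent_edge f x \<in> G" if "x \<in> D - {v}" for x
    using f(1)[OF that] unfolding R_def G_def parent_edge_def ipairs_def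
    by (auto simp: min_def max_def)
  have fD: "f x \<in> D" if "x \<in> D - {v}" for x
    using f(1)[OF that] unfolding R_def G_def ipairs_def by auto
  have inj: "inj_on (parent_edge f) (D - {v})"
  proof (rule inj_onI)
    fix x y assume xy: "x \<in> D - {v}" "y \<in> D - {v}" "parent_edge f x = parent_edge f y"
    show "x = y"
    proof (rule ccontr)
      assume "x \<noteq> y"
      \<comment> \<open>Two vertices with the same edge would be parents of each other, each nearer
        to the root than the other.\<close>
      with xy(3) have "f x = y" "f y = x"
        unfolding parent_edge_def by (auto simp: min_def max_def split: if_splits)
      with f(2)[OF xy(1)] f(2)[OF xy(2)] show False by simp
    qed
  qed
  let ?T = "parent_edge f ` (D - {v})"
  have TD: "?T \<inter> ipairs D = ?T" using fG unfolding G_def by auto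
  have path: "(v, x) \<in> (?T \<union> ?T\<inverse>)\<^sup>*" if "x \<in> D" for x
    using that
  proof (induction "dst x" arbitrary: x rule: less_induct)
    case less
    show ?case
    proof (cases "x = v")
      case False
      with less have x: "x \<in> D - {v}" by auto
      have "(v, f x) \<in> (?T \<union> ?T\<inverse>)\<^sup>*" using less f(2)[OF x] fD[OF x] by blast
      moreover have "(f x, x) \<in> ?T \<union> ?T\<inverse>"
      proof -
        have "parent_edge f x \<in> ?T" using x by blast
        then show ?thesis unfolding parent_edge_def by (cases "x \<le> f x") (auto simp: min_def max_def)
      qed
      ultimately show ?thesis by (rule rtrancl_into_rtrancl)
    qed simp
  qed
  have "conn D ?T"
    unfolding conn_def TD
  proof
    fix x assume "x \<in> D"
    have "graph_cluster D ?T v = D" using path by (auto simp: graph_cluster_def)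
    then show "graph_cluster D ?T x = D" using graph_cluster_cong \<open>x \<in> D\<close> by blast
  qed
  moreover have "f \<in> (D - {v}) \<rightarrow>\<^sub>E D" 
  proof (rule PiE_I)
    show "f x = undefined" if "x \<notin> D - {v}" for x unfolding f_def using that by (rule if_not_P)
  qed (rule fD)
  moreover have "?T \<subseteq> E \<inter> ipairs D" using fG unfolding G_def by blast
  ultimately show thesis using that[of f] inj by blast
qed

section \<open>The process of created links\<close>

abbreviation is_small :: "real \<Rightarrow> nat \<Rightarrow> (nat \<times> nat) set \<Rightarrow> nat \<Rightarrow> bool" where
  "is_small a N E i \<equiv> real (card (graph_cluster {1..N} E i)) < a"

definition solset :: "real \<Rightarrow> nat \<Rightarrow> (nat \<times> nat) set \<Rightarrow> nat set" where
  "solset a N E = {i \<in> {1..N}. is_small a N E i}"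

definition link_step ::
  "real \<Rightarrow> nat \<Rightarrow> ((nat \<times> nat) \<Rightarrow> real) \<Rightarrow> real \<Rightarrow> nat \<times> nat \<Rightarrow> (nat \<times> nat) set \<Rightarrow> (nat \<times> nat) set" where
  "link_step a N e t p E =
     (if e p \<le> t \<and> is_small a N E (fst p)
               \<and> is_small a N E (snd p)
      then insert p E else E)"

lemma link_step_yes:
  "e p \<le> t \<Longrightarrow> is_small a N E (fst p) \<Longrightarrow>
    is_small a N E (snd p) \<Longrightarrow> link_step a N e t p E = insert p E"
  by (simp add: link_step_def)

lemma link_step_no:
  "\<not> (e p \<le> t \<and> is_small a N E (fst p) \<and>
    is_small a N E (snd p)) \<Longrightarrow> link_step a N e t p E = E"
  unfolding link_step_def by (rule if_not_P)

lemma link_step_or: "link_step a N e t p E = E \<or> link_step a N e t p E = insert p E"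
  by (simp add: link_step_def)

text \<open>A step consults the edge set only through the clusters of the two ends, so equal
  clusters give the same decision. In the applications \<open>X\<close> consists of links inside a
  fixed set \<open>S\<close>.\<close>

lemma link_step_same:
  assumes "E - X = E' - X" "graph_cluster {1..N} E (fst p) = graph_cluster {1..N} E' (fst p)"
    "graph_cluster {1..N} E (snd p) = graph_cluster {1..N} E' (snd p)"
  shows "link_step a N e t p E - X = link_step a N e t p E' - X"
  using assms by (auto simp: link_step_def)

text \<open>Runs over arbitrary lists: prefixes of the sorted list give the states between two
  rings, filtered lists give runs with some clocks left out.\<close>

abbreviation run_links ::
  "real \<Rightarrow> nat \<Rightarrow> ((nat \<times> nat) \<Rightarrow> real) \<Rightarrow> real \<Rightarrow> (nat \<times> nat) list \<Rightarrow> (nat \<times> nat) set" where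
  "run_links a N e t us \<equiv> fold (link_step a N e t) us {}"

lemma links_eq_run: "links a N e t = run_links a N e t (sort_key e (pairs_list N))"
  unfolding links_def link_step_def cluster_def by simp

lemma sol_eq_solset: "sol a N e t = solset a N (links a N e t)"
  by (simp add: sol_def solset_def cluster_def)

lemma set_pairs_list: "set (pairs_list N) = pairs N"
proof -
  have "set (pairs_list N) = (\<Union>j\<in>{1..<Suc N}. (\<lambda>i. (i, j)) ` {1..<j})"
    unfolding pairs_list_def by (simp only: set_concat set_map set_upt image_image)
  also have "... = pairs N"
  proof
    show "pairs N \<subseteq> (\<Union>j\<in>{1..<Suc N}. (\<lambda>i. (i, j)) ` {1..<j})"
    proof
      fix p assume "p \<in> pairs N"
      then obtain i j where "p = (i, j)" "1 \<le> i" "i < j" "j \<le> N" by (auto simp: pairs_def)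
      then show "p \<in> (\<Union>j\<in>{1..<Suc N}. (\<lambda>i. (i, j)) ` {1..<j})"
        by (intro UN_I[of j]) auto
    qed
  qed (auto simp: pairs_def)
  finally show ?thesis .
qed

lemma solset_subset: "solset a N E \<subseteq> {1..N}"
  by (auto simp: solset_def)

lemma finite_solset: "finite (solset a N E)"
  by (rule finite_subset[OF solset_subset]) simp

lemma solset_antimono: "E \<subseteq> E' \<Longrightarrow> solset a N E' \<subseteq> solset a N E"
proof
  fix i assume E: "E \<subseteq> E'" and i: "i \<in> solset a N E'"
  have "card (graph_cluster {1..N} E i) \<le> card (graph_cluster {1..N} E' i)"
    by (intro card_mono finite_graph_cluster graph_cluster_mono E) simp
  with i show "i \<in> solset a N E" by (simp add: solset_def)
qed

lemma solset_cluster_closed: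
  assumes "i \<in> solset a N E" "j \<in> graph_cluster {1..N} E i"
  shows "j \<in> solset a N E"
proof -
  have "graph_cluster {1..N} E j = graph_cluster {1..N} E i"
    using assms(2) by (rule graph_cluster_cong)
  moreover have "j \<in> {1..N}" using assms(2) graph_cluster_subset by blast
  ultimately show ?thesis using assms(1) by (simp add: solset_def)
qed

lemma solset_no_cross:
  assumes "E \<subseteq> ipairs {1..N}"
  shows "E \<inter> crossp (solset a N E) {1..N} = {}"
proof (rule ccontr)
  assume "E \<inter> crossp (solset a N E) {1..N} \<noteq> {}"
  then obtain x y where xy: "(x, y) \<in> E" "x \<in> {1..N}" "y \<in> {1..N}"
    "(x \<in> solset a N E) \<noteq> (y \<in> solset a N E)"
    by (auto simp: crossp_def ipairs_def)
  have "graph_cluster {1..N} E x = graph_cluster {1..N} E y"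
    by (rule graph_cluster_edge) (use xy in auto)
  with xy show False by (simp add: solset_def)
qed

lemma fold_link_step_mono: "E \<subseteq> fold (link_step a N e t) us E"
proof (induction us arbitrary: E)
  case (Cons p us)
  have "E \<subseteq> link_step a N e t p E" by (auto simp: link_step_def)
  also have "... \<subseteq> fold (link_step a N e t) us (link_step a N e t p E)" by (rule Cons.IH)
  finally show ?case by simp
qed simp

lemma run_links_mono: "run_links a N e t us \<subseteq> run_links a N e t (us @ vs)"
  using fold_link_step_mono[of "run_links a N e t us" a N e t vs] by simp

lemma run_links_subset: "run_links a N e t us \<subseteq> {p \<in> set us. e p \<le> t}"
  by (induction us rule: rev_induct) (auto simp: link_step_def)

text \<open>The set in solution only shrinks along a run. So ends that are in small clusters finally
  were so when \<open>p\<close> was processed, and its link was not refused.\<close>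

lemma run_links_complete:
  assumes "p \<in> set us" "e p \<le> t" "p \<in> ipairs (solset a N (run_links a N e t us))"
  shows "p \<in> run_links a N e t us"
  using assms
proof (induction us rule: rev_induct)
  case (snoc q us)
  let ?E = "run_links a N e t us" and ?E' = "run_links a N e t (us @ [q])"
  have sub: "solset a N ?E' \<subseteq> solset a N ?E" by (intro solset_antimono run_links_mono)
  have pE: "p \<in> ipairs (solset a N ?E)" using snoc.prems(3) ipairs_mono[OF sub] by blast
  show ?case
  proof (cases "p = q")
    case True
    have "link_step a N e t p ?E = insert p ?E"
      by (rule link_step_yes) (use pE snoc.prems(2) in \<open>auto simp: ipairs_def solset_def\<close>)
    then show ?thesis using True by simp
  next
    case False
    then have "p \<in> ?E" using snoc pE by auto
    then show ?thesis using run_links_mono by blast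
  qed
qed simp

section \<open>Merging of clusters and histories\<close>

text \<open>The union of the two clusters has no link to the outside, before or after the insertion.
  Hence the new link joins the two and leaves every other cluster as it was.\<close>

lemma graph_cluster_insert:
  assumes "E \<subseteq> ipairs V" "(i, j) \<in> ipairs V"
  shows "x \<in> graph_cluster V E i \<union> graph_cluster V E j \<Longrightarrow>
           graph_cluster V (insert (i, j) E) x = graph_cluster V E i \<union> graph_cluster V E j"
    and "x \<in> V - (graph_cluster V E i \<union> graph_cluster V E j) \<Longrightarrow>
           graph_cluster V (insert (i, j) E) x = graph_cluster V E x"
proof -
  let ?D = "graph_cluster V E i \<union> graph_cluster V E j"
  let ?E = "insert (i, j) E"
  have ij: "i \<in> V" "j \<in> V" using assms(2) by (auto simp: ipairs_def)
  have iD: "i \<in> graph_cluster V E i" "j \<in> graph_cluster V E j" using ij graph_cluster_self by auto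
  have sub: "?D \<subseteq> V" using graph_cluster_subset by blast
  have E': "?E \<subseteq> ipairs V" using assms by simp
  have cE: "E \<inter> crossp ?D V = {}"
  proof -
    have "crossp ?D V \<subseteq> crossp (graph_cluster V E i) V \<union> crossp (graph_cluster V E j) V"
      by (auto simp: crossp_def)
    then show ?thesis using graph_cluster_no_cross[OF assms(1)] by blast
  qed
  have c: "?E \<inter> crossp ?D V = {}" using cE iD by (auto simp: crossp_def)
  have mono: "graph_cluster V E y \<subseteq> graph_cluster V ?E y" for y
    by (rule graph_cluster_mono) auto
  have eqij: "graph_cluster V ?E i = graph_cluster V ?E j"
    by (rule graph_cluster_edge) (use ij in auto)
  have "graph_cluster V ?E i = graph_cluster ?D (?E \<inter> ipairs ?D) i"
    by (rule graph_cluster_restrict) (use sub E' c iD in auto)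
  then have "graph_cluster V ?E i \<subseteq> ?D" using graph_cluster_subset by simp
  moreover have "?D \<subseteq> graph_cluster V ?E i" using mono[of i] mono[of j] eqij by blast
  ultimately have D: "graph_cluster V ?E i = ?D" by blast
  show "graph_cluster V ?E x = ?D" if "x \<in> ?D"
  proof -
    have "x \<in> graph_cluster V ?E i" using that D by simp
    then show ?thesis using graph_cluster_cong D by metis
  qed
  show "graph_cluster V ?E x = graph_cluster V E x" if x: "x \<in> V - ?D"
  proof -
    have eq: "?E \<inter> ipairs (V - ?D) = E \<inter> ipairs (V - ?D)" using iD by (auto simp: ipairs_def)
    have "graph_cluster V ?E x = graph_cluster (V - ?D) (?E \<inter> ipairs (V - ?D)) x"
      by (rule graph_cluster_restrict) (use x E' c in \<open>auto simp: crossp_compl\<close>)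
    moreover have "graph_cluster V E x = graph_cluster (V - ?D) (E \<inter> ipairs (V - ?D)) x"
      by (rule graph_cluster_restrict) (use x assms cE in \<open>auto simp: crossp_compl\<close>)
    ultimately show ?thesis using eq by simp
  qed
qed

text \<open>The histories of a particle set: successive removal of newborn large clusters
  \<open>D\<close>, each formed during a cell \<open>(m h, (m + 1) h]\<close> of the time grid, until the remaining
  set has a size satisfying \<open>F\<close> and only small components at time \<open>M h\<close>.\<close>
primrec hist ::
  "real \<Rightarrow> real \<Rightarrow> nat \<Rightarrow> (nat \<Rightarrow> bool) \<Rightarrow> nat \<Rightarrow> nat set \<Rightarrow> (nat \<times> nat \<Rightarrow> real) \<Rightarrow> bool" where
  "hist a h M F 0 S e \<longleftrightarrow> F (card S) \<and> nolarge a S {p. e p \<le> real M * h}"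
| "hist a h M F (Suc r) S e \<longleftrightarrow> (\<exists>m<M. \<exists>D\<in>{D \<in> Pow S. a \<le> real (card D) \<and> real (card D) < 2 * a}.
      conn D {p. e p \<le> real (Suc m) * h} \<and> (\<forall>p\<in>crossp D S. real m * h < e p) \<and>
      hist a h M F r (S - D) e)"

lemma grid_cell:
  assumes "0 < x" "x \<le> real M * h" "h > 0"
  obtains m where "m < M" "real m * h < x" "x \<le> real (Suc m) * h"
proof -
  let ?n = "LEAST n. x \<le> real n * h"
  have 1: "x \<le> real ?n * h" by (rule LeastI[of _ M]) (rule assms(2))
  have "?n \<noteq> 0"
  proof
    assume "?n = 0"
    with 1 assms(1) show False by simp
  qed
  then obtain m where m: "?n = Suc m" by (cases ?n) auto
  have "\<not> x \<le> real m * h" by (rule not_less_Least) (simp add: m)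
  moreover have "?n \<le> M" by (rule Least_le) (rule assms(2))
  ultimately show thesis using that[of m] 1 m by auto
qed

text \<open>Induction over the links \<open>vs\<close> still to be processed, with the claim stated
  for the state after \<open>us\<close>. A link that changes the set in solution merges two clusters
  of size below \<open>a\<close> into a large one, hence of size below \<open>2 * a\<close>; this
  newborn cluster is the first step of the history, and the induction hypothesis supplies the
  rest.\<close>

lemma hist_exists:
  assumes "set (us @ vs) = pairs N" "sorted (map e (us @ vs))" "\<forall>p\<in>pairs N. 0 < e p"
    and "h > 0" "t = real M * h" "F (card (solset a N (run_links a N e t (us @ vs))))"
  shows "\<exists>r. real r * a \<le> real (card (solset a N (run_links a N e t us))) \<and>
             hist a h M F r (solset a N (run_links a N e t us)) e"
  using assms(1,2,6)
proof (induction vs arbitrary: us)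
  case Nil
  let ?V = "{1..N}"
  let ?E = "run_links a N e t us"
  let ?S = "solset a N ?E"
  have EV: "?E \<subseteq> ipairs ?V" using run_links_subset[of a N e t us] Nil by (auto simp: pairs_eq_ipairs)
  have eq: "{p. e p \<le> t} \<inter> ipairs ?S = ?E \<inter> ipairs ?S"
  proof -
    have "p \<in> ?E" if "e p \<le> t" "p \<in> ipairs ?S" for p
      by (rule run_links_complete)
        (use that Nil ipairs_mono[OF solset_subset[of a N ?E]] in \<open>auto simp: pairs_eq_ipairs\<close>)
    then show ?thesis using run_links_subset[of a N e t us] by blast
  qed
  have "nolarge a ?S {p. e p \<le> t}"
    unfolding nolarge_def no_large_comp_def fst_conv snd_conv eq
  proof
    fix i assume i: "i \<in> ?S"
    have "graph_cluster ?V ?E i = graph_cluster ?S (?E \<inter> ipairs ?S) i"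
      by (rule graph_cluster_restrict[OF solset_subset EV solset_no_cross[OF EV] i])
    moreover have "is_small a N ?E i" using i by (simp add: solset_def)
    ultimately show "real (card (graph_cluster ?S (?E \<inter> ipairs ?S) i)) < a" by simp
  qed
  then have "hist a h M F 0 ?S e" using Nil.prems(3) assms(5) by simp
  then show ?case by (intro exI[of _ 0]) auto
next
  case (Cons p vs)
  let ?V = "{1..N}"
  let ?E = "run_links a N e t us"
  let ?E' = "run_links a N e t (us @ [p])"
  let ?S = "solset a N ?E"
  obtain i j where p: "p = (i, j)" by (cases p)
  have pV: "(i, j) \<in> ipairs ?V" using Cons.prems(1) p by (auto simp: pairs_eq_ipairs)
  have EV: "?E \<subseteq> ipairs ?V" using run_links_subset[of a N e t us] Cons.prems(1)
    by (auto simp: pairs_eq_ipairs)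
  obtain r where r: "real r * a \<le> real (card (solset a N ?E'))" "hist a h M F r (solset a N ?E') e"
    using Cons.IH[of "us @ [p]"] Cons.prems by auto
  show ?case
  proof (cases "solset a N ?E' = ?S")
    case True
    then show ?thesis using r by auto
  next
    case False
    then have ne: "link_step a N e t p ?E \<noteq> ?E" by auto
    then have c: "e p \<le> t \<and> is_small a N ?E (fst p) \<and>
        is_small a N ?E (snd p)"
      using link_step_no by blast
    have E': "?E' = insert (i, j) ?E" using link_step_yes[of e p t N ?E a] c p by simp
    have ept: "e p \<le> t" and iS: "i \<in> ?S" and jS: "j \<in> ?S"
      using p pV c by (auto simp: solset_def ipairs_def)
    let ?D = "graph_cluster ?V ?E i \<union> graph_cluster ?V ?E j"
    have DS: "?D \<subseteq> ?S" using solset_cluster_closed iS jS by blast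
    have fD: "finite ?D" using DS finite_solset finite_subset by blast
    note ins = graph_cluster_insert[OF EV pV, folded E']
    have out: "k \<in> solset a N ?E' \<longleftrightarrow> k \<in> ?S" if "k \<notin> ?D" for k
    proof (cases "k \<in> ?V")
      case True
      then have "k \<in> ?V - ?D" using that by blast
      from ins(2)[OF this] show ?thesis by (simp add: solset_def)
    next
      case False
      then show ?thesis using solset_subset by blast
    qed
    have inn: "k \<in> solset a N ?E' \<longleftrightarrow> real (card ?D) < a" if "k \<in> ?D" for k
    proof -
      have "k \<in> ?V" using that graph_cluster_subset by blast
      then show ?thesis using ins(1)[OF that] by (simp add: solset_def)
    qed
    have large: "a \<le> real (card ?D)"
    proof (rule ccontr)
      assume "\<not> a \<le> real (card ?D)"
      then have lt: "real (card ?D) < a" by linarith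
      have "k \<in> solset a N ?E' \<longleftrightarrow> k \<in> ?S" for k
      proof (cases "k \<in> ?D")
        case True
        then have "k \<in> solset a N ?E'" using inn[OF True] lt by blast
        moreover have "k \<in> ?S" using True DS by (rule rev_subsetD)
        ultimately show ?thesis by blast
      qed (rule out)
      with False show False by blast
    qed
    have S': "solset a N ?E' = ?S - ?D"
    proof (rule set_eqI)
      fix k show "k \<in> solset a N ?E' \<longleftrightarrow> k \<in> ?S - ?D"
      proof (cases "k \<in> ?D")
        case True
        then show ?thesis using inn[OF True] large by simp
      next
        case nD: False
        then show ?thesis using out[OF nD] by blast
      qed
    qed
    have "card ?D \<le> card (graph_cluster ?V ?E i) + card (graph_cluster ?V ?E j)"
      by (rule card_Un_le)
    then have small: "real (card ?D) < 2 * a" using iS jS by (auto simp: solset_def)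
    obtain m where m: "m < M" "real m * h < e p" "e p \<le> real (Suc m) * h"
      using grid_cell[of "e p" M h] assms(3-5) Cons.prems(1) ept by auto
    have D': "?D = graph_cluster ?V ?E' i" using ins(1)[of i] graph_cluster_self[of i ?V] pV
      by (auto simp: ipairs_def)
    have E'V: "?E' \<subseteq> ipairs ?V" using E' EV pV by auto
    have le: "e q \<le> e p" if "q \<in> ?E'" for q
      using that Cons.prems(2) run_links_subset[of a N e t "us @ [p]"] by (auto simp: sorted_append)
    have "conn ?D ?E'" unfolding D' by (rule conn_graph_cluster[OF E'V])
    then have "conn ?D {q. e q \<le> real (Suc m) * h}"
      by (rule conn_mono) (use le m(3) order_trans in blast)
    \<comment> \<open>A cross link processed before \<open>p\<close> and rung by \<open>t\<close>
      would have been created, as both its ends were in solution. So \<open>q\<close> comes after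
      \<open>p\<close> in the list or rings after \<open>t\<close>, and in both cases not before
      \<open>e p\<close>.\<close>
    moreover have "\<forall>q\<in>crossp ?D ?S. real m * h < e q"
    proof
      fix q assume q: "q \<in> crossp ?D ?S"
      have qV: "q \<in> crossp ?D ?V" using q solset_subset[of a N ?E] by (auto simp: crossp_def ipairs_def)
      have "q \<notin> ?E'" using graph_cluster_no_cross[OF E'V, of i] qV D' by auto
      then have nE: "q \<notin> ?E" "q \<noteq> p" using E' p by auto
      show "real m * h < e q"
      proof (cases "e q \<le> t")
        case False
        then show ?thesis using m ept by linarith
      next
        case True
        have "q \<notin> set us"
          using nE(1) run_links_complete[of q us e t a N] True q crossp_subset[of ?D ?S] by blast
        then have "q \<in> set vs" using nE(2) Cons.prems(1) qV crossp_subset[of ?D ?V]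
          by (auto simp: pairs_eq_ipairs)
        then have "e p \<le> e q" using Cons.prems(2) by (auto simp: sorted_append)
        then show ?thesis using m by linarith
      qed
    qed
    moreover have "?D \<in> {D \<in> Pow ?S. a \<le> real (card D) \<and> real (card D) < 2 * a}"
      using DS large small by blast
    moreover have "hist a h M F r (?S - ?D) e" using r(2) S' by simp
    ultimately have "hist a h M F (Suc r) ?S e"
      unfolding hist.simps(2) using m(1) by blast
    \<comment> \<open>Each removed cluster has at least \<open>a\<close> particles; this later
      bounds the number of steps by \<open>N / a\<close>.\<close>
    moreover have "real (Suc r) * a \<le> real (card ?S)"
    proof -
      have "card ?S = card (?S - ?D) + card ?D"
        using card_Diff_subset[OF fD DS] card_mono[OF finite_solset DS] by simp
      then show ?thesis using r(1) S' large by (simp add: algebra_simps)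
    qed
    ultimately show ?thesis by blast
  qed
qed

text \<open>This event does not depend on the clocks inside \<open>S\<close>: it says that the process run without the
  clocks inside \<open>S\<close> never touches \<open>S\<close> and leaves no other particle in solution.\<close>
definition outside_event :: "real \<Rightarrow> nat \<Rightarrow> (nat \<times> nat \<Rightarrow> real) \<Rightarrow> real \<Rightarrow> nat set \<Rightarrow> bool" where
  "outside_event a N e t S \<longleftrightarrow>
     (let E = run_links a N e t (filter (\<lambda>p. p \<notin> ipairs S) (sort_key e (pairs_list N)))
      in E \<subseteq> ipairs ({1..N} - S) \<and> solset a N E \<subseteq> S)"

section \<open>Separating the clocks inside a set from the others\<close>

context
  fixes a :: real and N :: nat and e :: "nat \<times> nat \<Rightarrow> real" and t :: real and S :: "nat set"
  assumes SV: "S \<subseteq> {1..N}"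
begin

abbreviation (input) outer :: "(nat \<times> nat) list \<Rightarrow> (nat \<times> nat) list" where
  "outer us \<equiv> filter (\<lambda>p. p \<notin> ipairs S) us"

lemma cluster_outside:
  assumes "E \<subseteq> ipairs S \<union> ipairs ({1..N} - S)" "E' \<subseteq> ipairs S \<union> ipairs ({1..N} - S)"
    and "E - ipairs S = E' - ipairs S" "i \<in> {1..N} - S"
  shows "graph_cluster {1..N} E i = graph_cluster {1..N} E' i"
proof -
  let ?V = "{1..N}"
  have sub: "ipairs S \<union> ipairs (?V - S) \<subseteq> ipairs ?V" using SV by (auto simp: ipairs_def)
  have dj: "(ipairs S \<union> ipairs (?V - S)) \<inter> crossp (?V - S) ?V = {}"
    by (auto simp: crossp_def ipairs_def)
  have "graph_cluster ?V E i = graph_cluster (?V - S) (E \<inter> ipairs (?V - S)) i"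
    by (rule graph_cluster_restrict) (use assms sub dj in blast)+
  moreover have "graph_cluster ?V E' i = graph_cluster (?V - S) (E' \<inter> ipairs (?V - S)) i"
    by (rule graph_cluster_restrict) (use assms sub dj in blast)+
  moreover have "E \<inter> ipairs (?V - S) = E' \<inter> ipairs (?V - S)"
  proof -
    have "ipairs S \<inter> ipairs (?V - S) = {}" by (auto simp: ipairs_def)
    then show ?thesis using assms(3) by blast
  qed
  ultimately show ?thesis by simp
qed

lemma cluster_inside:
  assumes "E \<subseteq> ipairs S \<union> ipairs ({1..N} - S)" "i \<in> S"
  shows "graph_cluster {1..N} E i = graph_cluster S (E \<inter> ipairs S) i"
  by (rule graph_cluster_restrict) (use assms SV in \<open>fastforce simp: crossp_def ipairs_def\<close>)+

text \<open>As long as no link joins \<open>S\<close> to the other particles, the two parts do not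
  see each other. Inside \<open>S\<close> no cluster ever becomes large, so every rung clock creates
  its link; outside, each decision is the same as in the run without the clocks inside
  \<open>S\<close>.\<close>

lemma run_links_decompose:
  assumes "nolarge a S {p. e p \<le> t}" "set us \<subseteq> pairs N"
    and "run_links a N e t (outer us) \<subseteq> ipairs ({1..N} - S)"
  shows "run_links a N e t us = run_links a N e t (outer us) \<union> {p \<in> set us \<inter> ipairs S. e p \<le> t}"
  using assms(2,3)
proof (induction us rule: rev_induct)
  case (snoc p us)
  let ?V = "{1..N}"
  let ?E = "run_links a N e t us" and ?E' = "run_links a N e t (outer us)"
  let ?T = "{p \<in> set us \<inter> ipairs S. e p \<le> t}"
  have "?E' \<subseteq> run_links a N e t (outer (us @ [p]))"
    using run_links_mono[of a N e t "outer us" "outer [p]"] by simp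
  then have E'sub: "?E' \<subseteq> ipairs (?V - S)" using snoc.prems(2) by blast
  have IH: "?E = ?E' \<union> ?T" using snoc.IH snoc.prems(1) E'sub by simp
  obtain i j where p: "p = (i, j)" by (cases p)
  have pV: "i < j" "i \<in> ?V" "j \<in> ?V" using snoc.prems(1) p by (auto simp: pairs_eq_ipairs ipairs_def)
  have Esub: "?E \<subseteq> ipairs S \<union> ipairs (?V - S)" using IH E'sub by blast
  have dj: "ipairs S \<inter> ipairs (?V - S) = {}" by (auto simp: ipairs_def)
  have small: "is_small a N ?E k" if "k \<in> S" for k
  proof -
    have "graph_cluster ?V ?E k = graph_cluster S (?E \<inter> ipairs S) k"
      by (rule cluster_inside[OF Esub that])
    also have "... \<subseteq> graph_cluster S ({p. e p \<le> t} \<inter> ipairs S) k"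
      by (rule graph_cluster_mono) (use IH E'sub dj in blast)
    finally have "card (graph_cluster ?V ?E k) \<le> card (graph_cluster S ({p. e p \<le> t} \<inter> ipairs S) k)"
      by (intro card_mono finite_graph_cluster) (use SV finite_subset in blast)+
    then show ?thesis using assms(1) that unfolding nolarge_def no_large_comp_def by force
  qed
  have same: "graph_cluster ?V ?E k = graph_cluster ?V ?E' k" if "k \<in> ?V - S" for k
    by (rule cluster_outside) (use that Esub E'sub IH dj in blast)+
  have iso: "is_small a N ?E' k" if "k \<in> S" for k
  proof -
    have "card (graph_cluster ?V ?E' k) \<le> card (graph_cluster ?V ?E k)"
      by (intro card_mono finite_graph_cluster graph_cluster_mono) (use IH in auto)
    then show ?thesis using small[OF that] by simp
  qed
  show ?case
  proof (cases "p \<in> ipairs S")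
    case True
    then have "p \<in> pairs N" and ij: "i \<in> S" "j \<in> S" using snoc.prems(1) p by (auto simp: ipairs_def)
    show ?thesis
    proof (cases "e p \<le> t")
      case et: True
      have "link_step a N e t p ?E = insert p ?E"
        by (rule link_step_yes) (use et small ij p in auto)
      moreover have "{q \<in> set (us @ [p]) \<inter> ipairs S. e q \<le> t} = insert p ?T" using True et by auto
      ultimately show ?thesis using True IH by simp
    next
      case et: False
      have "link_step a N e t p ?E = ?E" by (rule link_step_no) (use et in simp)
      moreover have "{q \<in> set (us @ [p]) \<inter> ipairs S. e q \<le> t} = ?T" using et by auto
      ultimately show ?thesis using True IH by simp
    qed
  next
    case False
    have step: "link_step a N e t p ?E' \<subseteq> ipairs (?V - S)" using snoc.prems(2) False by simp
    have "link_step a N e t p ?E = link_step a N e t p ?E' \<union> ?T"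
    proof (cases "p \<in> ipairs (?V - S)")
      case True
      then have ij: "i \<in> ?V - S" "j \<in> ?V - S" using p by (auto simp: ipairs_def)
      have "link_step a N e t p ?E - ?T = link_step a N e t p ?E' - ?T"
        by (rule link_step_same) (use IH same ij p in auto)
      moreover have "?T \<subseteq> link_step a N e t p ?E" "link_step a N e t p ?E' \<inter> ?T = {}"
        using IH link_step_or[of a N e t p ?E] step dj by auto
      ultimately show ?thesis by blast
    next
      case nin: False
      then have cr: "(i \<in> S) \<noteq> (j \<in> S)" using False p pV by (auto simp: ipairs_def)
      have n: "\<not> (e p \<le> t \<and> is_small a N ?E' i \<and> is_small a N ?E' j)"
        using step nin p link_step_yes[of e p t N ?E' a] by auto
      \<comment> \<open>The end in \<open>S\<close> has a small cluster in both runs. So the refusal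
        is due to the clock or to the other end, whose cluster is the same in both runs.\<close>
      then have n': "\<not> (e p \<le> t \<and> is_small a N ?E i \<and> is_small a N ?E j)"
        using cr iso same pV by (cases "i \<in> S") auto
      have "link_step a N e t p ?E = ?E" by (rule link_step_no) (use n' p in simp)
      moreover have "link_step a N e t p ?E' = ?E'" by (rule link_step_no) (use n p in simp)
      ultimately show ?thesis using IH by simp
    qed
    moreover have "{q \<in> set (us @ [p]) \<inter> ipairs S. e q \<le> t} = ?T" using False by auto
    ultimately show ?thesis using False by simp
  qed
qed simp

text \<open>Here the final solution is known to be \<open>S\<close>, so the complete run never links
  \<open>S\<close> to its complement and keeps the particles of \<open>S\<close> in small clusters
  at all times. The list \<open>vs\<close> of links to come lets an induction over prefixes refer to
  the final state.\<close>

lemma run_links_outer: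
  assumes "set (us @ vs) = pairs N" "solset a N (run_links a N e t (us @ vs)) = S"
  shows "run_links a N e t (outer us) = run_links a N e t us - ipairs S"
  using assms
proof (induction us arbitrary: vs rule: rev_induct)
  case (snoc p us)
  let ?V = "{1..N}"
  let ?E = "run_links a N e t us" and ?E' = "run_links a N e t (outer us)"
  let ?F = "run_links a N e t (us @ [p] @ vs)"
  have IH: "?E' = ?E - ipairs S" using snoc.IH[of "p # vs"] snoc.prems by simp
  have FV: "?F \<subseteq> ipairs ?V" using run_links_subset[of a N e t "us @ [p] @ vs"] snoc.prems(1)
    by (auto simp: pairs_eq_ipairs)
  have split: "ipairs ?V = ipairs S \<union> ipairs (?V - S) \<union> crossp S ?V"
    by (rule ipairs_split[OF SV])
  have Fsub: "?F \<subseteq> ipairs S \<union> ipairs (?V - S)"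
    using solset_no_cross[OF FV] snoc.prems(2) FV split by auto
  have EF: "?E \<subseteq> ?F" using run_links_mono[of a N e t us "[p] @ vs"] by simp
  have sF: "link_step a N e t p ?E \<subseteq> ?F"
    using run_links_mono[of a N e t "us @ [p]" vs] by simp
  have Esub: "?E \<subseteq> ipairs S \<union> ipairs (?V - S)" using EF Fsub by blast
  obtain i j where p: "p = (i, j)" by (cases p)
  have pV: "i < j" "i \<in> ?V" "j \<in> ?V" using snoc.prems(1) p by (auto simp: pairs_eq_ipairs ipairs_def)
  have same: "graph_cluster ?V ?E k = graph_cluster ?V ?E' k" if "k \<in> ?V - S" for k
    by (rule cluster_outside) (use that Esub IH in blast)+
  have small: "is_small a N ?E k" if "k \<in> S" for k
    using solset_antimono[OF EF, of a N] snoc.prems(2) that by (auto simp: solset_def)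
  show ?case
  proof (cases "p \<in> ipairs S")
    case True
    then have "link_step a N e t p ?E - ipairs S = ?E - ipairs S"
      using link_step_or[of a N e t p ?E] by (elim disjE) simp_all
    then show ?thesis using IH True by simp
  next
    case False
    have "link_step a N e t p ?E' = link_step a N e t p ?E - ipairs S"
    proof (cases "p \<in> ipairs (?V - S)")
      case True
      then have ij: "i \<in> ?V - S" "j \<in> ?V - S" using p by (auto simp: ipairs_def)
      have "link_step a N e t p ?E' - ipairs S = link_step a N e t p ?E - ipairs S"
        by (rule link_step_same) (use IH same ij p in auto)
      moreover have "link_step a N e t p ?E' \<inter> ipairs S = {}"
        using IH False link_step_or[of a N e t p ?E'] by auto
      ultimately show ?thesis by blast
    next
      case nin: False
      then have cr: "(i \<in> S) \<noteq> (j \<in> S)" using False p pV by (auto simp: ipairs_def)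
      have n: "\<not> (e p \<le> t \<and> is_small a N ?E i \<and> is_small a N ?E j)"
        using sF Fsub nin False p link_step_yes[of e p t N ?E a] by auto
      then have n': "\<not> (e p \<le> t \<and> is_small a N ?E' i \<and> is_small a N ?E' j)"
        using cr small same pV by (cases "i \<in> S") auto
      have "link_step a N e t p ?E = ?E" by (rule link_step_no) (use n p in simp)
      moreover have "link_step a N e t p ?E' = ?E'" by (rule link_step_no) (use n' p in simp)
      ultimately show ?thesis using IH by simp
    qed
    then show ?thesis using False by simp
  qed
qed simp

text \<open>From left to right this rests on \<open>run_links_outer\<close>, from right to left on
  \<open>run_links_decompose\<close>. Its use is that the two conditions on the right live on
  disjoint sets of clocks.\<close>

lemma sol_eq_iff: "sol a N e t = S \<longleftrightarrow> nolarge a S {p. e p \<le> t} \<and> outside_event a N e t S"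
proof -
  let ?V = "{1..N}"
  let ?ys = "sort_key e (pairs_list N)"
  let ?E = "run_links a N e t ?ys" and ?E' = "run_links a N e t (outer ?ys)"
  have ys: "set ?ys = pairs N" by (simp add: set_pairs_list)
  have sol: "sol a N e t = solset a N ?E" by (simp add: sol_eq_solset links_eq_run)
  have EV: "?E \<subseteq> ipairs ?V" using run_links_subset[of a N e t ?ys] ys by (auto simp: pairs_eq_ipairs)
  have Spairs: "ipairs S \<subseteq> pairs N" using ipairs_mono[OF SV] by (simp add: pairs_eq_ipairs)
  have dj: "ipairs S \<inter> ipairs (?V - S) = {}" by (auto simp: ipairs_def)
  show ?thesis
  proof
    assume L: "sol a N e t = S"
    have E': "?E' = ?E - ipairs S"
      by (rule run_links_outer[where vs = "[]"]) (use ys L sol in auto)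
    have Esub: "?E \<subseteq> ipairs S \<union> ipairs (?V - S)"
      using solset_no_cross[OF EV, of a] L sol EV ipairs_split[OF SV] by auto
    have eq: "{p. e p \<le> t} \<inter> ipairs S = ?E \<inter> ipairs S"
    proof -
      have "p \<in> ?E" if "e p \<le> t" "p \<in> ipairs S" for p
        by (rule run_links_complete) (use that ys Spairs L sol in auto)
      then show ?thesis using run_links_subset[of a N e t ?ys] by blast
    qed
    have "nolarge a S {p. e p \<le> t}"
      unfolding nolarge_def no_large_comp_def fst_conv snd_conv eq
    proof
      fix i assume i: "i \<in> S"
      then have "is_small a N ?E i" using L sol by (auto simp: solset_def)
      then show "real (card (graph_cluster S (?E \<inter> ipairs S) i)) < a"
        using cluster_inside[OF Esub i] by simp
    qed
    moreover have "?E' \<subseteq> ipairs (?V - S)" using E' Esub by blast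
    moreover have "solset a N ?E' \<subseteq> S"
    proof (rule ccontr)
      assume "\<not> solset a N ?E' \<subseteq> S"
      then obtain i where i: "i \<in> solset a N ?E'" "i \<notin> S" by blast
      have "graph_cluster ?V ?E i = graph_cluster ?V ?E' i"
        by (rule cluster_outside) (use i Esub E' solset_subset in blast)+
      then have "i \<in> solset a N ?E" using i by (simp add: solset_def)
      then show False using i L sol by simp
    qed
    ultimately show "nolarge a S {p. e p \<le> t} \<and> outside_event a N e t S"
      by (simp add: outside_event_def)
  next
    assume R: "nolarge a S {p. e p \<le> t} \<and> outside_event a N e t S"
    then have E'sub: "?E' \<subseteq> ipairs (?V - S)" and sS: "solset a N ?E' \<subseteq> S"
      by (auto simp: outside_event_def Let_def)
    have E: "?E = ?E' \<union> {p \<in> set ?ys \<inter> ipairs S. e p \<le> t}"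
      by (rule run_links_decompose) (use R E'sub ys in auto)
    have Esub: "?E \<subseteq> ipairs S \<union> ipairs (?V - S)" using E E'sub by blast
    have ES: "?E \<inter> ipairs S = {p. e p \<le> t} \<inter> ipairs S" using E E'sub dj ys Spairs by blast
    have "i \<in> solset a N ?E \<longleftrightarrow> i \<in> S" if i: "i \<in> ?V" for i
    proof (cases "i \<in> S")
      case True
      then have "is_small a N ?E i"
        using cluster_inside[OF Esub True] ES R by (auto simp: nolarge_def no_large_comp_def)
      then show ?thesis using True i by (simp add: solset_def)
    next
      case False
      have "graph_cluster ?V ?E i = graph_cluster ?V ?E' i"
        by (rule cluster_outside) (use i False Esub E'sub E in blast)+
      then show ?thesis using False i sS by (auto simp: solset_def)
    qed
    then show "sol a N e t = S" using sol SV solset_subset[of a N ?E] by blast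
  qed
qed

end

section \<open>Dependence on the order of the clocks and on the rung ones\<close>

lemma insort_key_cong:
  assumes "\<forall>q\<in>set xs. (e p \<le> e q) = (e' p \<le> e' q)"
  shows "insort_key e p xs = insort_key e' p xs"
  using assms by (induction xs) auto

lemma sort_key_order_cong:
  fixes e e' :: "'a \<Rightarrow> 'b::linorder"
  assumes "\<forall>p\<in>set xs. \<forall>q\<in>set xs. (e p \<le> e q) = (e' p \<le> e' q)"
  shows "sort_key e xs = sort_key e' xs"
  using assms
proof (induction xs)
  case (Cons p xs)
  have "sort_key e xs = sort_key e' xs" using Cons by simp
  moreover have "insort_key e p (sort_key e' xs) = insort_key e' p (sort_key e' xs)"
    by (rule insort_key_cong) (use Cons.prems in auto)
  ultimately show ?case by simp
qed simp

lemma run_links_cong: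
  assumes "\<forall>p\<in>set us. (e p \<le> t) = (e' p \<le> t')"
  shows "run_links a N e t us = run_links a N e' t' us"
proof -
  have "fold (link_step a N e t) us E = fold (link_step a N e' t') us E" for E
    using assms by (induction us arbitrary: E) (auto simp: link_step_def)
  then show ?thesis .
qed

text \<open>Two times appear because clocks and time may move together, as in
  \<open>skorokhod_conv_rounded\<close>, or time alone, as in \<open>cadlag_nsol\<close>.\<close>

lemma links_cong:
  assumes "\<forall>p\<in>pairs N. \<forall>q\<in>pairs N. (e p \<le> e q) = (e' p \<le> e' q)"
    and "\<forall>p\<in>pairs N. (e p \<le> t) = (e' p \<le> t')"
  shows "links a N e t = links a N e' t'"
proof -
  have "sort_key e (pairs_list N) = sort_key e' (pairs_list N)"
    by (rule sort_key_order_cong) (use assms(1) in \<open>simp add: set_pairs_list\<close>)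
  then show ?thesis
    unfolding links_eq_run using run_links_cong[of "sort_key e' (pairs_list N)" e t e' t'] assms(2)
    by (simp add: set_pairs_list)
qed

lemma outside_event_cong:
  assumes "\<forall>p\<in>pairs N - ipairs S. \<forall>q\<in>pairs N - ipairs S. (e p \<le> e q) = (e' p \<le> e' q)"
    and "\<forall>p\<in>pairs N - ipairs S. (e p \<le> t) = (e' p \<le> t)"
  shows "outside_event a N e t S = outside_event a N e' t S"
proof -
  let ?xs = "filter (\<lambda>p. p \<notin> ipairs S) (pairs_list N)"
  have "sort_key e ?xs = sort_key e' ?xs"
    by (rule sort_key_order_cong) (use assms(1) in \<open>simp add: set_pairs_list\<close>)
  moreover have "run_links a N e t (sort_key e' ?xs) = run_links a N e' t (sort_key e' ?xs)"
    by (rule run_links_cong) (use assms(2) in \<open>simp add: set_pairs_list\<close>)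
  \<comment> \<open>Filtering commutes with sorting, so the clocks inside \<open>S\<close> are
    discarded before any comparison.\<close>
  ultimately show ?thesis by (simp add: outside_event_def filter_sort)
qed

section \<open>Random subsets with independent elements\<close>

definition rsub :: "'a set \<Rightarrow> real \<Rightarrow> 'a set pmf" where
  "rsub I p = map_pmf (\<lambda>b. {x \<in> I. b x}) (Pi_pmf I False (\<lambda>_. bernoulli_pmf p))"

abbreviation rsub_prob :: "'a set \<Rightarrow> real \<Rightarrow> ('a set \<Rightarrow> bool) \<Rightarrow> real" where
  "rsub_prob I p R \<equiv> measure_pmf.prob (rsub I p) {A. R A}"

lemma ER_eq_rsub: "ER k p = map_pmf (\<lambda>A. ({1..k}, A)) (rsub (pairs k) p)"
  by (simp add: ER_def rsub_def map_pmf_comp)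

text \<open>Events that constrain each element separately are boxes of the product law;
  \<open>pmf_rsub\<close> and \<open>prob_rsub_supset\<close> are the two instances.\<close>

lemma prob_rsub_Pi:
  assumes "finite I"
  shows "rsub_prob I p (\<lambda>A. (\<lambda>x. x \<in> I \<inter> A) \<in> Pi I B) =
    (\<Prod>x\<in>I. measure_pmf.prob (bernoulli_pmf p) (B x))"
proof -
  have "rsub_prob I p (\<lambda>A. (\<lambda>x. x \<in> I \<inter> A) \<in> Pi I B) =
      measure_pmf.prob (Pi_pmf I False (\<lambda>_. bernoulli_pmf p)) (Pi I B)"
    unfolding rsub_def measure_map_pmf
    by (rule arg_cong2[where f = measure]) (auto simp: Pi_iff)
  also have "... = (\<Prod>x\<in>I. measure_pmf.prob (bernoulli_pmf p) (B x))"
    by (rule measure_Pi_pmf_Pi[OF assms])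
  finally show ?thesis .
qed

lemma prob_bernoulli:
  assumes "0 \<le> p" "p \<le> 1"
  shows "measure_pmf.prob (bernoulli_pmf p) {True} = p"
    "measure_pmf.prob (bernoulli_pmf p) {False} = 1 - p"
  using assms by (simp_all add: measure_pmf_single)

lemma set_pmf_rsub: "A \<in> set_pmf (rsub I p) \<Longrightarrow> A \<subseteq> I"
  by (auto simp: rsub_def)

lemma prob_rsub_cong:
  assumes "\<And>A. A \<subseteq> I \<Longrightarrow> P A \<longleftrightarrow> Q A"
  shows "rsub_prob I p (\<lambda>A. P A) = rsub_prob I p (\<lambda>A. Q A)"
  using assms set_pmf_rsub[of _ I p]
  by (intro measure_pmf.finite_measure_eq_AE) (auto simp: AE_measure_pmf_iff)

lemma pmf_rsub:
  assumes "finite I" "0 \<le> p" "p \<le> 1" "A \<subseteq> I"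
  shows "pmf (rsub I p) A = p ^ card A * (1 - p) ^ card (I - A)"
proof -
  have "pmf (rsub I p) A = rsub_prob I p (\<lambda>A'. A' = A)"
    by (simp add: measure_pmf_single)
  also have "... = rsub_prob I p (\<lambda>A'. (\<lambda>x. x \<in> I \<inter> A') \<in> Pi I (\<lambda>x. {x \<in> A}))"
    by (rule prob_rsub_cong) (use assms(4) in auto)
  also have "... = (\<Prod>x\<in>I. measure_pmf.prob (bernoulli_pmf p) {x \<in> A})"
    by (rule prob_rsub_Pi) fact
  also have "... = (\<Prod>x\<in>I. if x \<in> A then p else 1 - p)"
    by (rule prod.cong) (use prob_bernoulli[OF assms(2,3)] in auto)
  also have "... = p ^ card (I \<inter> A) * (1 - p) ^ card (I - A)"
    using assms(1) by (simp add: prod.If_cases Collect_neg_eq Diff_eq)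
  finally show ?thesis using assms(4) by (simp add: Int_absorb1)
qed

lemma prob_rsub_supset:
  assumes "finite I" "0 \<le> p" "p \<le> 1" "B \<subseteq> I"
  shows "rsub_prob I p (\<lambda>A. B \<subseteq> A) = p ^ card B"
proof -
  have "rsub_prob I p (\<lambda>A. B \<subseteq> A) =
      rsub_prob I p (\<lambda>A. (\<lambda>x. x \<in> I \<inter> A) \<in> Pi I (\<lambda>x. if x \<in> B then {True} else UNIV))"
    by (rule prob_rsub_cong) (use assms(4) in \<open>auto simp: Pi_iff split: if_splits\<close>)
  also have "... = (\<Prod>x\<in>I. measure_pmf.prob (bernoulli_pmf p) (if x \<in> B then {True} else UNIV))"
    by (rule prob_rsub_Pi) fact
  also have "... = (\<Prod>x\<in>I. if x \<in> B then p else 1)"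
    by (rule prod.cong) (use prob_bernoulli[OF assms(2,3)] in auto)
  also have "... = p ^ card (I \<inter> B)"
    using assms(1) by (simp add: prod.If_cases)
  finally show ?thesis using assms(4) by (simp add: Int_absorb1)
qed

lemma bernoulli_pmf_mult:
  assumes "0 \<le> p" "p \<le> 1" "0 \<le> q" "q \<le> 1"
  shows "bernoulli_pmf (p * q) = bind_pmf (bernoulli_pmf p) (\<lambda>b. if b then bernoulli_pmf q else return_pmf False)"
proof (rule pmf_eqI)
  fix b
  have "p * q \<le> 1" using assms by (simp add: mult_le_one)
  then show "pmf (bernoulli_pmf (p * q)) b =
      pmf (bind_pmf (bernoulli_pmf p) (\<lambda>b. if b then bernoulli_pmf q else return_pmf False)) b"
    using assms by (cases b) (simp_all add: pmf_bind algebra_simps)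
qed

text \<open>Keeping each element of a random subset with probability \<open>q\<close> preserves an increasing
  property with probability at least \<open>q ^ m\<close> if the property has witnesses of size \<open>m\<close>.\<close>
lemma prob_rsub_thinning:
  assumes I: "finite I" and p: "0 \<le> p" "p \<le> 1" and q: "0 \<le> q" "q \<le> 1"
    and R: "\<And>A. A \<subseteq> I \<Longrightarrow> R A \<Longrightarrow> \<exists>B\<subseteq>A. card B \<le> m \<and> (\<forall>C. B \<subseteq> C \<longrightarrow> C \<subseteq> I \<longrightarrow> R C)"
  shows "q ^ m * rsub_prob I p (\<lambda>A. R A) \<le> rsub_prob I (p * q) (\<lambda>A. R A)"
proof -
  define set where "set b = {x \<in> I. b x}" for b :: "'a \<Rightarrow> bool"
  define Bp where "Bp = Pi_pmf I False (\<lambda>_. bernoulli_pmf p)"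
  define K where "K f = Pi_pmf I False (\<lambda>x. if f x then bernoulli_pmf q else return_pmf False)" for f
  have bind: "Pi_pmf I False (\<lambda>_. bernoulli_pmf (p * q)) = bind_pmf Bp K"
    unfolding bernoulli_pmf_mult[OF p q] Bp_def K_def by (rule Pi_pmf_bind[OF I])
  \<comment> \<open>Given the first stage \<open>f\<close>, it is enough that every element of a
    witness \<open>B\<close> survives the second stage.\<close>
  have K: "q ^ m \<le> measure_pmf.prob (K f) {b. R (set b)}" if f: "R (set f)" for f
  proof -
    obtain B where B: "B \<subseteq> set f" "card B \<le> m" "\<And>C. B \<subseteq> C \<Longrightarrow> C \<subseteq> I \<Longrightarrow> R C"
      using R[of "set f"] f by (auto simp: set_def)
    have BI: "B \<subseteq> I" using B(1) by (auto simp: set_def)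
    have "q ^ m \<le> q ^ card B" by (rule power_decreasing) (use B q in auto)
    also have "... = (\<Prod>x\<in>I. if x \<in> B then q else 1)"
      using I BI by (simp add: prod.If_cases Int_absorb1)
    also have "... = (\<Prod>x\<in>I. measure_pmf.prob (if f x then bernoulli_pmf q else return_pmf False)
        (if x \<in> B then {True} else UNIV))"
      by (rule prod.cong) (use B(1) prob_bernoulli[OF q] in \<open>auto simp: set_def\<close>)
    also have "... = measure_pmf.prob (K f) (Pi I (\<lambda>x. if x \<in> B then {True} else UNIV))"
      unfolding K_def by (rule measure_Pi_pmf_Pi[OF I, symmetric])
    also have "... \<le> measure_pmf.prob (K f) {b. R (set b)}"
    proof (rule measure_pmf.finite_measure_mono)
      show "Pi I (\<lambda>x. if x \<in> B then {True} else UNIV) \<subseteq> {b. R (set b)}"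
      proof
        fix b assume b: "b \<in> Pi I (\<lambda>x. if x \<in> B then {True} else UNIV)"
        have "B \<subseteq> set b"
        proof
          fix x assume "x \<in> B"
          then have "b x \<in> {True}" using b BI by (auto simp: Pi_iff split: if_splits)
          then show "x \<in> set b" using \<open>x \<in> B\<close> BI by (auto simp: set_def)
        qed
        then show "b \<in> {b. R (set b)}" using B(3)[of "set b"] by (auto simp: set_def)
      qed
    qed simp
    finally show ?thesis .
  qed
  have "ennreal (q ^ m * measure_pmf.prob Bp {f. R (set f)}) = ennreal (q ^ m) * emeasure Bp {f. R (set f)}"
    using q by (simp add: measure_pmf.emeasure_eq_measure ennreal_mult)
  also have "... = (\<integral>\<^sup>+f. ennreal (q ^ m) * indicator {f. R (set f)} f \<partial>Bp)"
    by (simp add: nn_integral_cmult_indicator)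
  also have "... \<le> (\<integral>\<^sup>+f. emeasure (K f) {b. R (set b)} \<partial>Bp)"
    by (rule nn_integral_mono)
      (use K in \<open>auto simp: measure_pmf.emeasure_eq_measure indicator_def intro: ennreal_leI\<close>)
  also have "... = emeasure (bind_pmf Bp K) {b. R (set b)}"
    by (simp add: emeasure_bind_pmf)
  finally have "q ^ m * measure_pmf.prob Bp {f. R (set f)} \<le> measure_pmf.prob (bind_pmf Bp K) {b. R (set b)}"
    by (simp add: measure_pmf.emeasure_eq_measure)
  then show ?thesis
    unfolding rsub_def measure_map_pmf bind by (simp add: set_def vimage_def Bp_def)
qed

text \<open>Union bound over parent functions towards a fixed root. Their number d^(d-1) exceeds
  Cayley's count d^(d-2) of trees by the factor d, which is negligible on the exponential
  scale.\<close>

lemma prob_rsub_conn_le: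
  assumes D: "finite D" "D \<noteq> {}" and p: "0 \<le> p" "p \<le> 1"
  shows "rsub_prob (ipairs D) p (\<lambda>A. conn D A) \<le> real (card D) ^ (card D - 1) * p ^ (card D - 1)"
proof -
  obtain v where v: "v \<in> D" using D by blast
  \<comment> \<open>Distinct edges make each of these functions prescribe exactly
    \<open>card D - 1\<close> links.\<close>
  define F where "F = {f \<in> (D - {v}) \<rightarrow>\<^sub>E D. inj_on (parent_edge f) (D - {v}) \<and> parent_edge f ` (D - {v}) \<subseteq> ipairs D}"
  have finP: "finite ((D - {v}) \<rightarrow>\<^sub>E D)" using D by (intro finite_PiE) auto
  have finF: "finite F" by (rule finite_subset[OF _ finP]) (auto simp: F_def)
  have cardF: "card F \<le> card D ^ (card D - 1)"
  proof -
    have "card F \<le> card ((D - {v}) \<rightarrow>\<^sub>E D)" by (rule card_mono[OF finP]) (auto simp: F_def)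
    also have "... = card D ^ (card D - 1)" using D v by (simp add: card_PiE)
    finally show ?thesis .
  qed
  have "rsub_prob (ipairs D) p (\<lambda>A. conn D A) \<le>
      measure_pmf.prob (rsub (ipairs D) p) (\<Union>f\<in>F. {A. parent_edge f ` (D - {v}) \<subseteq> A})"
  proof (rule measure_pmf.finite_measure_mono)
    show "{A. conn D A} \<subseteq> (\<Union>f\<in>F. {A. parent_edge f ` (D - {v}) \<subseteq> A})"
    proof
      fix A assume "A \<in> {A. conn D A}"
      then have "conn D A" by simp
      obtain f where f: "f \<in> (D - {v}) \<rightarrow>\<^sub>E D" "inj_on (parent_edge f) (D - {v})" "parent_edge f ` (D - {v}) \<subseteq> A \<inter> ipairs D"
        by (rule conn_parent[OF \<open>conn D A\<close> v])
      then have "f \<in> F" by (auto simp: F_def)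
      then show "A \<in> (\<Union>f\<in>F. {A. parent_edge f ` (D - {v}) \<subseteq> A})" using f(3) by blast
    qed
  qed simp
  also have "... \<le> (\<Sum>f\<in>F. rsub_prob (ipairs D) p (\<lambda>A. parent_edge f ` (D - {v}) \<subseteq> A))"
    by (rule measure_pmf.finite_measure_subadditive_finite) (use finF in auto)
  also have "... = (\<Sum>f\<in>F. p ^ (card D - 1))"
  proof (rule sum.cong)
    fix f assume f: "f \<in> F"
    have "card (parent_edge f ` (D - {v})) = card D - 1"
      using f D v by (subst card_image) (auto simp: F_def)
    then show "rsub_prob (ipairs D) p (\<lambda>A. parent_edge f ` (D - {v}) \<subseteq> A) = p ^ (card D - 1)"
      using prob_rsub_supset[OF finite_ipairs[OF D(1)] p, of "parent_edge f ` (D - {v})"] f by (simp add: F_def)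
  qed simp
  also have "... = real (card F) * p ^ (card D - 1)" by simp
  also have "... \<le> real (card D ^ (card D - 1)) * p ^ (card D - 1)"
    by (rule mult_right_mono) (use cardF p in auto)
  finally show ?thesis by simp
qed

text \<open>The witness for the thinning is a spanning tree, which has \<open>card D - 1\<close>
  links.\<close>

lemma prob_rsub_conn_thinning:
  assumes D: "finite D" "D \<noteq> {}" and p: "0 < p" "p \<le> 1" and q: "0 \<le> q" "q \<le> p"
  shows "rsub_prob (ipairs D) p (\<lambda>A. conn D A) * (q / p) ^ (card D - 1)
      \<le> rsub_prob (ipairs D) q (\<lambda>A. conn D A)"
proof -
  obtain v where v: "v \<in> D" using D by blast
  have "(q / p) ^ (card D - 1) * rsub_prob (ipairs D) p (\<lambda>A. conn D A)
      \<le> rsub_prob (ipairs D) (p * (q / p)) (\<lambda>A. conn D A)"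
  proof (rule prob_rsub_thinning)
    fix A assume A: "A \<subseteq> ipairs D" "conn D A"
    obtain f where "f \<in> (D - {v}) \<rightarrow>\<^sub>E D" "inj_on (parent_edge f) (D - {v})"
      and f: "parent_edge f ` (D - {v}) \<subseteq> A \<inter> ipairs D"
      "conn D (parent_edge f ` (D - {v}))"
      by (rule conn_parent[OF A(2) v])
    have "card (parent_edge f ` (D - {v})) \<le> card (D - {v})"
      by (rule card_image_le) (use D in simp)
    then have "card (parent_edge f ` (D - {v})) \<le> card D - 1"
      using v D by simp
    then show "\<exists>B\<subseteq>A. card B \<le> card D - 1 \<and> (\<forall>C. B \<subseteq> C \<longrightarrow> C \<subseteq> ipairs D \<longrightarrow> conn D C)"
    proof (intro exI conjI allI impI)
      show "parent_edge f ` (D - {v}) \<subseteq> A" using f(1) by blast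
      show "conn D C" if "parent_edge f ` (D - {v}) \<subseteq> C" for C
        by (rule conn_mono[OF f(2)]) (use that in blast)
    qed
  qed (use p q finite_ipairs[OF D(1)] in simp_all)
  then show ?thesis using p by (simp add: mult.commute)
qed

section \<open>Events of the clocks\<close>

abbreviation clock :: "nat \<Rightarrow> real measure" where
  "clock N \<equiv> density lborel (exponential_density (1 / real N))"

lemma prob_space_clock: "N \<ge> 1 \<Longrightarrow> prob_space (clock N)"
  by (rule prob_space_exponential_density) simp

lemma prob_space_clock_space: "N \<ge> 1 \<Longrightarrow> prob_space (clock_space N)"
  unfolding clock_space_def by (intro prob_space_PiM prob_space_clock)

abbreviation clocks :: "nat \<Rightarrow> (nat \<times> nat \<Rightarrow> real) set" where
  "clocks N \<equiv> space (clock_space N)"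

lemma space_clock_space: "clocks N = pairs N \<rightarrow>\<^sub>E UNIV"
  by (simp add: clock_space_def space_PiM)

lemma measurable_clock_component [measurable]:
  "p \<in> pairs N \<Longrightarrow> (\<lambda>e. e p) \<in> borel_measurable (clock_space N)"
  unfolding clock_space_def
  using measurable_component_singleton[of p "pairs N" "\<lambda>_. clock N"] by (simp add: measurable_def)

lemma psol_bounds: "t \<ge> 0 \<Longrightarrow> 0 \<le> psol N t \<and> psol N t \<le> 1"
  by (simp add: psol_def)

lemma measure_clock_le:
  assumes "N \<ge> 1" "t \<ge> 0"
  shows "measure (clock N) {..t} = psol N t" "measure (clock N) {t<..} = 1 - psol N t"
proof -
  interpret prob_space "clock N" by (rule prob_space_clock) fact
  have "emeasure (clock N) {..t} = ennreal (erlang_CDF 0 (1 / real N) t)"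
    by (rule emeasure_erlang_density) (use assms in simp)
  then show 1: "measure (clock N) {..t} = psol N t"
    using assms psol_bounds[of t N] by (simp add: measure_def erlang_CDF_def psol_def)
  have "{t<..} = space (clock N) - {..t}" by auto
  then show "measure (clock N) {t<..} = 1 - psol N t"
    using prob_compl[of "{..t}"] 1 by simp
qed

text \<open>Stands for measurability with respect to the clocks in \<open>J\<close>: a measurable
  event together with the pointwise statement that only these clocks matter. The second half is
  easily checked for combinatorial predicates, and \<open>cprob_indep\<close> turns it into
  independence.\<close>

definition clock_event :: "nat \<Rightarrow> (nat \<times> nat) set \<Rightarrow> ((nat \<times> nat \<Rightarrow> real) \<Rightarrow> bool) \<Rightarrow> bool" where
  "clock_event N J P \<longleftrightarrow> {e \<in> clocks N. P e} \<in> sets (clock_space N) \<and>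
     (\<forall>e e'. (\<forall>p\<in>J. e p = e' p) \<longrightarrow> P e = P e')"

abbreviation cprob :: "nat \<Rightarrow> ((nat \<times> nat \<Rightarrow> real) \<Rightarrow> bool) \<Rightarrow> real" where
  "cprob N P \<equiv> measure (clock_space N) {e \<in> clocks N. P e}"

lemma clock_event_sets: "clock_event N J P \<Longrightarrow> {e \<in> clocks N. P e} \<in> sets (clock_space N)"
  by (simp add: clock_event_def)

lemma clock_event_mono: "clock_event N J P \<Longrightarrow> J \<subseteq> K \<Longrightarrow> clock_event N K P"
  unfolding clock_event_def by blast

lemma clock_event_const: "clock_event N J (\<lambda>_. b)"
  by (simp add: clock_event_def)

lemma clock_event_conj:
  "clock_event N J P \<Longrightarrow> clock_event N J Q \<Longrightarrow> clock_event N J (\<lambda>e. P e \<and> Q e)"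
  unfolding clock_event_def by (auto intro: sets.sets_Collect_conj)

lemma clock_event_Bex:
  assumes "finite X" "\<And>x. x \<in> X \<Longrightarrow> clock_event N J (P x)"
  shows "clock_event N J (\<lambda>e. \<exists>x\<in>X. P x e)"
proof -
  have "{e \<in> clocks N. \<exists>x\<in>X. P x e} \<in> sets (clock_space N)"
    using assms by (intro sets.sets_Collect_finite_Ex) (auto simp: clock_event_def)
  then show ?thesis using assms(2) unfolding clock_event_def by blast
qed

text \<open>The order of the clocks in \<open>J\<close> and the set of those rung by
  \<open>t\<close> admit finitely many patterns. Each pattern is a measurable cell, and
  \<open>P\<close> is constant on it.\<close>

lemma clock_event_order:
  assumes J: "J \<subseteq> pairs N"
    and P: "\<And>e e'. (\<forall>p\<in>J. \<forall>q\<in>J. (e p \<le> e q) = (e' p \<le> e' q)) \<Longrightarrow> (\<forall>p\<in>J. (e p \<le> t) = (e' p \<le> t)) \<Longrightarrow> P e = P e'"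
  shows "clock_event N J P"
proof -
  have fJ: "finite J" using J finite_pairs finite_subset by blast
  define C where "C K = {e \<in> clocks N. (\<forall>x\<in>J \<times> J. (e (fst x) \<le> e (snd x)) = (x \<in> fst K)) \<and>
      (\<forall>p\<in>J. (e p \<le> t) = (p \<in> snd K))}" for K :: "((nat \<times> nat) \<times> nat \<times> nat) set \<times> (nat \<times> nat) set"
  define key where "key e = ({x \<in> J \<times> J. e (fst x) \<le> e (snd x)}, {p \<in> J. e p \<le> t})" for e :: "nat \<times> nat \<Rightarrow> real"
  have "C K \<in> sets (clock_space N)" for K
  proof -
    have "{e \<in> clocks N. (e (fst x) \<le> e (snd x)) = (x \<in> fst K)} \<in> sets (clock_space N)"
      if "x \<in> J \<times> J" for x
    proof -
      have x: "fst x \<in> pairs N" "snd x \<in> pairs N" using J that by auto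
      have 1: "{e \<in> clocks N. e (fst x) \<le> e (snd x)} \<in> sets (clock_space N)"
        by (rule borel_measurable_le[OF measurable_clock_component[OF x(1)] measurable_clock_component[OF x(2)]])
      show ?thesis using 1 sets.sets_Collect_neg[OF 1] by (cases "x \<in> fst K") simp_all
    qed
    moreover have "{e \<in> clocks N. (e p \<le> t) = (p \<in> snd K)} \<in> sets (clock_space N)" if "p \<in> J" for p
    proof -
      have p: "p \<in> pairs N" using J that by blast
      have 1: "{e \<in> clocks N. e p \<le> t} \<in> sets (clock_space N)"
        by (rule borel_measurable_le[OF measurable_clock_component[OF p]]) simp
      show ?thesis using 1 sets.sets_Collect_neg[OF 1] by (cases "p \<in> snd K") simp_all
    qed
    ultimately show ?thesis
      unfolding C_def using fJ by (intro sets.sets_Collect_conj sets.sets_Collect_finite_All) auto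
  qed
  moreover have "finite (key ` {e. P e})"
    by (rule finite_subset[of _ "Pow (J \<times> J) \<times> Pow J"]) (use fJ in \<open>auto simp: key_def\<close>)
  ultimately have "(\<Union>K\<in>key ` {e. P e}. C K) \<in> sets (clock_space N)" by (intro sets.finite_UN)
  also have "(\<Union>K\<in>key ` {e. P e}. C K) = {e \<in> clocks N. P e}"
  proof (rule set_eqI)
    fix e
    have "P e \<longleftrightarrow> P e'" if "e \<in> C (key e')" for e'
      by (rule P) (use that in \<open>auto simp: C_def key_def\<close>)
    moreover have "e \<in> C (key e)" if "e \<in> clocks N" using that by (auto simp: C_def key_def)
    moreover have "C K \<subseteq> clocks N" for K by (auto simp: C_def)
    ultimately show "e \<in> (\<Union>K\<in>key ` {e. P e}. C K) \<longleftrightarrow> e \<in> {e \<in> clocks N. P e}" by blast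
  qed
  finally have "{e \<in> clocks N. P e} \<in> sets (clock_space N)" .
  moreover have "P e = P e'" if "\<forall>p\<in>J. e p = e' p" for e e'
    by (rule P) (use that in auto)
  ultimately show ?thesis by (simp add: clock_event_def)
qed

lemma clock_event_open:
  assumes "J \<subseteq> pairs N"
  shows "clock_event N J (\<lambda>e. R {p \<in> J. e p \<le> t})"
proof (rule clock_event_order[OF assms])
  fix e e' :: "nat \<times> nat \<Rightarrow> real"
  assume "\<forall>p\<in>J. (e p \<le> t) = (e' p \<le> t)"
  then have "{p \<in> J. e p \<le> t} = {p \<in> J. e' p \<le> t}" by blast
  then show "R {p \<in> J. e p \<le> t} = R {p \<in> J. e' p \<le> t}" by simp
qed

lemma cprob_open:
  assumes N: "N \<ge> 1" and J: "J \<subseteq> pairs N" and t: "t \<ge> 0"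
  shows "cprob N (\<lambda>e. R {p \<in> J. e p \<le> t}) = rsub_prob J (psol N t) (\<lambda>A. R A)"
proof -
  interpret prob_space "clock_space N" by (rule prob_space_clock_space[OF N])
  interpret clk: prob_space "clock N" by (rule prob_space_clock[OF N])
  interpret PP: finite_product_prob_space "\<lambda>_. clock N" "pairs N"
    by standard (rule finite_pairs)
  have fJ: "finite J" using J finite_pairs finite_subset by blast
  have exact: "cprob N (\<lambda>e. {p \<in> J. e p \<le> t} = A) = pmf (rsub J (psol N t)) A" if A: "A \<subseteq> J" for A
  proof -
    \<comment> \<open>Prescribing the set of rung clocks is a box: \<open>{..t}\<close> on
      \<open>A\<close>, its complement on \<open>J - A\<close>, no condition on the other
      pairs.\<close>
    let ?B = "\<lambda>p. if p \<in> J then (if p \<in> A then {..t} else {t<..}) else UNIV"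
    have "{e \<in> clocks N. {p \<in> J. e p \<le> t} = A} = Pi\<^sub>E (pairs N) ?B"
    proof (rule set_eqI)
      fix e :: "nat \<times> nat \<Rightarrow> real"
      have "{p \<in> J. e p \<le> t} = A \<longleftrightarrow> (\<forall>p\<in>J. e p \<le> t \<longleftrightarrow> p \<in> A)" using A by blast
      also have "... \<longleftrightarrow> (\<forall>p\<in>J. e p \<in> ?B p)" by (rule ball_cong) auto
      also have "... \<longleftrightarrow> (\<forall>p\<in>pairs N. e p \<in> ?B p)" using J by auto
      finally show "e \<in> {e \<in> clocks N. {p \<in> J. e p \<le> t} = A} \<longleftrightarrow> e \<in> Pi\<^sub>E (pairs N) ?B"
        unfolding space_clock_space PiE_iff by (simp add: conj_commute)
    qed
    then have "cprob N (\<lambda>e. {p \<in> J. e p \<le> t} = A) = (\<Prod>p\<in>pairs N. measure (clock N) (?B p))"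
      using PP.finite_measure_PiM_emb[of ?B] by (simp add: clock_space_def)
    also have "... = (\<Prod>p\<in>pairs N. if p \<in> J then (if p \<in> A then psol N t else 1 - psol N t) else 1)"
      by (rule prod.cong) (use measure_clock_le[OF N t] clk.prob_space in auto)
    also have "... = (\<Prod>p\<in>J. if p \<in> A then psol N t else 1 - psol N t)"
      using J finite_pairs by (simp add: prod.If_cases Int_absorb1)
    also have "... = psol N t ^ card (J \<inter> A) * (1 - psol N t) ^ card (J - A)"
      using fJ by (simp add: prod.If_cases Collect_neg_eq Diff_eq)
    also have "... = pmf (rsub J (psol N t)) A"
      using A fJ psol_bounds[OF t] by (simp add: pmf_rsub Int_absorb1)
    finally show ?thesis .
  qed
  let ?X = "{A \<in> Pow J. R A}"
  have "{e \<in> clocks N. R {p \<in> J. e p \<le> t}} =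
      (\<Union>A\<in>?X. {e \<in> clocks N. {p \<in> J. e p \<le> t} = A})" by auto
  then have "cprob N (\<lambda>e. R {p \<in> J. e p \<le> t}) = (\<Sum>A\<in>?X. cprob N (\<lambda>e. {p \<in> J. e p \<le> t} = A))"
    using fJ clock_event_sets[OF clock_event_open[OF J, where t = t]]
    by (simp, intro finite_measure_finite_Union) (auto simp: disjoint_family_on_def)
  also have "... = (\<Sum>A\<in>?X. pmf (rsub J (psol N t)) A)" by (rule sum.cong) (use exact in auto)
  also have "... = measure_pmf.prob (rsub J (psol N t)) ?X"
    using fJ by (simp add: measure_measure_pmf_finite)
  also have "... = rsub_prob J (psol N t) (\<lambda>A. R A)"
    using prob_rsub_cong[of J "\<lambda>A. A \<in> ?X" R] by simp
  finally show ?thesis .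
qed

text \<open>Both events are read off the restrictions to \<open>J\<close> and \<open>K\<close>,
  which are independent as disjoint blocks of independent coordinates.\<close>

lemma cprob_indep:
  assumes N: "N \<ge> 1" and P: "clock_event N J P" and Q: "clock_event N K Q"
    and JK: "J \<inter> K = {}" "J \<subseteq> pairs N" "K \<subseteq> pairs N"
  shows "cprob N (\<lambda>e. P e \<and> Q e) = cprob N P * cprob N Q"
proof -
  let ?M = "clock_space N" and ?I = "pairs N"
  interpret prob_space ?M by (rule prob_space_clock_space[OF N])
  interpret clk: prob_space "clock N" by (rule prob_space_clock[OF N])
  interpret PP: finite_product_prob_space "\<lambda>_. clock N" ?I
    by standard (rule finite_pairs)
  show ?thesis
  \<comment> \<open>For \<open>N = 1\<close> there are no clocks and every event is constant. This
    case is separate because the characterization of independence by product measures asks for a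
    nonempty index set.\<close>
  proof (cases "?I = {}")
    case True
    then have J: "J = {}" "K = {}" using JK by auto
    have cP: "P e = P undefined" for e
      by (rule P[unfolded clock_event_def, THEN conjunct2, rule_format]) (simp add: J)
    have cQ: "Q e = Q undefined" for e
      by (rule Q[unfolded clock_event_def, THEN conjunct2, rule_format]) (simp add: J)
    have "P = (\<lambda>_. P undefined)" "Q = (\<lambda>_. Q undefined)"
      by (rule ext, rule cP) (rule ext, rule cQ)
    then obtain b c where "P = (\<lambda>_. b)" "Q = (\<lambda>_. c)" by blast
    then show ?thesis by (cases b; cases c) (simp_all add: prob_space)
  next
    case False
    have ind: "indep_vars (\<lambda>_. clock N) (\<lambda>p e. e p) ?I"
    proof (subst indep_vars_iff_distr_eq_PiM'[OF False])
      show "(\<lambda>e. e p) \<in> ?M \<rightarrow>\<^sub>M clock N" if "p \<in> ?I" for p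
        unfolding clock_space_def using that by (rule measurable_component_singleton)
      have "distr ?M (PiM ?I (\<lambda>_. clock N)) (\<lambda>e. \<lambda>p\<in>?I. e p) = distr ?M (PiM ?I (\<lambda>_. clock N)) (\<lambda>e. e)"
        by (rule distr_cong) (auto simp: space_clock_space restrict_def PiE_def extensional_def fun_eq_iff)
      also have "... = PiM ?I (\<lambda>_. clock N)" unfolding clock_space_def by (rule distr_id)
      also have "... = PiM ?I (\<lambda>p. distr ?M (clock N) (\<lambda>e. e p))"
        unfolding clock_space_def by (rule PiM_cong) (auto simp: PP.PiM_component)
      finally show "distr ?M (PiM ?I (\<lambda>_. clock N)) (\<lambda>e. \<lambda>p\<in>?I. e p) = PiM ?I (\<lambda>p. distr ?M (clock N) (\<lambda>e. e p))" .
    qed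
    \<comment> \<open>Filling the missing coordinates with 0 allows an event to be evaluated on a
      restriction to \<open>L\<close>; the event itself looks only at the clocks in
      \<open>L\<close>.\<close>
    define ext where "ext L e = (\<lambda>p\<in>?I. if p \<in> L then e p else (0::real))"
      for L :: "(nat \<times> nat) set" and e
    have ext: "ext L \<in> PiM L (\<lambda>_. clock N) \<rightarrow>\<^sub>M ?M" for L
      unfolding ext_def clock_space_def
    proof (rule measurable_restrict)
      show "(\<lambda>x. if p \<in> L then x p else 0) \<in> PiM L (\<lambda>_. clock N) \<rightarrow>\<^sub>M clock N" for p
        using measurable_component_singleton[of p L "\<lambda>_. clock N"] by (cases "p \<in> L") simp_all
    qed
    have lift: "{f \<in> space (PiM L (\<lambda>_. clock N)). R (ext L f)} \<in> sets (PiM L (\<lambda>_. clock N))"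
      and val: "\<And>e. R (ext L (restrict e L)) = R e"
      if R: "clock_event N L R" "L \<subseteq> ?I" for L R
    proof -
      have "{f \<in> space (PiM L (\<lambda>_. clock N)). R (ext L f)} =
          ext L -` {e \<in> space ?M. R e} \<inter> space (PiM L (\<lambda>_. clock N))"
        using measurable_space[OF ext] by auto
      then show "{f \<in> space (PiM L (\<lambda>_. clock N)). R (ext L f)} \<in> sets (PiM L (\<lambda>_. clock N))"
        using measurable_sets[OF ext clock_event_sets[OF R(1)]] by simp
      show "R (ext L (restrict e L)) = R e" for e
      proof -
        have "\<forall>p\<in>L. ext L (restrict e L) p = e p" using R(2) by (auto simp: ext_def)
        then show ?thesis using R(1) unfolding clock_event_def by blast
      qed
    qed
    let ?SP = "{f \<in> space (PiM J (\<lambda>_. clock N)). P (ext J f)}"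
    let ?SQ = "{f \<in> space (PiM K (\<lambda>_. clock N)). Q (ext K f)}"
    have sp: "restrict e L \<in> space (PiM L (\<lambda>_. clock N))" for e L by (simp add: space_PiM)
    have "prob ((\<lambda>e. (restrict e J, restrict e K)) -` (?SP \<times> ?SQ) \<inter> space ?M) =
      prob ((\<lambda>e. restrict e J) -` ?SP \<inter> space ?M) * prob ((\<lambda>e. restrict e K) -` ?SQ \<inter> space ?M)"
      by (rule indep_varD[OF indep_var_restrict[OF ind JK]]) (use lift[OF P JK(2)] lift[OF Q JK(3)] in auto)
    moreover have "(\<lambda>e. (restrict e J, restrict e K)) -` (?SP \<times> ?SQ) \<inter> space ?M = {e \<in> space ?M. P e \<and> Q e}"
      using val[OF P JK(2)] val[OF Q JK(3)] sp by auto
    moreover have "(\<lambda>e. restrict e J) -` ?SP \<inter> space ?M = {e \<in> space ?M. P e}"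
      using val[OF P JK(2)] sp by auto
    moreover have "(\<lambda>e. restrict e K) -` ?SQ \<inter> space ?M = {e \<in> space ?M. Q e}"
      using val[OF Q JK(3)] sp by auto
    ultimately show ?thesis by simp
  qed
qed

section \<open>Entropy estimates\<close>

text \<open>In a Poisson branching process with mean \<open>x\<close>, a total progeny of
  \<open>d\<close> has probability exp (- d (x - 1 - ln x)) up to polynomial factors. The rate
  vanishes only at the critical mean 1.\<close>

definition entropy_gap :: "real \<Rightarrow> real" where
  "entropy_gap x = x - 1 - ln x"

lemma entropy_gap_nonneg: "x > 0 \<Longrightarrow> 0 \<le> entropy_gap x"
  using ln_le_minus_one[of x] by (simp add: entropy_gap_def)

lemma entropy_gap_pos: "x > 0 \<Longrightarrow> x \<noteq> 1 \<Longrightarrow> 0 < entropy_gap x"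
  using ln_eq_minus_one[of x] entropy_gap_nonneg[of x] by (auto simp: entropy_gap_def less_le)

lemma entropy_gap_mono:
  assumes "1 \<le> y" "y \<le> x"
  shows "entropy_gap y \<le> entropy_gap x"
proof -
  have "ln x - ln y = ln (x / y)" using assms by (simp add: ln_div)
  also have "... \<le> x / y - 1" using assms by (intro ln_le_minus_one) simp
  also have "... \<le> x - y"
  proof -
    have "(x - y) / y \<le> (x - y) / 1" by (rule divide_left_mono) (use assms in auto)
    then show ?thesis using assms by (simp add: diff_divide_distrib)
  qed
  finally show ?thesis by (simp add: entropy_gap_def)
qed

lemma entropy_gap_antimono:
  assumes "0 < x" "x \<le> y" "y \<le> 1"
  shows "entropy_gap y \<le> entropy_gap x"
proof -
  have "ln x - ln y = ln (x / y)" using assms by (simp add: ln_div)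
  also have "... \<le> x / y - 1" using assms by (intro ln_le_minus_one) simp
  also have "... \<le> x - y"
  proof -
    have "(y - x) / 1 \<le> (y - x) / y" by (rule divide_left_mono) (use assms in auto)
    then show ?thesis using assms by (simp add: diff_divide_distrib)
  qed
  finally show ?thesis by (simp add: entropy_gap_def)
qed

text \<open>A single term of the exponential series is at most its sum.\<close>

lemma power_self_le: "real d ^ d \<le> fact d * exp (real d)"
proof -
  have "(\<Sum>n\<in>{d}. real d ^ n /\<^sub>R fact n) \<le> (\<Sum>n. real d ^ n /\<^sub>R fact n)"
    by (rule sum_le_suminf) (use summable_exp_generic[of "real d"] in auto)
  then have "real d ^ d / fact d \<le> exp (real d)"
    by (simp add: exp_def divide_inverse mult.commute)
  then show ?thesis by (simp add: pos_divide_le_eq mult.commute)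
qed

lemma binomial_power_le: "real (k choose d) * real d ^ d \<le> (real k * exp 1) ^ d"
proof -
  have "real (k choose d) * real d ^ d \<le> real (k choose d) * (fact d * exp (real d))"
    by (intro mult_left_mono power_self_le) simp
  also have "... = real ((k choose d) * fact d) * exp (real d)" by simp
  also have "... \<le> real (k ^ d) * exp (real d)"
    by (intro mult_right_mono of_nat_mono binomial_fact_pow) simp
  also have "... = (real k * exp 1) ^ d" by (simp add: power_mult_distrib exp_of_nat_mult[symmetric])
  finally show ?thesis .
qed

lemma psol_le: "N \<ge> 1 \<Longrightarrow> psol N t \<le> t / real N"
  using exp_ge_add_one_self[of "- t / real N"] by (simp add: psol_def)

lemma psol_pos: "N \<ge> 1 \<Longrightarrow> t > 0 \<Longrightarrow> 0 < psol N t"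
  by (simp add: psol_def)

lemma psol_mono: "s \<le> t \<Longrightarrow> psol N s \<le> psol N t"
  by (simp add: psol_def divide_right_mono)

text \<open>\<open>psol N\<close> is concave in time and vanishes at 0, so its quotient by the time
  decreases.\<close>

lemma psol_ratio:
  assumes "N \<ge> 1" "0 < s" "s \<le> t"
  shows "psol N t / psol N s \<le> t / s"
proof -
  let ?l = "s / t"
  have l: "0 < ?l" "?l \<le> 1" using assms by auto
  have "exp ((1 - ?l) *\<^sub>R 0 + ?l *\<^sub>R (- t / real N)) \<le> (1 - ?l) * exp 0 + ?l * exp (- t / real N)"
    by (rule convex_onD[OF exp_convex]) (use l in auto)
  then have "?l * psol N t \<le> psol N s"
    using assms by (simp add: psol_def algebra_simps)
  moreover have "0 < psol N s" using assms by (intro psol_pos)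
  ultimately show ?thesis using assms by (simp add: divide_simps mult.commute)
qed

section \<open>Probabilities of the building blocks of a history\<close>

abbreviation conn_prob :: "nat \<Rightarrow> nat set \<Rightarrow> real \<Rightarrow> real" where
  "conn_prob N D t \<equiv> cprob N (\<lambda>e. conn D {p. e p \<le> t})"

abbreviation nolarge_prob :: "nat \<Rightarrow> real \<Rightarrow> nat set \<Rightarrow> real \<Rightarrow> real" where
  "nolarge_prob N a S t \<equiv> cprob N (\<lambda>e. nolarge a S {p. e p \<le> t})"

abbreviation cross_prob :: "nat \<Rightarrow> nat set \<Rightarrow> nat set \<Rightarrow> real \<Rightarrow> real" where
  "cross_prob N D S t \<equiv> cprob N (\<lambda>e. \<forall>p\<in>crossp D S. t < e p)"

lemma ipairs_subset_pairs: "S \<subseteq> {1..N} \<Longrightarrow> ipairs S \<subseteq> pairs N"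
  unfolding pairs_eq_ipairs by (rule ipairs_mono)

lemma conn_open_iff: "conn D {p. e p \<le> t} \<longleftrightarrow> conn D {p \<in> ipairs D. e p \<le> t}"
proof -
  have "{p. e p \<le> t} \<inter> ipairs D = {p \<in> ipairs D. e p \<le> t} \<inter> ipairs D" by blast
  then show ?thesis by (simp add: conn_def)
qed

lemma nolarge_open_iff: "nolarge a S {p. e p \<le> t} \<longleftrightarrow> no_large_comp a (S, {p \<in> ipairs S. e p \<le> t})"
proof -
  have "{p. e p \<le> t} \<inter> ipairs S = {p \<in> ipairs S. e p \<le> t}" by blast
  then show ?thesis by (simp add: nolarge_def)
qed

lemma clock_event_conn: "D \<subseteq> {1..N} \<Longrightarrow> clock_event N (ipairs D) (\<lambda>e. conn D {p. e p \<le> t})"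
  unfolding conn_open_iff by (intro clock_event_open ipairs_subset_pairs)

lemma clock_event_nolarge: "S \<subseteq> {1..N} \<Longrightarrow> clock_event N (ipairs S) (\<lambda>e. nolarge a S {p. e p \<le> t})"
  unfolding nolarge_open_iff by (intro clock_event_open ipairs_subset_pairs)

lemma cross_closed_iff: "(\<forall>p\<in>C. t < e p) \<longleftrightarrow> {p \<in> C. e p \<le> t} = {}" for e :: "'a \<Rightarrow> real"
  by (auto simp: not_le)

lemma clock_event_cross:
  "S \<subseteq> {1..N} \<Longrightarrow> clock_event N (crossp D S) (\<lambda>e. \<forall>p\<in>crossp D S. t < e p)"
  unfolding cross_closed_iff
  by (rule clock_event_open) (use crossp_subset ipairs_subset_pairs in blast)

lemma cprob_cross:
  assumes "N \<ge> 1" "S \<subseteq> {1..N}" "D \<subseteq> S" "t \<ge> 0"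
  shows "cross_prob N D S t = exp (- t * real (card D) * real (card S - card D) / real N)"
proof -
  have fS: "finite S" using assms(2) finite_subset by blast
  have C: "crossp D S \<subseteq> pairs N" using crossp_subset ipairs_subset_pairs[OF assms(2)] by blast
  have fC: "finite (crossp D S)" using C finite_pairs finite_subset by blast
  have "cross_prob N D S t = rsub_prob (crossp D S) (psol N t) (\<lambda>A. A = {})"
    unfolding cross_closed_iff by (rule cprob_open[OF assms(1) C assms(4)])
  also have "... = (1 - psol N t) ^ card (crossp D S)"
    using pmf_rsub[OF fC, of "psol N t" "{}"] psol_bounds[OF assms(4), of N] by (simp add: measure_pmf_single)
  also have "... = exp (real (card (crossp D S)) * (- t / real N))"
    unfolding exp_of_nat_mult by (simp add: psol_def)
  also have "real (card (crossp D S)) * (- t / real N) = - t * real (card D) * real (card S - card D) / real N"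
    using card_crossp[OF fS assms(3)] by (simp add: mult.commute)
  finally show ?thesis .
qed

lemma cprob_conn_eq:
  assumes "N \<ge> 1" "D \<subseteq> {1..N}" "t \<ge> 0"
  shows "conn_prob N D t = rsub_prob (ipairs D) (psol N t) (\<lambda>A. conn D A)"
  unfolding conn_open_iff by (rule cprob_open[OF assms(1) ipairs_subset_pairs[OF assms(2)] assms(3)])

lemma cprob_conn_le:
  assumes "N \<ge> 1" "D \<subseteq> {1..N}" "D \<noteq> {}" "t \<ge> 0"
  shows "conn_prob N D t \<le> real (card D) ^ (card D - 1) * (t / real N) ^ (card D - 1)"
proof -
  have fD: "finite D" using assms(2) finite_subset by blast
  have b: "0 \<le> psol N t" "psol N t \<le> 1" using psol_bounds[OF assms(4)] by auto
  have "conn_prob N D t \<le> real (card D) ^ (card D - 1) * psol N t ^ (card D - 1)"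
    using cprob_conn_eq[OF assms(1,2,4)] prob_rsub_conn_le[OF fD assms(3) b] by simp
  also have "... \<le> real (card D) ^ (card D - 1) * (t / real N) ^ (card D - 1)"
    by (intro mult_left_mono power_mono psol_le b assms) simp
  finally show ?thesis .
qed

lemma cprob_conn_thinning:
  assumes "N \<ge> 1" "D \<subseteq> {1..N}" "D \<noteq> {}" "0 < s" "s \<le> t"
  shows "conn_prob N D t \<le> (t / s) ^ (card D - 1) * conn_prob N D s"
proof -
  have fD: "finite D" using assms(2) finite_subset by blast
  have ps: "0 < psol N s" "psol N s \<le> psol N t" using psol_pos psol_mono assms by auto
  have pt: "0 < psol N t" "psol N t \<le> 1" using psol_pos psol_bounds[of t N] assms by auto
  let ?P = "conn_prob N D t" and ?Q = "conn_prob N D s"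
  have le: "?P * (psol N s / psol N t) ^ (card D - 1) \<le> ?Q"
    using prob_rsub_conn_thinning[OF fD assms(3) pt, of "psol N s"] ps
      cprob_conn_eq[OF assms(1,2), of t] cprob_conn_eq[OF assms(1,2), of s] assms by simp
  have "?P = (psol N t / psol N s) ^ (card D - 1) * (?P * (psol N s / psol N t) ^ (card D - 1))"
    using ps pt by (simp add: power_divide)
  also have "... \<le> (psol N t / psol N s) ^ (card D - 1) * ?Q"
    by (rule mult_left_mono[OF le]) (use ps pt in simp)
  also have "... \<le> (t / s) ^ (card D - 1) * ?Q"
    by (intro mult_right_mono power_mono psol_ratio assms) (use ps pt in auto)
  finally show ?thesis .
qed

lemma clock_event_block:
  assumes "S \<subseteq> {1..N}" "D \<subseteq> S" "clock_event N (ipairs (S - D)) P"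
  shows "clock_event N (ipairs S) (\<lambda>e. conn D {p. e p \<le> t} \<and> (\<forall>p\<in>crossp D S. s < e p) \<and> P e)"
proof -
  have sub: "ipairs D \<subseteq> ipairs S" "crossp D S \<subseteq> ipairs S" "ipairs (S - D) \<subseteq> ipairs S"
    using ipairs_split[OF assms(2)] by auto
  have DN: "D \<subseteq> {1..N}" using assms by blast
  show ?thesis
    by (intro clock_event_conj clock_event_mono[OF clock_event_conn[OF DN] sub(1)]
        clock_event_mono[OF clock_event_cross[OF assms(1)] sub(2)] clock_event_mono[OF assms(3) sub(3)])
qed

text \<open>The pairs inside \<open>D\<close>, across, and inside \<open>S - D\<close> are disjoint
  sets of clocks. Two times occur because a history locates the birth of \<open>D\<close> only up to
  a grid cell: \<open>D\<close> is connected at the end of the cell, and no cross clock has rung at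
  its beginning.\<close>

lemma cprob_block:
  assumes N: "N \<ge> 1" and S: "S \<subseteq> {1..N}" and D: "D \<subseteq> S" and P: "clock_event N (ipairs (S - D)) P"
  shows "cprob N (\<lambda>e. conn D {p. e p \<le> t} \<and> (\<forall>p\<in>crossp D S. s < e p) \<and> P e) =
    conn_prob N D t * (cross_prob N D S s * cprob N P)"
proof -
  have SN: "ipairs S \<subseteq> pairs N" by (rule ipairs_subset_pairs[OF S])
  have sub: "ipairs D \<subseteq> pairs N" "crossp D S \<subseteq> pairs N" "ipairs (S - D) \<subseteq> pairs N"
    using ipairs_split[OF D] SN by auto
  have DN: "D \<subseteq> {1..N}" using D S by blast
  have 1: "clock_event N (crossp D S \<union> ipairs (S - D)) (\<lambda>e. (\<forall>p\<in>crossp D S. s < e p) \<and> P e)"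
    by (intro clock_event_conj clock_event_mono[OF clock_event_cross[OF S]] clock_event_mono[OF P]) auto
  have "cprob N (\<lambda>e. conn D {p. e p \<le> t} \<and> (\<forall>p\<in>crossp D S. s < e p) \<and> P e) =
      conn_prob N D t * cprob N (\<lambda>e. (\<forall>p\<in>crossp D S. s < e p) \<and> P e)"
    by (rule cprob_indep[OF N clock_event_conn[OF DN] 1]) (use ipairs_crossp_disjoint sub in blast)+
  moreover have "cprob N (\<lambda>e. (\<forall>p\<in>crossp D S. s < e p) \<and> P e) = cross_prob N D S s * cprob N P"
  proof (rule cprob_indep[OF N clock_event_cross[OF S] P _ sub(2,3)])
    show "crossp D S \<inter> ipairs (S - D) = {}" by (auto simp: crossp_def ipairs_def)
  qed
  ultimately show ?thesis by simp
qed

lemma cprob_mono: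
  assumes "clock_event N J Q" "\<And>e. e \<in> clocks N \<Longrightarrow> P e \<Longrightarrow> Q e" "N \<ge> 1"
  shows "cprob N P \<le> cprob N Q"
proof -
  interpret prob_space "clock_space N" by (rule prob_space_clock_space) fact
  show ?thesis by (rule finite_measure_mono) (use assms clock_event_sets[OF assms(1)] in auto)
qed

lemma cprob_le_1: "N \<ge> 1 \<Longrightarrow> cprob N P \<le> 1"
proof -
  assume "N \<ge> 1"
  then interpret prob_space "clock_space N" by (rule prob_space_clock_space)
  show ?thesis by (rule prob_le_1)
qed

lemma cprob_Bex_le:
  assumes "N \<ge> 1" "finite X" "\<And>x. x \<in> X \<Longrightarrow> clock_event N J (P x)"
  shows "cprob N (\<lambda>e. \<exists>x\<in>X. P x e) \<le> (\<Sum>x\<in>X. cprob N (P x))"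
proof -
  interpret prob_space "clock_space N" by (rule prob_space_clock_space) fact
  have "cprob N (\<lambda>e. \<exists>x\<in>X. P x e) = prob (\<Union>x\<in>X. {e \<in> clocks N. P x e})"
    by (rule arg_cong[where f = prob]) auto
  also have "... \<le> (\<Sum>x\<in>X. cprob N (P x))"
    by (rule finite_measure_subadditive_finite) (use assms clock_event_sets in auto)
  finally show ?thesis .
qed

lemma sum_Pow_card:
  fixes f :: "nat \<Rightarrow> real"
  assumes "finite S"
  shows "(\<Sum>D\<in>Pow S. f (card D)) = (\<Sum>d\<le>card S. real (card S choose d) * f d)"
proof -
  have "(\<Sum>D\<in>Pow S. f (card D)) = (\<Sum>d\<le>card S. \<Sum>D\<in>{D \<in> Pow S. card D = d}. f (card D))"
    using assms by (intro sum.group[symmetric]) (auto intro: card_mono)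
  also have "... = (\<Sum>d\<le>card S. real (card S choose d) * f d)"
  proof (rule sum.cong)
    fix d
    have "(\<Sum>D\<in>{D \<in> Pow S. card D = d}. f (card D)) = real (card {D. D \<subseteq> S \<and> card D = d}) * f d"
      by simp
    then show "(\<Sum>D\<in>{D \<in> Pow S. card D = d}. f (card D)) = real (card S choose d) * f d"
      using n_subsets[OF assms, of d] by simp
  qed simp
  finally show ?thesis .
qed

lemma clock_event_hist: "S \<subseteq> {1..N} \<Longrightarrow> clock_event N (ipairs S) (hist a h M F r S)"
proof (induction r arbitrary: S)
  case 0
  then show ?case
    by (simp add: clock_event_conj clock_event_const clock_event_nolarge)
next
  case (Suc r)
  have fS: "finite S" using Suc.prems finite_subset by blast
  have "clock_event N (ipairs S) (\<lambda>e. \<exists>m\<in>{..<M}. \<exists>D\<in>{D \<in> Pow S. a \<le> real (card D) \<and> real (card D) < 2 * a}.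
      conn D {p. e p \<le> real (Suc m) * h} \<and> (\<forall>p\<in>crossp D S. real m * h < e p) \<and> hist a h M F r (S - D) e)"
    by (intro clock_event_Bex clock_event_block Suc.IH) (use Suc.prems fS in auto)
  then show ?case by (simp add: Bex_def)
qed

text \<open>Put \<open>t' = (m + 1) h\<close> and \<open>x = k t' / N\<close>. By
  \<open>binomial_power_le\<close>, choosing and connecting the cluster costs exp (d (ln x + 1)),
  and the missing cross links give exp (- d x). The factor \<open>N / h\<close> pays for the
  exponent d - 1 in place of d.\<close>

lemma block_estimate:
  fixes a h :: real
  assumes N: "N \<ge> 1" and k: "k \<le> N" and d: "1 \<le> d" "d \<le> k" "real d \<le> 2 * a"
    and h: "h > 0" and m: "m < M" and K: "K = h + 2 * a * (real M * h) / real N"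
  shows "real (k choose d) * (real d ^ (d - 1) * (real (Suc m) * h / real N) ^ (d - 1)) *
           exp (- (real m * h) * real d * real (k - d) / real N)
         \<le> real N / h * (exp (K * real d) * exp (- real d * entropy_gap (real k * (real (Suc m) * h) / real N)))"
proof -
  define t' where "t' = real (Suc m) * h"
  define x where "x = real k * t' / real N"
  have t': "0 < t'" "h \<le> t'" using h by (auto simp: t'_def)
  have Npos: "0 < real N" and kpos: "0 < real k" and dpos: "0 < real d" using N d by auto
  have xpos: "0 < x" using t' Npos kpos by (simp add: x_def)
  have dd: "real d ^ d = real d ^ (d - 1) * real d"
    using d by (cases d) auto
  have tt: "(t' / real N) ^ d = (t' / real N) ^ (d - 1) * (t' / real N)"
    using d by (cases d) auto
  have "real (k choose d) * (real d ^ (d - 1) * (t' / real N) ^ (d - 1)) =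
      (real (k choose d) * real d ^ d) * (t' / real N) ^ d * (real N / (t' * real d))"
    unfolding dd tt using t' Npos dpos by (simp add: field_simps)
  also have "... \<le> (real k * exp 1) ^ d * (t' / real N) ^ d * (real N / h)"
  proof (intro mult_mono binomial_power_le)
    have "h * 1 \<le> t' * real d" using t' d h by (intro mult_mono) auto
    then show "real N / (t' * real d) \<le> real N / h"
      using h Npos by (intro divide_left_mono) (auto intro!: mult_pos_pos t' dpos)
  qed (use t' Npos dpos h in auto)
  also have "(real k * exp 1) ^ d * (t' / real N) ^ d = (x * exp 1) ^ d"
    by (simp add: x_def power_mult_distrib power_divide)
  also have "(x * exp 1) ^ d = exp (real d * (ln x + 1))"
    using xpos by (simp add: exp_of_nat_mult exp_add)
  finally have 1: "real (k choose d) * (real d ^ (d - 1) * (t' / real N) ^ (d - 1)) \<le>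
      exp (real d * (ln x + 1)) * (real N / h)" .
  \<comment> \<open>Two errors make up \<open>K\<close>: the cross clocks are controlled only up to
    the start \<open>m h\<close> of the cell, which costs at most \<open>h d\<close>, and there are
    d (k - d) of them instead of d k, which costs at most \<open>2 a M h d / N\<close>.\<close>
  have "- (real m * h) * real d * real (k - d) / real N =
      - real d * x + h * real d * (real k / real N) + (real m * h) * real d * real d / real N"
    using d Npos by (simp add: x_def t'_def of_nat_diff field_simps)
  also have "... \<le> - real d * x + K * real d"
  proof -
    have "h * real d * (real k / real N) \<le> h * real d * 1"
      using k Npos h by (intro mult_left_mono) auto
    moreover have "(real m * h) * real d * real d / real N \<le> (real M * h) * real d * (2 * a) / real N"
      using m d h Npos by (intro divide_right_mono mult_mono) auto
    ultimately show ?thesis by (simp add: K algebra_simps)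
  qed
  finally have 2: "exp (- (real m * h) * real d * real (k - d) / real N) \<le> exp (- real d * x + K * real d)"
    by simp
  have "real (k choose d) * (real d ^ (d - 1) * (t' / real N) ^ (d - 1)) *
        exp (- (real m * h) * real d * real (k - d) / real N)
      \<le> (exp (real d * (ln x + 1)) * (real N / h)) * exp (- real d * x + K * real d)"
    by (intro mult_mono 1 2) (use h Npos in auto)
  also have "... = real N / h * (exp (K * real d) * exp (- real d * entropy_gap x))"
    by (simp add: entropy_gap_def exp_add[symmetric] algebra_simps)
  finally show ?thesis by (simp add: t'_def x_def)
qed

text \<open>\<open>U\<close> is a potential: it dominates the probability of the final state and
  absorbs the exponential factor of each step, so a history costs \<open>U\<close> at its starting
  set. Per step, \<open>L\<close> collects \<open>M\<close> cells, at most \<open>N\<close> sizes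
  and the factor \<open>N / h\<close> of the block estimate. The errors exp (K d) multiply to at
  most exp (K card S).\<close>

lemma cprob_hist_le:
  fixes a h :: real
  assumes N: "N \<ge> 1" and a: "a > 0" and h: "h > 0"
    and U: "\<And>k. 0 \<le> U k"
    and base: "\<And>S. S \<subseteq> {1..N} \<Longrightarrow> cprob N (hist a h M F 0 S) \<le> U (card S)"
    and step: "\<And>k d m. k \<le> N \<Longrightarrow> 1 \<le> d \<Longrightarrow> d \<le> k \<Longrightarrow> real d < 2 * a \<Longrightarrow> m < M \<Longrightarrow>
      exp (- real d * entropy_gap (real k * (real (Suc m) * h) / real N)) * U (k - d) \<le> U k"
    and K: "K = h + 2 * a * (real M * h) / real N"
    and L: "L = real M * real N * real N / h"
    and S: "S \<subseteq> {1..N}"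
  shows "cprob N (hist a h M F r S) \<le> L ^ r * exp (K * real (card S)) * U (card S)"
  using S
proof (induction r arbitrary: S)
  case 0
  have "0 \<le> K" using K a h by simp
  then have "1 \<le> exp (K * real (card S))" by simp
  then have "1 * U (card S) \<le> exp (K * real (card S)) * U (card S)" by (intro mult_right_mono U)
  then show ?case using base[OF 0] by simp
next
  case (Suc r)
  have fS: "finite S" using Suc.prems finite_subset by blast
  define k where "k = card S"
  have kN: "k \<le> N" using card_mono[OF _ Suc.prems] by (simp add: k_def)
  have L0: "0 \<le> L" using h by (simp add: L)
  let ?DD = "{D \<in> Pow S. a \<le> real (card D) \<and> real (card D) < 2 * a}"
  define B where "B m D e \<longleftrightarrow> conn D {p. e p \<le> real (Suc m) * h} \<and> (\<forall>p\<in>crossp D S. real m * h < e p) \<and>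
      hist a h M F r (S - D) e" for m D e
  have evB: "clock_event N (ipairs S) (B m D)" if "D \<subseteq> S" for m D
    unfolding B_def by (intro clock_event_block clock_event_hist) (use that Suc.prems in auto)
  \<comment> \<open>The bound sees only the size of \<open>D\<close> and is 0 unless 1 <= d < 2 a.
    The sum over clusters can thus be extended to all subsets and grouped by size.\<close>
  define \<phi> where "\<phi> m d = (if 1 \<le> d \<and> real d < 2 * a then
      (real d ^ (d - 1) * (real (Suc m) * h / real N) ^ (d - 1)) *
      exp (- (real m * h) * real d * real (k - d) / real N) *
      (L ^ r * exp (K * real (k - d)) * U (k - d)) else 0)" for m d
  have \<phi>0: "0 \<le> \<phi> m d" for m d using h L0 U by (simp add: \<phi>_def)
  have B: "cprob N (B m D) \<le> \<phi> m (card D)" if D: "D \<in> ?DD" for m D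
  proof -
    have DS: "D \<subseteq> S" and dpos: "1 \<le> card D" and d2: "real (card D) < 2 * a" using D a by auto
    have Dne: "D \<noteq> {}" using dpos by auto
    have fD: "finite D" using DS fS finite_subset by blast
    have cSD: "card (S - D) = k - card D" using card_Diff_subset[OF fD DS] by (simp add: k_def)
    have SD: "S - D \<subseteq> {1..N}" and DN: "D \<subseteq> {1..N}" using Suc.prems DS by auto
    have "cprob N (B m D) = conn_prob N D (real (Suc m) * h) *
        (cross_prob N D S (real m * h) * cprob N (hist a h M F r (S - D)))"
      unfolding B_def by (rule cprob_block[OF N Suc.prems DS clock_event_hist[OF SD]])
    also have "... \<le> (real (card D) ^ (card D - 1) * (real (Suc m) * h / real N) ^ (card D - 1)) *
        (exp (- (real m * h) * real (card D) * real (k - card D) / real N) *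
        (L ^ r * exp (K * real (k - card D)) * U (k - card D)))"
    proof (intro mult_mono)
      show "conn_prob N D (real (Suc m) * h) \<le>
          real (card D) ^ (card D - 1) * (real (Suc m) * h / real N) ^ (card D - 1)"
        by (rule cprob_conn_le[OF N DN Dne]) (use h in simp)
      show "cross_prob N D S (real m * h) \<le>
          exp (- (real m * h) * real (card D) * real (k - card D) / real N)"
        using cprob_cross[OF N Suc.prems DS, of "real m * h"] h by (simp add: k_def)
      show "cprob N (hist a h M F r (S - D)) \<le> L ^ r * exp (K * real (k - card D)) * U (k - card D)"
        using Suc.IH[OF SD] cSD by simp
    qed (use h L0 U in auto)
    also have "... = \<phi> m (card D)" using dpos d2 by (simp add: \<phi>_def)
    finally show ?thesis .
  qed
  have \<phi>le: "real (k choose d) * \<phi> m d \<le> real N / h * (L ^ r * exp (K * real k) * U k)"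
    if d: "d \<le> k" and m: "m < M" for m d
  proof (cases "1 \<le> d \<and> real d < 2 * a")
    case True
    let ?g = "exp (- real d * entropy_gap (real k * (real (Suc m) * h) / real N))"
    have "real (k choose d) * \<phi> m d = (real (k choose d) * (real d ^ (d - 1) * (real (Suc m) * h / real N) ^ (d - 1)) *
           exp (- (real m * h) * real d * real (k - d) / real N)) * (L ^ r * exp (K * real (k - d)) * U (k - d))"
      using True by (simp add: \<phi>_def)
    also have "... \<le> (real N / h * (exp (K * real d) * ?g)) * (L ^ r * exp (K * real (k - d)) * U (k - d))"
      by (intro mult_right_mono block_estimate[OF N kN _ d _ h m K]) (use True L0 U in auto)
    also have "... = real N / h * (L ^ r * (exp (K * real d) * exp (K * real (k - d))) * (?g * U (k - d)))"
      by (simp add: mult_ac)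
    also have "exp (K * real d) * exp (K * real (k - d)) = exp (K * real k)"
      using d by (simp add: exp_add[symmetric] of_nat_diff algebra_simps)
    also have "real N / h * (L ^ r * exp (K * real k) * (?g * U (k - d))) \<le> real N / h * (L ^ r * exp (K * real k) * U k)"
      by (intro mult_left_mono step[OF kN _ d _ m]) (use True L0 h in auto)
    finally show ?thesis .
  next
    case False
    have "\<phi> m d = 0" using False by (auto simp: \<phi>_def)
    then show ?thesis using L0 U h by simp
  qed
  have "cprob N (hist a h M F (Suc r) S) = cprob N (\<lambda>e. \<exists>m\<in>{..<M}. \<exists>D\<in>?DD. B m D e)"
    by (simp add: B_def Bex_def)
  also have "... \<le> (\<Sum>m\<in>{..<M}. cprob N (\<lambda>e. \<exists>D\<in>?DD. B m D e))"
  proof (rule cprob_Bex_le[OF N])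
    show "clock_event N (ipairs S) (\<lambda>e. \<exists>D\<in>?DD. B m D e)" for m
      by (intro clock_event_Bex evB) (use fS in auto)
  qed simp
  also have "... \<le> (\<Sum>m\<in>{..<M}. real N * (real N / h * (L ^ r * exp (K * real k) * U k)))"
  proof (rule sum_mono)
    fix m assume m: "m \<in> {..<M}"
    have "cprob N (\<lambda>e. \<exists>D\<in>?DD. B m D e) \<le> (\<Sum>D\<in>?DD. cprob N (B m D))"
      by (rule cprob_Bex_le[OF N, where J = "ipairs S"]) (use fS in \<open>auto intro!: evB\<close>)
    also have "... \<le> (\<Sum>D\<in>?DD. \<phi> m (card D))" by (rule sum_mono) (rule B)
    also have "... \<le> (\<Sum>D\<in>Pow S. \<phi> m (card D))" by (rule sum_mono2) (use fS \<phi>0 in auto)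
    also have "... = (\<Sum>d\<le>k. real (k choose d) * \<phi> m d)" unfolding k_def by (rule sum_Pow_card[OF fS])
    also have "... = (\<Sum>d=1..k. real (k choose d) * \<phi> m d)"
      by (rule sum.mono_neutral_right) (auto simp: \<phi>_def)
    also have "... \<le> (\<Sum>d=1..k. real N / h * (L ^ r * exp (K * real k) * U k))"
      by (rule sum_mono) (use \<phi>le m in auto)
    also have "... = real k * (real N / h * (L ^ r * exp (K * real k) * U k))" by simp
    also have "... \<le> real N * (real N / h * (L ^ r * exp (K * real k) * U k))"
      by (rule mult_right_mono) (use kN h L0 U in auto)
    finally show "cprob N (\<lambda>e. \<exists>D\<in>?DD. B m D e) \<le> real N * (real N / h * (L ^ r * exp (K * real k) * U k))" .
  qed
  also have "... = L ^ Suc r * exp (K * real (card S)) * U (card S)"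
    by (simp add: L k_def)
  finally show ?case .
qed

text \<open>Above criticality the cluster of a vertex is compared with its cluster at the critical time
  \<open>s\<close> of the set: keeping a spanning tree costs \<open>(t / s) ^ (d - 1)\<close>, which the missing
  cross edges more than compensate, and the critical clusters of a vertex are disjoint events.\<close>
lemma cprob_nolarge_le:
  assumes N: "N \<ge> 1" and t: "t > 0" and a: "a > 0" and \<delta>: "\<delta> > 0"
    and c: "0 < c" "c \<le> entropy_gap (1 + \<delta>) - t * a / real N"
    and K0: "K0 = real N * (1 + \<delta>) / t"
    and S: "S \<subseteq> {1..N}"
  shows "nolarge_prob N a S t \<le> exp (- c * (real (card S) - K0))"
  using S
proof (induction "card S" arbitrary: S rule: less_induct)
  case less
  show ?case
  \<comment> \<open>\<open>K0\<close> is the size at which \<open>t card S / N\<close> equals 1 +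
    \<delta>; up to it the claimed bound is at least 1.\<close>
  proof (cases "real (card S) \<le> K0")
    case True
    then have "1 \<le> exp (- c * (real (card S) - K0))" using c by (simp add: mult_nonneg_nonpos)
    then show ?thesis by (rule order_trans[OF cprob_le_1[OF N]])
  next
    case False
    have fS: "finite S" using less.prems finite_subset by blast
    define k where "k = card S"
    define x where "x = t * real k / real N"
    define s where "s = real N / real k"
    have Npos: "0 < real N" using N by simp
    have kK: "K0 < real k" using False by (simp add: k_def)
    moreover have "0 < K0" using N t \<delta> by (simp add: K0)
    ultimately have kpos: "0 < real k" by linarith
    have x: "1 + \<delta> < x" using kK t Npos by (simp add: K0 x_def divide_simps mult.commute)
    have s: "0 < s" "t / s = x" using kpos Npos by (simp_all add: s_def x_def)
    have st: "s \<le> t"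
    proof -
      have "1 \<le> t / s" using x s \<delta> by linarith
      then show ?thesis using s(1) by (simp add: le_divide_eq)
    qed
    have "S \<noteq> {}" using kpos by (auto simp: k_def)
    then obtain v where v: "v \<in> S" by blast
    let ?DD = "{D \<in> Pow S. v \<in> D \<and> real (card D) < a}"
    define B where "B u D e \<longleftrightarrow> conn D {p. e p \<le> u} \<and> (\<forall>p\<in>crossp D S. u < e p)" for u :: real and D e
    let ?W = "\<lambda>e. nolarge a S {p. e p \<le> t}"
    let ?b = "exp (- c * (real k - K0))"
    have "cprob N ?W \<le> cprob N (\<lambda>e. \<exists>D\<in>?DD. conn D {p. e p \<le> t} \<and> (\<forall>p\<in>crossp D S. t < e p) \<and>
        nolarge a (S - D) {p. e p \<le> t})"
    proof (rule cprob_mono[OF _ _ N])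
      show "clock_event N (ipairs S) (\<lambda>e. \<exists>D\<in>?DD. conn D {p. e p \<le> t} \<and> (\<forall>p\<in>crossp D S. t < e p) \<and>
          nolarge a (S - D) {p. e p \<le> t})"
        by (intro clock_event_Bex clock_event_block clock_event_nolarge) (use fS less.prems in auto)
      fix e :: "nat \<times> nat \<Rightarrow> real"
      assume "?W e"
      then obtain D where D: "D \<subseteq> S" "v \<in> D" "real (card D) < a" "conn D {p. e p \<le> t}"
        "{p. e p \<le> t} \<inter> crossp D S = {}" "nolarge a (S - D) {p. e p \<le> t}"
        by (rule nolarge_cases[OF _ v])
      moreover have "\<forall>p\<in>crossp D S. t < e p" using D(5) by (auto simp: not_le[symmetric])
      ultimately show "\<exists>D\<in>?DD. conn D {p. e p \<le> t} \<and> (\<forall>p\<in>crossp D S. t < e p) \<and> nolarge a (S - D) {p. e p \<le> t}"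
        by blast
    qed
    also have "... \<le> (\<Sum>D\<in>?DD. cprob N (\<lambda>e. conn D {p. e p \<le> t} \<and> (\<forall>p\<in>crossp D S. t < e p) \<and>
        nolarge a (S - D) {p. e p \<le> t}))"
      by (rule cprob_Bex_le[OF N, where J = "ipairs S"])
        (use fS less.prems in \<open>auto intro!: clock_event_block clock_event_nolarge\<close>)
    also have "... \<le> (\<Sum>D\<in>?DD. cprob N (B s D) * ?b)"
    proof (rule sum_mono)
      fix D assume "D \<in> ?DD"
      then have DS: "D \<subseteq> S" and vD: "v \<in> D" and da: "real (card D) < a" by auto
      define d where "d = card D"
      have fD: "finite D" using DS fS finite_subset by blast
      have dpos: "1 \<le> d" using vD fD by (auto simp: d_def Suc_le_eq card_gt_0_iff)
      have dk: "d \<le> k" using DS fS by (simp add: d_def k_def card_mono)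
      have cSD: "card (S - D) = k - d" using card_Diff_subset[OF fD DS] by (simp add: k_def d_def)
      have SD: "S - D \<subseteq> {1..N}" and DN: "D \<subseteq> {1..N}" using less.prems DS by auto
      have IH: "nolarge_prob N a (S - D) t \<le> exp (- c * (real (k - d) - K0))"
        using less.hyps[of "S - D"] SD cSD dpos dk kpos by (simp add: k_def)
      have conn: "conn_prob N D t \<le> x ^ (d - 1) * conn_prob N D s"
        using cprob_conn_thinning[OF N DN _ s(1) st] vD s(2) by (auto simp: d_def)
      have cross: "cross_prob N D S u = exp (- u * real d * real (k - d) / real N)" if "0 \<le> u" for u
        using cprob_cross[OF N less.prems DS that] by (simp add: d_def k_def)
      have Bs: "cprob N (B s D) = conn_prob N D s * exp (- s * real d * real (k - d) / real N)"
      proof -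
        have "cprob N (B s D) = conn_prob N D s * (cross_prob N D S s * cprob N (\<lambda>e. True))"
          using cprob_block[OF N less.prems DS clock_event_const[of N _ True], of s s] by (simp add: B_def)
        moreover have "cprob N (\<lambda>e. True) = 1"
          using prob_space.prob_space[OF prob_space_clock_space[OF N]] by simp
        ultimately show ?thesis using cross[of s] s by simp
      qed
      \<comment> \<open>Since \<open>t k / N = x\<close> and \<open>s k / N = 1\<close>, the cross
        links gain (x - 1) d up to the error (t - s) d^2 / N, while the spanning tree costs at most
        d ln x. The balance is at least d (\<open>entropy_gap x\<close> - t a / N), and the gap
        increases beyond 1, so at least c d is gained.\<close>
      have "x ^ (d - 1) * exp (- t * real d * real (k - d) / real N) \<le>
          exp (- s * real d * real (k - d) / real N) * exp (- c * real d)"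
      proof -
        have "x ^ (d - 1) \<le> x ^ d" using x \<delta> by (intro power_increasing) auto
        also have "... = exp (real d * ln x)" using x \<delta> by (simp add: exp_of_nat_mult)
        finally have "x ^ (d - 1) * exp (- t * real d * real (k - d) / real N) \<le>
            exp (real d * ln x) * exp (- t * real d * real (k - d) / real N)"
          by (rule mult_right_mono) simp
        also have "... = exp (real d * ln x - t * real d * real (k - d) / real N)"
          by (simp add: exp_add[symmetric])
        also have "... \<le> exp (- s * real d * real (k - d) / real N - c * real d)"
        proof -
          have "c \<le> entropy_gap x - t * a / real N"
            using c(2) entropy_gap_mono[of "1 + \<delta>" x] x \<delta> by linarith
          moreover have "t * real d / real N \<le> t * a / real N"
            using da t Npos by (intro divide_right_mono mult_left_mono) (auto simp: d_def)
          ultimately have "c * real d \<le> (x - 1 - ln x - t * real d / real N) * real d"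
            by (intro mult_right_mono) (auto simp: entropy_gap_def)
          also have "... \<le> (x - 1 - ln x - (t - s) * real d / real N) * real d"
            using s Npos by (intro mult_right_mono) (auto intro!: divide_right_mono mult_right_mono)
          also have "... = - real d * ln x + (t - s) * real d * real (k - d) / real N"
            using dk Npos kpos by (simp add: of_nat_diff x_def s_def field_simps)
          finally show ?thesis by (simp add: algebra_simps diff_divide_distrib)
        qed
        finally show ?thesis by (simp add: exp_add[symmetric])
      qed
      note key = this
      have "cprob N (\<lambda>e. conn D {p. e p \<le> t} \<and> (\<forall>p\<in>crossp D S. t < e p) \<and> nolarge a (S - D) {p. e p \<le> t}) =
          conn_prob N D t * (cross_prob N D S t *
          nolarge_prob N a (S - D) t)"
        by (rule cprob_block[OF N less.prems DS clock_event_nolarge[OF SD]])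
      also have "... \<le> (x ^ (d - 1) * conn_prob N D s) *
          (exp (- t * real d * real (k - d) / real N) * exp (- c * (real (k - d) - K0)))"
        using cross[of t] t x \<delta> by (intro mult_mono conn IH) auto
      also have "... = (x ^ (d - 1) * exp (- t * real d * real (k - d) / real N)) *
          (conn_prob N D s * exp (- c * (real (k - d) - K0)))" by simp
      also have "... \<le> (exp (- s * real d * real (k - d) / real N) * exp (- c * real d)) *
          (conn_prob N D s * exp (- c * (real (k - d) - K0)))"
        by (rule mult_right_mono[OF key]) simp
      also have "... = cprob N (B s D) * (exp (- c * real d) * exp (- c * (real (k - d) - K0)))"
        unfolding Bs by simp
      \<comment> \<open>The gain exp (- c d) makes up for the \<open>d\<close> particles that the
        induction hypothesis for \<open>S - D\<close> lacks.\<close>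
      also have "exp (- c * real d) * exp (- c * (real (k - d) - K0)) = ?b"
        using dk by (simp add: exp_add[symmetric] of_nat_diff algebra_simps)
      finally show "cprob N (\<lambda>e. conn D {p. e p \<le> t} \<and> (\<forall>p\<in>crossp D S. t < e p) \<and> nolarge a (S - D) {p. e p \<le> t})
          \<le> cprob N (B s D) * ?b" .
    qed
    also have "... = (\<Sum>D\<in>?DD. cprob N (B s D)) * ?b" by (simp add: sum_distrib_right)
    also have "... \<le> 1 * ?b"
    proof (rule mult_right_mono)
      interpret prob_space "clock_space N" by (rule prob_space_clock_space[OF N])
      have ev: "clock_event N (ipairs S) (B s D)" if "D \<subseteq> S" for D
        using clock_event_block[OF less.prems that clock_event_const[of N _ True], of s s] by (simp add: B_def[abs_def])
      have eq: "D = graph_cluster S ({p. e p \<le> s} \<inter> ipairs S) v" if "D \<in> ?DD" "B s D e" for D e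
      proof (rule conn_cluster_eq[symmetric])
        show "{p. e p \<le> s} \<inter> crossp D S = {}" using that(2) by (fastforce simp: B_def)
      qed (use that in \<open>simp_all add: B_def\<close>)
      have "(\<Sum>D\<in>?DD. cprob N (B s D)) = prob (\<Union>D\<in>?DD. {e \<in> clocks N. B s D e})"
      proof (rule finite_measure_finite_Union[symmetric])
        show "(\<lambda>D. {e \<in> clocks N. B s D e}) ` ?DD \<subseteq> events"
          using clock_event_sets[OF ev] by auto
        show "disjoint_family_on (\<lambda>D. {e \<in> clocks N. B s D e}) ?DD"
          unfolding disjoint_family_on_def
        proof (intro ballI impI equals0I)
          fix D D' e assume DD: "D \<in> ?DD" "D' \<in> ?DD" "D \<noteq> D'"
            and "e \<in> {e \<in> clocks N. B s D e} \<inter> {e \<in> clocks N. B s D' e}"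
          then have "B s D e" "B s D' e" by simp_all
          from eq[OF DD(1) this(1)] eq[OF DD(2) this(2)] DD(3) show False by simp
        qed
      qed (use fS in simp)
      then show "(\<Sum>D\<in>?DD. cprob N (B s D)) \<le> 1" by simp
    qed simp
    finally show ?thesis by (simp add: k_def)
  qed
qed

section \<open>The number of particles in solution\<close>

lemma clock_event_sol: "clock_event N (pairs N) (\<lambda>e. R (sol a N e t))"
proof (rule clock_event_order)
  fix e e' :: "nat \<times> nat \<Rightarrow> real"
  assume "\<forall>p\<in>pairs N. \<forall>q\<in>pairs N. (e p \<le> e q) = (e' p \<le> e' q)" "\<forall>p\<in>pairs N. (e p \<le> t) = (e' p \<le> t)"
  then have "links a N e t = links a N e' t" by (rule links_cong)
  then show "R (sol a N e t) = R (sol a N e' t)" by (simp add: sol_def)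
qed simp

text \<open>The cells of the time grid are open on the left, so a clock ringing at time 0 would
  belong to none of them.\<close>

lemma AE_clock_pos:
  assumes N: "N \<ge> 1"
  shows "AE e in clock_space N. \<forall>p\<in>pairs N. 0 < e p"
proof -
  interpret prob_space "clock_space N" by (rule prob_space_clock_space[OF N])
  have "cprob N (\<lambda>e. {p \<in> pairs N. e p \<le> 0} = {}) = rsub_prob (pairs N) (psol N 0) (\<lambda>A. A = {})"
    by (rule cprob_open[OF N]) auto
  also have "... = 1"
    using pmf_rsub[OF finite_pairs, of "psol N 0" "{}" N] by (simp add: measure_pmf_single psol_def)
  finally have "AE e in clock_space N. {p \<in> pairs N. e p \<le> 0} = {}"
    by (subst (asm) prob_Collect_eq_1)
      (use clock_event_sets[OF clock_event_open[of "pairs N" N "\<lambda>A. A = {}" 0]] in auto)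
  then show ?thesis by eventually_elim (auto simp: not_le[symmetric])
qed

lemma cprob_mono_pos:
  assumes "N \<ge> 1" "clock_event N J Q"
    and "\<And>e. (\<forall>p\<in>pairs N. 0 < e p) \<Longrightarrow> P e \<Longrightarrow> Q e"
  shows "cprob N P \<le> cprob N Q"
proof -
  interpret prob_space "clock_space N" by (rule prob_space_clock_space) fact
  have "AE e in clock_space N. e \<in> {e \<in> clocks N. P e} \<longrightarrow> e \<in> {e \<in> clocks N. Q e}"
    using AE_clock_pos[OF assms(1)] by eventually_elim (use assms(3) in auto)
  then show ?thesis by (rule finite_measure_mono_AE) (rule clock_event_sets[OF assms(2)])
qed

lemma solset_empty: "1 < a \<Longrightarrow> solset a N {} = {1..N}"
proof -
  assume "1 < a"
  moreover have "graph_cluster {1..N} {} i = {i}" if "i \<in> {1..N}" for i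
    using that by (auto simp: graph_cluster_def)
  ultimately show ?thesis by (auto simp: solset_def)
qed

lemma sol_history:
  assumes "\<forall>p\<in>pairs N. 0 < e p" "1 < a" "h > 0" "F (card (sol a N e (real M * h)))"
  shows "\<exists>r. real r * a \<le> real N \<and> hist a h M F r {1..N} e"
proof -
  let ?ys = "sort_key e (pairs_list N)"
  have "\<exists>r. real r * a \<le> real (card (solset a N (run_links a N e (real M * h) []))) \<and>
      hist a h M F r (solset a N (run_links a N e (real M * h) [])) e"
    by (rule hist_exists[where vs = ?ys])
      (use assms in \<open>simp_all add: set_pairs_list sol_eq_solset links_eq_run\<close>)
  then show ?thesis using assms(2) by (simp add: solset_empty)
qed

text \<open>A history from all \<open>N\<close> particles has \<open>r\<close> steps with
  \<open>r * a <= N\<close>. This leaves at most \<open>N + 1\<close> values of \<open>r\<close>,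
  and as the base is at least 1, its \<open>r\<close>-th power is bounded by the one with exponent
  \<open>N / a\<close>.\<close>

lemma cprob_sol_le:
  fixes a h :: real
  assumes N: "N \<ge> 1" and a: "a > 1" and h: "h > 0" and t: "t = real M * h"
    and U: "\<And>k. 0 \<le> U k"
    and base: "\<And>S. S \<subseteq> {1..N} \<Longrightarrow> cprob N (hist a h M F 0 S) \<le> U (card S)"
    and step: "\<And>k d m. k \<le> N \<Longrightarrow> 1 \<le> d \<Longrightarrow> d \<le> k \<Longrightarrow> real d < 2 * a \<Longrightarrow> m < M \<Longrightarrow>
      exp (- real d * entropy_gap (real k * (real (Suc m) * h) / real N)) * U (k - d) \<le> U k"
    and L: "1 \<le> real M * real N * real N / h"
  shows "cprob N (\<lambda>e. F (card (sol a N e t))) \<le>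
    real (N + 1) * ((real M * real N * real N / h) powr (real N / a) *
      exp ((h + 2 * a * t / real N) * real N) * U N)"
proof -
  define L where "L = real M * real N * real N / h"
  define b where "b = L powr (real N / a) * exp ((h + 2 * a * t / real N) * real N) * U N"
  let ?X = "{r \<in> {..N}. real r * a \<le> real N}"
  have ev: "clock_event N (ipairs {1..N}) (\<lambda>e. \<exists>r\<in>?X. hist a h M F r {1..N} e)"
    by (intro clock_event_Bex clock_event_hist) auto
  have b0: "0 \<le> b" using U by (simp add: b_def)
  have "cprob N (\<lambda>e. F (card (sol a N e t))) \<le> cprob N (\<lambda>e. \<exists>r\<in>?X. hist a h M F r {1..N} e)"
  proof (rule cprob_mono_pos[OF N ev])
    fix e :: "nat \<times> nat \<Rightarrow> real"
    assume "\<forall>p\<in>pairs N. 0 < e p" "F (card (sol a N e t))"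
    then obtain r where r: "real r * a \<le> real N" "hist a h M F r {1..N} e"
      using sol_history[of N e a h F M] a h t by auto
    have "real r * 1 \<le> real r * a" using a by (intro mult_left_mono) auto
    then have "r \<le> N" using r(1) by linarith
    then show "\<exists>r\<in>?X. hist a h M F r {1..N} e" using r by auto
  qed
  also have "... \<le> (\<Sum>r\<in>?X. cprob N (hist a h M F r {1..N}))"
    by (rule cprob_Bex_le[OF N, where J = "ipairs {1..N}"]) (auto intro: clock_event_hist)
  also have "... \<le> (\<Sum>r\<in>?X. b)"
  proof (rule sum_mono)
    fix r assume r: "r \<in> ?X"
    have "cprob N (hist a h M F r {1..N}) \<le> L ^ r * exp ((h + 2 * a * t / real N) * real (card {1..N})) * U (card {1..N})"
      by (rule cprob_hist_le[OF N _ h U base step _ L_def]) (use a t in auto)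
    also have "L ^ r \<le> L powr (real N / a)"
    proof -
      have "L ^ r = L powr real r" using assms(8) by (subst powr_realpow) (auto simp: L_def)
      also have "... \<le> L powr (real N / a)"
        using r a assms(8) by (intro powr_mono) (auto simp: L_def le_divide_eq)
      finally show ?thesis .
    qed
    finally show "cprob N (hist a h M F r {1..N}) \<le> b"
      using U by (simp add: b_def mult_right_mono)
  qed
  also have "... \<le> real (N + 1) * b"
  proof -
    have "card ?X \<le> card {..N}" by (intro card_mono) auto
    then show ?thesis using b0 by (simp add: mult_right_mono)
  qed
  finally show ?thesis by (simp add: b_def L_def)
qed

lemma n_limit_le_1: "n_limit t \<le> 1"
  by (simp add: n_limit_def)

lemma n_limit_pos: "0 < n_limit t"
  by (simp add: n_limit_def)

lemma card_sol_le: "card (sol a N e t) \<le> N"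
proof -
  have "card (sol a N e t) \<le> card {1..N}"
    unfolding sol_eq_solset by (rule card_mono[OF _ solset_subset]) simp
  then show ?thesis by simp
qed

lemma nsol_le_1: "nsol a N e t \<le> 1"
  using card_sol_le[of a N e t] by (cases "N = 0") (auto simp: nsol_def divide_le_eq)

text \<open>The sorted list splits into the clocks rung by \<open>t\<close> and the later ones,
  which are skipped in the run up to \<open>t\<close>. So this run makes the same decisions as the
  initial part of the run up to \<open>t'\<close>.\<close>

lemma links_mono:
  assumes "t \<le> t'"
  shows "links a N e t \<subseteq> links a N e t'"
proof -
  let ?ys = "sort_key e (pairs_list N)"
  define us where "us = takeWhile (\<lambda>p. e p \<le> t) ?ys"
  define vs where "vs = dropWhile (\<lambda>p. e p \<le> t) ?ys"
  have ys: "?ys = us @ vs" by (simp add: us_def vs_def)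
  have us: "\<forall>p\<in>set us. e p \<le> t" unfolding us_def by (auto dest: set_takeWhileD)
  have vs: "t < e p" if "p \<in> set vs" for p
  proof (cases vs)
    case Nil
    then show ?thesis using that by simp
  next
    case (Cons q vs')
    have "sorted (map e vs)" using sorted_sort_key[of e "pairs_list N"] unfolding ys by (simp add: sorted_append)
    then have "e q \<le> e p" using that Cons by auto
    moreover have "\<not> e q \<le> t"
      using hd_dropWhile[of "\<lambda>p. e p \<le> t" ?ys, folded vs_def] Cons by (simp del: dropWhile_eq_Nil_conv)
    ultimately show ?thesis by linarith
  qed
  have "fold (link_step a N e t) xs E = E" if "\<forall>p\<in>set xs. t < e p" for xs E
    using that by (induction xs arbitrary: E) (simp_all add: link_step_no)
  then have "run_links a N e t (us @ vs) = run_links a N e t us" using vs by simp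
  also have "... = run_links a N e t' us" by (rule run_links_cong) (use us assms in auto)
  also have "... \<subseteq> run_links a N e t' (us @ vs)" by (rule run_links_mono)
  finally show ?thesis by (simp only: links_eq_run ys)
qed

lemma nsol_antimono: "t \<le> t' \<Longrightarrow> nsol a N e t' \<le> nsol a N e t"
  unfolding nsol_def sol_eq_solset
  by (intro divide_right_mono of_nat_mono card_mono finite_solset solset_antimono links_mono) auto

lemma n_limit_Lipschitz:
  assumes "0 \<le> s" "s \<le> t"
  shows "n_limit t \<le> n_limit s" "n_limit s \<le> n_limit t + (t - s)"
proof -
  have *: "1 / s - 1 / t \<le> t - s" if "1 \<le> s" "s \<le> t" for s t :: real
  proof -
    have "1 / s - 1 / t = (t - s) / (s * t)" using that by (simp add: field_simps)
    also have "... \<le> (t - s) / 1" using that mult_mono[of 1 s 1 t] by (intro divide_left_mono) auto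
    finally show ?thesis by simp
  qed
  show "n_limit t \<le> n_limit s" using assms by (auto simp: n_limit_def intro: divide_left_mono)
  show "n_limit s \<le> n_limit t + (t - s)"
    using assms *[of s t] *[of 1 t] by (auto simp: n_limit_def)
qed

section \<open>The law of the configuration in solution\<close>

lemma graph_cluster_image:
  assumes "E \<subseteq> V \<times> V" "inj_on f V" "i \<in> V"
  shows "graph_cluster (f ` V) ((\<lambda>(x, y). (f x, f y)) ` E) (f i) = f ` graph_cluster V E i"
proof -
  let ?E' = "(\<lambda>(x, y). (f x, f y)) ` E"
  have 1: "(f i, f j) \<in> (?E' \<union> ?E'\<inverse>)\<^sup>*" if "(i, j) \<in> (E \<union> E\<inverse>)\<^sup>*" for j
    using that
  proof (induction rule: rtrancl_induct)
    case (step y z)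
    have "(f y, f z) \<in> ?E' \<union> ?E'\<inverse>" using step.hyps(2) by force
    with step.IH show ?case by (rule rtrancl_into_rtrancl)
  qed simp
  have 2: "\<exists>j\<in>V. y = f j \<and> (i, j) \<in> (E \<union> E\<inverse>)\<^sup>*" if "(f i, y) \<in> (?E' \<union> ?E'\<inverse>)\<^sup>*" for y
    using that
  proof (induction rule: rtrancl_induct)
    case base
    then show ?case using assms(3) by blast
  next
    case (step y z)
    obtain j where j: "j \<in> V" "y = f j" "(i, j) \<in> (E \<union> E\<inverse>)\<^sup>*" using step.IH by blast
    obtain u w where uw: "(u, w) \<in> E \<union> E\<inverse>" "y = f u" "z = f w"
      using step.hyps(2) by auto
    have V: "u \<in> V" "w \<in> V" using uw(1) assms(1) by auto
    then have "j = u" using inj_onD[OF assms(2)] j uw by auto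
    then have "(i, w) \<in> (E \<union> E\<inverse>)\<^sup>*" using j(3) uw(1) by (auto intro: rtrancl_into_rtrancl)
    then show ?case using uw(3) V by blast
  qed
  show ?thesis
  proof
    show "f ` graph_cluster V E i \<subseteq> graph_cluster (f ` V) ?E' (f i)"
      using 1 by (auto simp: graph_cluster_def)
    show "graph_cluster (f ` V) ?E' (f i) \<subseteq> f ` graph_cluster V E i"
      using 2 by (fastforce simp: graph_cluster_def)
  qed
qed

lemma no_large_comp_image:
  assumes "E \<subseteq> V \<times> V" "inj_on f V"
  shows "no_large_comp a (f ` V, (\<lambda>(x, y). (f x, f y)) ` E) \<longleftrightarrow> no_large_comp a (V, E)"
proof -
  have "card (graph_cluster (f ` V) ((\<lambda>(x, y). (f x, f y)) ` E) (f i)) = card (graph_cluster V E i)" if "i \<in> V" for i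
    unfolding graph_cluster_image[OF assms that]
    by (rule card_image) (rule inj_on_subset[OF assms(2) graph_cluster_subset])
  then show ?thesis by (simp add: no_large_comp_def)
qed

lemma graph_iso_image:
  assumes "E \<subseteq> V \<times> V" "inj_on f V"
  shows "graph_iso (V, E) (f ` V, (\<lambda>(x, y). (f x, f y)) ` E)"
  unfolding graph_iso_def fst_conv snd_conv
proof (intro exI conjI ballI)
  show "bij_betw f V (f ` V)" using assms(2) by (rule inj_on_imp_bij_betw)
  have *: "(f i, f j) \<in> (\<lambda>(x, y). (f x, f y)) ` E \<longleftrightarrow> (i, j) \<in> E" if "i \<in> V" "j \<in> V" for i j
  proof
    assume "(f i, f j) \<in> (\<lambda>(x, y). (f x, f y)) ` E"
    then obtain u w where uw: "(u, w) \<in> E" "f i = f u" "f j = f w" by auto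
    have "u \<in> V" "w \<in> V" using uw(1) assms(1) by auto
    then have "i = u" "j = w" using inj_onD[OF assms(2)] uw that by auto
    then show "(i, j) \<in> E" using uw by simp
  qed force
  fix i j assume "i \<in> V" "j \<in> V"
  then show "uedge E i j = uedge ((\<lambda>(x, y). (f x, f y)) ` E) (f i) (f j)"
    using * by (simp add: uedge_def)
qed

text \<open>Edges are stored with the smaller end first; an increasing relabelling keeps them in
  this form.\<close>

lemma ipairs_strict_mono_image:
  assumes "strict_mono_on V f"
  shows "(\<lambda>(x, y). (f x, f y)) ` ipairs V = ipairs (f ` V)"
proof
  show "(\<lambda>(x, y). (f x, f y)) ` ipairs V \<subseteq> ipairs (f ` V)"
    using strict_mono_onD[OF assms] by (auto simp: ipairs_def)
  show "ipairs (f ` V) \<subseteq> (\<lambda>(x, y). (f x, f y)) ` ipairs V"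
  proof
    fix p assume "p \<in> ipairs (f ` V)"
    then obtain x y where xy: "p = (f x, f y)" "f x < f y" "x \<in> V" "y \<in> V" by (auto simp: ipairs_def)
    have "x < y"
      using xy strict_mono_onD[OF assms, of y x] by (cases x y rule: linorder_cases) auto
    then have "(x, y) \<in> ipairs V" using xy by (simp add: ipairs_def)
    then show "p \<in> (\<lambda>(x, y). (f x, f y)) ` ipairs V" using xy by force
  qed
qed

text \<open>The weights involve cardinalities only, which makes invariance under bijections a change
  of the summation index.\<close>

lemma prob_rsub_sum:
  assumes "finite I" "0 \<le> p" "p \<le> 1"
  shows "rsub_prob I p (\<lambda>A. R A) =
    (\<Sum>A\<in>Pow I. if R A then p ^ card A * (1 - p) ^ (card I - card A) else 0)"
proof -
  have "rsub_prob I p (\<lambda>A. R A) = measure_pmf.prob (rsub I p) {A \<in> Pow I. R A}"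
    using prob_rsub_cong[of I R "\<lambda>A. A \<in> Pow I \<and> R A"] by simp
  also have "... = (\<Sum>A\<in>{A \<in> Pow I. R A}. pmf (rsub I p) A)"
    using assms(1) by (intro measure_measure_pmf_finite) simp
  also have "... = (\<Sum>A\<in>{A \<in> Pow I. R A}. p ^ card A * (1 - p) ^ (card I - card A))"
  proof (rule sum.cong)
    fix A assume "A \<in> {A \<in> Pow I. R A}"
    then have A: "A \<subseteq> I" by simp
    then have "card (I - A) = card I - card A" using assms(1) by (intro card_Diff_subset) (auto intro: finite_subset)
    then show "pmf (rsub I p) A = p ^ card A * (1 - p) ^ (card I - card A)" using pmf_rsub[OF assms A] by simp
  qed simp
  also have "... = (\<Sum>A\<in>Pow I. if R A then p ^ card A * (1 - p) ^ (card I - card A) else 0)"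
    using assms(1) by (intro sum.inter_filter) simp
  finally show ?thesis .
qed

lemma prob_rsub_bij:
  assumes "bij_betw f I J" "finite I" "0 \<le> p" "p \<le> 1"
  shows "rsub_prob J p (\<lambda>A. R A) = rsub_prob I p (\<lambda>B. R (f ` B))"
proof -
  have J: "finite J" using assms bij_betw_finite by blast
  have cIJ: "card J = card I" by (rule bij_betw_same_card[OF assms(1), symmetric])
  have bp: "bij_betw (image f) (Pow I) (Pow J)" by (rule bij_betw_Pow[OF assms(1)])
  have "(\<Sum>A\<in>Pow J. if R A then p ^ card A * (1 - p) ^ (card J - card A) else 0) =
      (\<Sum>B\<in>Pow I. if R (f ` B) then p ^ card (f ` B) * (1 - p) ^ (card J - card (f ` B)) else 0)"
    by (rule sum.reindex_bij_betw[OF bp, symmetric])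
  also have "... = (\<Sum>B\<in>Pow I. if R (f ` B) then p ^ card B * (1 - p) ^ (card I - card B) else 0)"
  proof (rule sum.cong)
    fix B assume "B \<in> Pow I"
    then have "inj_on f B" using assms(1) by (auto simp: bij_betw_def intro: inj_on_subset)
    then show "(if R (f ` B) then p ^ card (f ` B) * (1 - p) ^ (card J - card (f ` B)) else 0) =
        (if R (f ` B) then p ^ card B * (1 - p) ^ (card I - card B) else 0)"
      by (simp add: card_image cIJ)
  qed simp
  finally show ?thesis
    using prob_rsub_sum[OF J assms(3,4)] prob_rsub_sum[OF assms(2-4)] by simp
qed

text \<open>The increasing enumeration of \<open>S\<close> induces a bijection of stored edges and
  hence preserves the law; \<open>Q\<close> and the size condition are invariant under the resulting
  graph isomorphism.\<close>

lemma prob_rsub_eq_ER: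
  assumes "finite S" "iso_invariant Q" "0 \<le> p" "p \<le> 1"
  shows "rsub_prob (ipairs S) p (\<lambda>A. Q (S, A) \<and> no_large_comp a (S, A)) =
    measure_pmf.prob (ER (card S) p) {G. Q G \<and> no_large_comp a G}"
proof -
  obtain h where h: "bij_betw h {..<card S} S" "strict_mono_on {..<card S} h"
    by (rule ex_bij_betw_strict_mono_card[OF assms(1)])
  define V where "V = {1..card S}"
  \<comment> \<open>The vertices of \<open>ER\<close> start at 1, the enumeration of
    \<open>S\<close> starts at 0.\<close>
  define f where "f i = h (i - 1)" for i
  define F where "F = (\<lambda>(x, y). (f x, f y))"
  have mono: "strict_mono_on V f"
    unfolding V_def f_def by (rule strict_mono_onI) (auto intro!: strict_mono_onD[OF h(2)])
  have inj: "inj_on f V" by (rule strict_mono_on_imp_inj_on[OF mono])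
  have fV: "f ` V = S"
  proof -
    have "(\<lambda>i. i - 1) ` V = {..<card S}"
    proof
      show "{..<card S} \<subseteq> (\<lambda>i. i - 1) ` V"
      proof
        fix i assume "i \<in> {..<card S}"
        then have "Suc i \<in> V" by (simp add: V_def)
        then show "i \<in> (\<lambda>i. i - 1) ` V" by (rule rev_image_eqI) simp
      qed
    qed (auto simp: V_def)
    then have "h ` ((\<lambda>i. i - 1) ` V) = S" using h(1) unfolding bij_betw_def by (simp only:)
    then show ?thesis unfolding image_image f_def .
  qed
  have VV: "ipairs V \<subseteq> V \<times> V" by (auto simp: ipairs_def)
  have bij: "bij_betw F (ipairs V) (ipairs S)"
    unfolding bij_betw_def
  proof
    show "F ` ipairs V = ipairs S" unfolding F_def using ipairs_strict_mono_image[OF mono] fV by simp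
    show "inj_on F (ipairs V)"
    proof (rule inj_onI)
      fix p q assume "p \<in> ipairs V" "q \<in> ipairs V" "F p = F q"
      then show "p = q"
        using inj_onD[OF inj, of "fst p" "fst q"] inj_onD[OF inj, of "snd p" "snd q"]
        by (cases p; cases q) (simp add: F_def ipairs_def)
    qed
  qed
  have "rsub_prob (ipairs S) p (\<lambda>A. Q (S, A) \<and> no_large_comp a (S, A)) =
      rsub_prob (ipairs V) p (\<lambda>B. Q (S, F ` B) \<and> no_large_comp a (S, F ` B))"
    by (rule prob_rsub_bij[OF bij _ assms(3,4)]) (simp add: V_def finite_ipairs)
  also have "... = rsub_prob (ipairs V) p (\<lambda>B. Q (V, B) \<and> no_large_comp a (V, B))"
  proof (rule prob_rsub_cong)
    fix B assume "B \<subseteq> ipairs V"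
    then have B: "B \<subseteq> V \<times> V" using VV by blast
    have "Q (V, B) = Q (S, F ` B)"
      using graph_iso_image[OF B inj] assms(2) unfolding iso_invariant_def fV F_def by blast
    then show "(Q (S, F ` B) \<and> no_large_comp a (S, F ` B)) = (Q (V, B) \<and> no_large_comp a (V, B))"
      using no_large_comp_image[OF B inj, of a] unfolding fV F_def by simp
  qed
  also have "... = measure_pmf.prob (ER (card S) p) {G. Q G \<and> no_large_comp a G}"
    unfolding ER_eq_rsub measure_map_pmf pairs_eq_ipairs V_def by (simp add: vimage_def)
  finally show ?thesis .
qed

lemma clock_event_outside:
  "clock_event N (pairs N - ipairs S) (\<lambda>e. outside_event a N e t S)"
proof (rule clock_event_order)
  fix e e' :: "nat \<times> nat \<Rightarrow> real"
  assume "\<forall>p\<in>pairs N - ipairs S. \<forall>q\<in>pairs N - ipairs S. (e p \<le> e q) = (e' p \<le> e' q)"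
    "\<forall>p\<in>pairs N - ipairs S. (e p \<le> t) = (e' p \<le> t)"
  then show "outside_event a N e t S = outside_event a N e' t S" by (rule outside_event_cong)
qed blast

text \<open>Once the solution is \<open>S\<close>, the configuration is a function of the clocks
  inside \<open>S\<close>. Independence splits off the outside factor, in which \<open>Q\<close>
  does not occur.\<close>

lemma cprob_config_given_sol:
  assumes N: "N \<ge> 1" and t: "t \<ge> 0" and S: "S \<subseteq> {1..N}" and Q: "iso_invariant Q"
  shows "clock_event N (pairs N) (\<lambda>e. sol a N e t = S \<and> Q (config a N e t))"
    and "cprob N (\<lambda>e. sol a N e t = S \<and> Q (config a N e t)) =
      measure_pmf.prob (ER (card S) (psol N t)) {G. Q G \<and> no_large_comp a G} *
      cprob N (\<lambda>e. outside_event a N e t S)"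
proof -
  let ?R = "\<lambda>A. Q (S, A) \<and> no_large_comp a (S, A)"
  have fS: "finite S" using S finite_subset by blast
  have SN: "ipairs S \<subseteq> pairs N" by (rule ipairs_subset_pairs[OF S])
  have config: "config a N e t = (S, {p \<in> ipairs S. e p \<le> t})" if "sol a N e t = S" for e
    using that SN unfolding config_def pairs_eq_ipairs by (auto simp: ipairs_def)
  have iff: "(sol a N e t = S \<and> Q (config a N e t)) =
      (?R {p \<in> ipairs S. e p \<le> t} \<and> outside_event a N e t S)" for e
    using sol_eq_iff[OF S, of a e t] nolarge_open_iff[of a S e t] config[of e] by auto
  have ev: "clock_event N (ipairs S) (\<lambda>e. ?R {p \<in> ipairs S. e p \<le> t})"
    by (rule clock_event_open[OF SN])
  show "clock_event N (pairs N) (\<lambda>e. sol a N e t = S \<and> Q (config a N e t))"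
    unfolding iff
    by (rule clock_event_conj[OF clock_event_mono[OF ev SN] clock_event_mono[OF clock_event_outside]]) blast
  have "cprob N (\<lambda>e. ?R {p \<in> ipairs S. e p \<le> t} \<and> outside_event a N e t S) =
      cprob N (\<lambda>e. ?R {p \<in> ipairs S. e p \<le> t}) * cprob N (\<lambda>e. outside_event a N e t S)"
    by (rule cprob_indep[OF N ev clock_event_outside]) (use SN in auto)
  also have "cprob N (\<lambda>e. ?R {p \<in> ipairs S. e p \<le> t}) = rsub_prob (ipairs S) (psol N t) (\<lambda>A. ?R A)"
    by (rule cprob_open[OF N SN t])
  also have "... = measure_pmf.prob (ER (card S) (psol N t)) {G. Q G \<and> no_large_comp a G}"
    using psol_bounds[OF t, of N] by (intro prob_rsub_eq_ER fS Q) auto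
  finally show "cprob N (\<lambda>e. sol a N e t = S \<and> Q (config a N e t)) =
      measure_pmf.prob (ER (card S) (psol N t)) {G. Q G \<and> no_large_comp a G} *
      cprob N (\<lambda>e. outside_event a N e t S)"
    unfolding iff .
qed

text \<open>Summed over the sets of size \<open>k\<close>, the outside factors give the same number
  \<open>W\<close> for every property. The property that is always true yields the denominator, and
  \<open>W\<close> cancels.\<close>

lemma config_law:
  assumes N: "N \<ge> 1" and t: "t \<ge> 0" and Q: "iso_invariant Q"
    and pos: "cprob N (\<lambda>e. real N * nsol a N e t = real k) > 0"
  shows "cprob N (\<lambda>e. Q (config a N e t) \<and> real N * nsol a N e t = real k) /
      cprob N (\<lambda>e. real N * nsol a N e t = real k) =
    measure_pmf.prob (ER k (psol N t)) {G. Q G \<and> no_large_comp a G} /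
      measure_pmf.prob (ER k (psol N t)) {G. no_large_comp a G}"
proof -
  interpret prob_space "clock_space N" by (rule prob_space_clock_space[OF N])
  let ?X = "{S \<in> Pow {1..N}. card S = k}"
  define W where "W = (\<Sum>S\<in>?X. cprob N (\<lambda>e. outside_event a N e t S))"
  have nk: "real N * nsol a N e t = real k \<longleftrightarrow> card (sol a N e t) = k" for e
    using N by (simp add: nsol_def)
  have sub: "sol a N e t \<subseteq> {1..N}" for e unfolding sol_eq_solset by (rule solset_subset)
  have main: "cprob N (\<lambda>e. R (config a N e t) \<and> real N * nsol a N e t = real k) =
      measure_pmf.prob (ER k (psol N t)) {G. R G \<and> no_large_comp a G} * W" if R: "iso_invariant R" for R
  proof -
    have "{e \<in> clocks N. R (config a N e t) \<and> real N * nsol a N e t = real k} =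
        (\<Union>S\<in>?X. {e \<in> clocks N. sol a N e t = S \<and> R (config a N e t)})"
      unfolding nk using sub by auto
    then have "cprob N (\<lambda>e. R (config a N e t) \<and> real N * nsol a N e t = real k) =
        prob (\<Union>S\<in>?X. {e \<in> clocks N. sol a N e t = S \<and> R (config a N e t)})" by simp
    also have "... = (\<Sum>S\<in>?X. cprob N (\<lambda>e. sol a N e t = S \<and> R (config a N e t)))"
    proof (rule finite_measure_finite_Union)
      show "(\<lambda>S. {e \<in> clocks N. sol a N e t = S \<and> R (config a N e t)}) ` ?X \<subseteq> events"
        using clock_event_sets[OF cprob_config_given_sol(1)[OF N t _ R]] by auto
    qed (auto simp: disjoint_family_on_def)
    also have "... = (\<Sum>S\<in>?X. measure_pmf.prob (ER k (psol N t)) {G. R G \<and> no_large_comp a G} *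
        cprob N (\<lambda>e. outside_event a N e t S))"
      by (rule sum.cong) (use cprob_config_given_sol(2)[OF N t _ R] in auto)
    finally show ?thesis by (simp add: W_def sum_distrib_left)
  qed
  have "cprob N (\<lambda>e. real N * nsol a N e t = real k) = measure_pmf.prob (ER k (psol N t)) {G. no_large_comp a G} * W"
    using main[of "\<lambda>_. True"] by (simp add: iso_invariant_def)
  then show ?thesis using main[OF Q] pos by auto
qed

section \<open>Convergence in the Skorokhod space\<close>

lemma nsol_cong:
  assumes "\<forall>p\<in>pairs N. \<forall>q\<in>pairs N. (e p \<le> e q) = (e' p \<le> e' q)"
    and "\<forall>p\<in>pairs N. (e p \<le> t) = (e' p \<le> t')"
  shows "nsol a N e t = nsol a N e' t'"
  using links_cong[OF assms] by (simp add: nsol_def sol_def)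

lemma cadlag_nsol: "cadlag (nsol a N e)"
  unfolding cadlag_def
proof (intro allI impI conjI)
  fix t :: real
  have "eventually (\<lambda>s. (e p \<le> s) = (e p \<le> t)) (at_right t)" for p
  proof (cases "e p \<le> t")
    case True
    have "eventually (\<lambda>s. s > t) (at_right t)" by (rule eventually_at_right_less)
    then show ?thesis by eventually_elim (use True in auto)
  next
    case False
    then have "eventually (\<lambda>s. s < e p) (at_right t)"
      by (intro order_tendstoD(2)[OF tendsto_ident_at]) simp
    then show ?thesis by eventually_elim (use False in auto)
  qed
  then have "eventually (\<lambda>s. \<forall>p\<in>pairs N. (e p \<le> s) = (e p \<le> t)) (at_right t)"
    by (intro eventually_ball_finite finite_pairs) auto
  then have "eventually (\<lambda>s. nsol a N e s = nsol a N e t) (at_right t)"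
    by eventually_elim (rule nsol_cong, auto)
  then show "continuous (at_right t) (nsol a N e)"
    unfolding continuous_within by (rule tendsto_eventually)
next
  fix t :: real
  \<comment> \<open>Shortly before \<open>t\<close> exactly the clocks ringing before
    \<open>t\<close> have rung, so the path is constant there and its value at \<open>s0\<close> is
    the left limit.\<close>
  define Pr where "Pr s \<longleftrightarrow> (\<forall>p\<in>pairs N. (e p \<le> s) = (e p < t))" for s
  have "eventually (\<lambda>s. (e p \<le> s) = (e p < t)) (at_left t)" for p
  proof (cases "e p < t")
    case True
    then have "eventually (\<lambda>s. e p < s) (at_left t)"
      by (intro order_tendstoD(1)[OF tendsto_ident_at]) simp
    then show ?thesis by eventually_elim (use True in auto)
  next
    case False
    have "eventually (\<lambda>s. s < t) (at_left t)" by (simp add: eventually_at_filter)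
    then show ?thesis by eventually_elim (use False in auto)
  qed
  then have Pr: "eventually Pr (at_left t)"
    unfolding Pr_def by (intro eventually_ball_finite finite_pairs) auto
  then obtain s0 where s0: "Pr s0" using eventually_happens'[OF trivial_limit_at_left_real] by blast
  from Pr have "eventually (\<lambda>s. nsol a N e s = nsol a N e s0) (at_left t)"
    by eventually_elim (rule nsol_cong, use s0 in \<open>auto simp: Pr_def\<close>)
  then show "\<exists>l. (nsol a N e \<longlongrightarrow> l) (at_left t)" by (blast intro: tendsto_eventually)
qed

lemma n_limit_eq: "n_limit t = 1 / max 1 t"
  by (simp add: n_limit_def max_def)

lemma isCont_n_limit: "isCont n_limit t"
  unfolding n_limit_eq[abs_def] by (intro continuous_intros) auto

lemma cadlag_n_limit: "cadlag n_limit"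
  unfolding cadlag_def using isCont_n_limit continuous_at_imp_continuous_at_within
  by (auto simp: continuous_within intro!: exI)

lemma skorokhod_conv_uniform:
  assumes "\<And>n t. t \<in> {0..real n} \<Longrightarrow> \<bar>xs n t - x t\<bar> \<le> 1 / real (Suc n)"
  shows "skorokhod_conv xs x"
  unfolding skorokhod_conv_def
proof (intro exI[of _ "\<lambda>_ t. t"] conjI allI impI)
  show "time_change (\<lambda>t. t)" by (auto simp: time_change_def strict_mono_on_def)
  fix T \<epsilon> :: real assume "T \<ge> 0" "\<epsilon> > 0"
  have "eventually (\<lambda>n. T \<le> real n) sequentially"
    using filterlim_at_top[THEN iffD1, OF filterlim_real_sequentially] by blast
  moreover have "eventually (\<lambda>n. 1 / real (Suc n) < \<epsilon>) sequentially"
    using order_tendstoD(2)[OF lim_1_over_n[THEN filterlim_compose, OF filterlim_Suc], of \<epsilon>] \<open>\<epsilon> > 0\<close> by simp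
  ultimately show "eventually (\<lambda>n. \<forall>t\<in>{0..T}. \<bar>xs n t - x t\<bar> < \<epsilon>) sequentially"
  proof eventually_elim
    case (elim n)
    show ?case
    proof
      fix t assume "t \<in> {0..T}"
      then have "\<bar>xs n t - x t\<bar> \<le> 1 / real (Suc n)" using elim(1) by (intro assms) auto
      then show "\<bar>xs n t - x t\<bar> < \<epsilon>" using elim(2) by linarith
    qed
  qed
qed auto

text \<open>Otherwise, for every \<open>n\<close>, some path within \<open>1 / (n + 1)\<close> of
  \<open>x\<close> on \<open>{0..n}\<close> would violate the bound; these paths converge to
  \<open>x\<close> with the identity as time change, against sequential continuity.\<close>

lemma sk_continuous_uniform:
  assumes F: "sk_continuous F" and x: "cadlag x" and \<epsilon>: "\<epsilon> > 0"
  obtains T \<delta> where "T \<ge> 0" "\<delta> > 0"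
    "\<forall>y. cadlag y \<longrightarrow> (\<forall>t\<in>{0..T}. \<bar>y t - x t\<bar> \<le> \<delta>) \<longrightarrow> \<bar>F y - F x\<bar> < \<epsilon>"
proof -
  have "\<exists>n. \<forall>y. cadlag y \<longrightarrow> (\<forall>t\<in>{0..real n}. \<bar>y t - x t\<bar> \<le> 1 / real (Suc n)) \<longrightarrow> \<bar>F y - F x\<bar> < \<epsilon>"
  proof (rule ccontr)
    assume "\<not> ?thesis"
    then have "\<forall>n. \<exists>y. cadlag y \<and> (\<forall>t\<in>{0..real n}. \<bar>y t - x t\<bar> \<le> 1 / real (Suc n)) \<and> \<not> \<bar>F y - F x\<bar> < \<epsilon>"
      by blast
    then obtain ys where ys: "\<And>n. cadlag (ys n)" "\<And>n t. t \<in> {0..real n} \<Longrightarrow> \<bar>ys n t - x t\<bar> \<le> 1 / real (Suc n)"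
      "\<And>n. \<not> \<bar>F (ys n) - F x\<bar> < \<epsilon>" by metis
    have "skorokhod_conv ys x" by (rule skorokhod_conv_uniform[OF ys(2)])
    then have "(\<lambda>n. F (ys n)) \<longlonglongrightarrow> F x"
      using ys(1) x by (intro F[unfolded sk_continuous_def, rule_format]) simp
    then have "eventually (\<lambda>n. \<bar>F (ys n) - F x\<bar> < \<epsilon>) sequentially"
      unfolding tendsto_iff dist_real_def using \<epsilon> by blast
    then show False using ys(3) by simp
  qed
  then obtain n where n: "\<forall>y. cadlag y \<longrightarrow> (\<forall>t\<in>{0..real n}. \<bar>y t - x t\<bar> \<le> 1 / real (Suc n)) \<longrightarrow> \<bar>F y - F x\<bar> < \<epsilon>" ..
  show thesis by (rule that[of "real n" "1 / real (Suc n)"]) (use n in auto)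
qed

lemma finite_gap:
  fixes A :: "real set"
  assumes "finite A"
  obtains w where "0 < w" "\<And>x y. x \<in> A \<Longrightarrow> y \<in> A \<Longrightarrow> x < y \<Longrightarrow> w \<le> y - x"
proof -
  \<comment> \<open>The element 1 keeps the set nonempty, so its minimum exists and is positive even
    if there are no gaps.\<close>
  let ?D = "insert 1 ((\<lambda>(x, y). y - x) ` {z \<in> A \<times> A. fst z < snd z})"
  have fin: "finite ?D" using assms by simp
  have "0 < Min ?D" using fin by (subst Min_gr_iff) auto
  moreover have "Min ?D \<le> y - x" if "x \<in> A" "y \<in> A" "x < y" for x y
    by (rule Min_le[OF fin]) (use that in force)
  ultimately show thesis using that by blast
qed

text \<open>Adding to the identity tents of height \<open>d v\<close> around the points \<open>v\<close> moves these points by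
  \<open>d v\<close>; the result is a time change because the slopes add up to less than 1.\<close>
lemma tent_time_change:
  fixes V :: "real set" and d :: "real \<Rightarrow> real"
  assumes V: "finite V" and w: "0 < w" "\<And>v. v \<in> V \<Longrightarrow> w \<le> v"
    "\<And>u v. u \<in> V \<Longrightarrow> v \<in> V \<Longrightarrow> u < v \<Longrightarrow> w \<le> v - u"
    and d: "\<And>v. v \<in> V \<Longrightarrow> 0 \<le> d v" "(\<Sum>v\<in>V. d v) < w"
  defines "l \<equiv> \<lambda>t. t + (\<Sum>v\<in>V. d v * max 0 (1 - \<bar>t - v\<bar> / w))"
  shows "time_change l" "\<And>v. v \<in> V \<Longrightarrow> l v = v + d v" "\<And>t. \<bar>l t - t\<bar> \<le> (\<Sum>v\<in>V. d v)"
proof -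
  define h where "h v t = max 0 (1 - \<bar>t - v\<bar> / w)" for v t :: real
  have l: "l t = t + (\<Sum>v\<in>V. d v * h v t)" for t by (simp add: l_def h_def)
  have h01: "0 \<le> h v t" "h v t \<le> 1" for v t using w(1) by (auto simp: h_def)
  have hLip: "\<bar>h v s - h v t\<bar> \<le> \<bar>s - t\<bar> / w" for v s t
  proof -
    have "\<bar>max 0 (1 - x) - max 0 (1 - y)\<bar> \<le> \<bar>x - y\<bar>" for x y :: real
      by (simp add: max_def abs_if)
    then have "\<bar>h v s - h v t\<bar> \<le> \<bar>\<bar>s - v\<bar> / w - \<bar>t - v\<bar> / w\<bar>" unfolding h_def .
    also have "... = \<bar>\<bar>s - v\<bar> - \<bar>t - v\<bar>\<bar> / w" using w(1) by (simp add: diff_divide_distrib[symmetric])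
    also have "... \<le> \<bar>s - t\<bar> / w" using w(1) by (intro divide_right_mono) auto
    finally show ?thesis .
  qed
  have h0: "h v t = 0" if "w \<le> \<bar>t - v\<bar>" for v t using that w(1) by (simp add: h_def)
  have l_ge: "t \<le> l t" for t
    unfolding l using d(1) h01 by (simp add: sum_nonneg)
  show bound: "\<bar>l t - t\<bar> \<le> (\<Sum>v\<in>V. d v)" for t
  proof -
    have "(\<Sum>v\<in>V. d v * h v t) \<le> (\<Sum>v\<in>V. d v)"
      using d(1) h01 by (intro sum_mono) (simp add: mult_left_le)
    then show ?thesis using l_ge[of t] by (simp add: l)
  qed
  show "l v = v + d v" if v: "v \<in> V" for v
  proof -
    have "(\<Sum>u\<in>V. d u * h u v) = (\<Sum>u\<in>V. if u = v then d u else 0)"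
    proof (rule sum.cong)
      fix u assume u: "u \<in> V"
      show "d u * h u v = (if u = v then d u else 0)"
      proof (cases "u = v")
        case True
        then show ?thesis by (simp add: h_def)
      next
        case False
        \<comment> \<open>The tent around \<open>u\<close> has half width \<open>w\<close>, so it
          vanishes at every other point of \<open>V\<close>.\<close>
        then have "w \<le> \<bar>v - u\<bar>" using w(3)[OF u v] w(3)[OF v u] by (cases u v rule: linorder_cases) auto
        then show ?thesis using False h0 by simp
      qed
    qed simp
    then show ?thesis using V v by (simp add: l)
  qed
  have mono: "l s < l t" if "s < t" for s t
  proof -
    have "(\<Sum>v\<in>V. d v * h v s) - (\<Sum>v\<in>V. d v * h v t) = (\<Sum>v\<in>V. d v * (h v s - h v t))"
      by (simp add: sum_subtractf right_diff_distrib)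
    also have "... \<le> (\<Sum>v\<in>V. d v * ((t - s) / w))"
      using hLip[of _ s t] that d(1) by (intro sum_mono mult_left_mono) (auto simp: abs_le_iff)
    also have "... = (\<Sum>v\<in>V. d v) * ((t - s) / w)" by (rule sum_distrib_right[symmetric])
    also have "... < w * ((t - s) / w)" using d(2) that w(1) by (intro mult_strict_right_mono) auto
    also have "... = t - s" using w(1) by simp
    finally show ?thesis by (simp add: l)
  qed
  have cont: "continuous_on {0..} l"
    unfolding l_def using w(1) by (intro continuous_intros) auto
  \<comment> \<open>All points of \<open>V\<close> are at least \<open>w\<close>, so no tent moves
    0; the intermediate value theorem then gives surjectivity.\<close>
  have l00: "l 0 = 0"
  proof -
    have "h v 0 = 0" if "v \<in> V" for v using h0 w(1) w(2)[OF that] by simp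
    then show ?thesis by (simp add: l)
  qed
  have "l ` {0..} = {0..}"
  proof
    show "l ` {0..} \<subseteq> {0..}" using l_ge by (auto intro: order_trans)
    show "{0..} \<subseteq> l ` {0..}"
    proof
      fix y :: real assume y: "y \<in> {0..}"
      have "\<exists>x\<ge>0. x \<le> y \<and> l x = y"
        by (rule IVT') (use y l00 l_ge continuous_on_subset[OF cont] in auto)
      then show "y \<in> l ` {0..}" by force
    qed
  qed
  then show "time_change l"
    using cont mono by (auto simp: time_change_def strict_mono_on_def)
qed

text \<open>Rounding the clocks up to a grid of mesh \<open>1 / (n + 1)\<close> keeps their order for large \<open>n\<close>,
  hence only moves the jump times of the path.\<close>
definition rounded :: "nat \<Rightarrow> (nat \<times> nat \<Rightarrow> real) \<Rightarrow> nat \<times> nat \<Rightarrow> real" where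
  "rounded n e p = of_int \<lceil>real (Suc n) * e p\<rceil> / real (Suc n)"

lemma rounded_bounds: "e p \<le> rounded n e p" "rounded n e p < e p + 1 / real (Suc n)"
proof -
  have "real (Suc n) * e p \<le> of_int \<lceil>real (Suc n) * e p\<rceil>" by (rule le_of_int_ceiling)
  then show "e p \<le> rounded n e p" by (simp add: rounded_def le_divide_eq mult.commute)
  have "of_int \<lceil>real (Suc n) * e p\<rceil> < real (Suc n) * e p + 1" by linarith
  then show "rounded n e p < e p + 1 / real (Suc n)"
    unfolding rounded_def by (simp add: divide_less_eq distrib_left mult.commute[of _ "real (Suc n)"] del: of_nat_Suc)
qed

lemma rounded_mono: "e p \<le> e q \<Longrightarrow> rounded n e p \<le> rounded n e q"
  unfolding rounded_def by (intro divide_right_mono of_int_le_iff[THEN iffD2] ceiling_mono mult_left_mono) auto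

lemma rounded_nonpos: "e p \<le> 0 \<Longrightarrow> rounded n e p \<le> 0"
  by (simp add: rounded_def divide_le_0_iff mult_le_0_iff)

text \<open>The tents send each positive clock to its rounded value. So the rounded clocks at time
  \<open>l n t\<close> show the same order and the same rung links as the original ones at time
  \<open>t\<close>, and the two paths agree exactly.\<close>

lemma skorokhod_conv_rounded: "skorokhod_conv (\<lambda>n. nsol a N (rounded n e)) (nsol a N e)"
proof -
  let ?P = "pairs N"
  define V where "V = {v \<in> e ` ?P. 0 < v}"
  have fV: "finite V" using finite_pairs by (simp add: V_def)
  \<comment> \<open>Including 0 keeps the positive clocks at distance \<open>w\<close> from the
    origin, as the tents require.\<close>
  obtain w where w: "0 < w" "\<And>x y. x \<in> insert 0 (e ` ?P) \<Longrightarrow> y \<in> insert 0 (e ` ?P) \<Longrightarrow> x < y \<Longrightarrow> w \<le> y - x"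
    using finite_gap[of "insert 0 (e ` ?P)"] finite_pairs by blast
  define d where "d n v = of_int \<lceil>real (Suc n) * v\<rceil> / real (Suc n) - v" for n :: nat and v
  have d_e: "d n (e p) = rounded n e p - e p" for n p by (simp add: d_def rounded_def)
  have d_bounds: "0 \<le> d n v" "d n v \<le> 1 / real (Suc n)" if "v \<in> V" for n v
  proof -
    obtain p where p: "v = e p" using \<open>v \<in> V\<close> by (auto simp: V_def)
    show "0 \<le> d n v" "d n v \<le> 1 / real (Suc n)"
      using rounded_bounds[where e = e and n = n and p = p] unfolding p d_e by linarith+
  qed
  define l where "l n t = t + (\<Sum>v\<in>V. d n v * max 0 (1 - \<bar>t - v\<bar> / w))" for n t
  \<comment> \<open>The tents give a time change when the grid is fine enough; the identity serves
    for the finitely many other \<open>n\<close>. The summand 1 in \<open>card V + 1\<close> ensures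
    \<open>1 / (n + 1) < w\<close> also for empty \<open>V\<close>.\<close>
  define ls where "ls n = (if real (card V + 1) / real (Suc n) < w then l n else (\<lambda>t. t))" for n
  have sum_le: "(\<Sum>v\<in>V. d n v) \<le> real (card V + 1) / real (Suc n)" for n
  proof -
    have "(\<Sum>v\<in>V. d n v) \<le> (\<Sum>v\<in>V. 1 / real (Suc n))" by (intro sum_mono d_bounds)
    also have "... \<le> real (card V + 1) / real (Suc n)" by (simp add: divide_right_mono)
    finally show ?thesis .
  qed
  have tent: "time_change (l n)" "\<And>v. v \<in> V \<Longrightarrow> l n v = v + d n v" "\<And>t. \<bar>l n t - t\<bar> \<le> (\<Sum>v\<in>V. d n v)"
    if n: "real (card V + 1) / real (Suc n) < w" for n
  proof -
    have 1: "w \<le> v" if "v \<in> V" for v using w(2)[of 0 v] that by (auto simp: V_def)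
    have 2: "w \<le> v - u" if "u \<in> V" "v \<in> V" "u < v" for u v using w(2)[of u v] that by (auto simp: V_def)
    have 3: "(\<Sum>v\<in>V. d n v) < w" using sum_le[of n] n by linarith
    show "time_change (l n)" "\<And>v. v \<in> V \<Longrightarrow> l n v = v + d n v" "\<And>t. \<bar>l n t - t\<bar> \<le> (\<Sum>v\<in>V. d n v)"
      unfolding l_def[abs_def] by (rule tent_time_change[OF fV w(1) 1 2 d_bounds(1) 3]; assumption)+
  qed
  have lim: "(\<lambda>n. real (card V + 1) / real (Suc n)) \<longlonglongrightarrow> 0"
    by (rule LIMSEQ_Suc[OF lim_const_over_n])
  have small: "eventually (\<lambda>n. real (card V + 1) / real (Suc n) < \<epsilon>) sequentially" if "\<epsilon> > 0" for \<epsilon>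
    using order_tendstoD(2)[OF lim that] .
  have eq: "nsol a N (rounded n e) (l n t) = nsol a N e t"
    if n: "real (card V + 1) / real (Suc n) < w" and t: "0 \<le> t" for n t
  proof (rule nsol_cong)
    have n1: "1 / real (Suc n) < w"
    proof -
      have "1 / real (Suc n) \<le> real (card V + 1) / real (Suc n)" by (intro divide_right_mono) auto
      then show ?thesis using n by linarith
    qed
    show "\<forall>p\<in>?P. \<forall>q\<in>?P. (rounded n e p \<le> rounded n e q) = (e p \<le> e q)"
    proof (intro ballI)
      fix p q assume pq: "p \<in> ?P" "q \<in> ?P"
      have "\<not> rounded n e p \<le> rounded n e q" if "\<not> e p \<le> e q"
        using w(2)[of "e q" "e p"] pq that rounded_bounds[where e = e and n = n and p = p] rounded_bounds[where e = e and n = n and p = q] n1 by auto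
      then show "(rounded n e p \<le> rounded n e q) = (e p \<le> e q)" using rounded_mono by blast
    qed
    show "\<forall>p\<in>?P. (rounded n e p \<le> l n t) = (e p \<le> t)"
    proof
      fix p assume p: "p \<in> ?P"
      have lt: "0 \<le> l n t" using tent(1)[OF n] t by (auto simp: time_change_def)
      show "(rounded n e p \<le> l n t) = (e p \<le> t)"
      proof (cases "0 < e p")
        case True
        then have "e p \<in> V" using p by (simp add: V_def)
        then have "rounded n e p = l n (e p)" using tent(2)[OF n] d_e by simp
        moreover have "strict_mono_on {0..} (l n)" using tent(1)[OF n] by (simp add: time_change_def)
        then have "l n (e p) \<le> l n t \<longleftrightarrow> e p \<le> t"
          by (rule strict_mono_on_less_eq) (use True t in auto)
        ultimately show ?thesis by simp
      next
        case False
        then show ?thesis using rounded_nonpos[of e p n] lt t by auto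
      qed
    qed
  qed
  show ?thesis
    unfolding skorokhod_conv_def
  proof (intro exI[of _ ls] conjI allI impI)
    show "time_change (ls n)" for n
      using tent(1)[of n] by (auto simp: ls_def time_change_def strict_mono_on_def)
    fix \<epsilon> :: real assume \<epsilon>: "\<epsilon> > 0"
    show "eventually (\<lambda>n. \<forall>t\<ge>0. \<bar>ls n t - t\<bar> < \<epsilon>) sequentially"
      using small[OF w(1)] small[OF \<epsilon>]
    proof eventually_elim
      case (elim n)
      have "\<bar>ls n t - t\<bar> < \<epsilon>" for t
        using tent(3)[OF elim(1), of t] sum_le[of n] elim by (simp add: ls_def)
      then show ?case by blast
    qed
    fix T :: real
    show "eventually (\<lambda>n. \<forall>t\<in>{0..T}. \<bar>nsol a N (rounded n e) (ls n t) - nsol a N e t\<bar> < \<epsilon>) sequentially"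
      using small[OF w(1)]
    proof eventually_elim
      case (elim n)
      show ?case using eq[OF elim] elim \<epsilon> by (simp add: ls_def)
    qed
  qed
qed

text \<open>\<open>F\<close> is only known to be continuous along Skorokhod convergent sequences.
  Rounded clocks take countably many values, so every functional of their path is measurable, and
  this passes to the limit.\<close>

lemma measurable_functional_nsol:
  assumes F: "sk_continuous F"
  shows "(\<lambda>e. F (nsol a N e)) \<in> borel_measurable (clock_space N)"
proof (rule borel_measurable_LIMSEQ_real)
  show "(\<lambda>n. F (nsol a N (rounded n e))) \<longlonglongrightarrow> F (nsol a N e)" for e
    by (rule F[unfolded sk_continuous_def, rule_format]) (simp add: cadlag_nsol skorokhod_conv_rounded)
  fix n
  define K where "K e = (\<lambda>p\<in>pairs N. \<lceil>real (Suc n) * e p\<rceil>)" for e :: "nat \<times> nat \<Rightarrow> real"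
  define G where "G c = F (nsol a N (\<lambda>p. of_int (c p) / real (Suc n)))" for c :: "nat \<times> nat \<Rightarrow> int"
  let ?A = "pairs N \<rightarrow>\<^sub>E (UNIV :: int set)"
  have cA: "countable ?A" by (intro countable_PiE finite_pairs) simp
  have "K \<in> clock_space N \<rightarrow>\<^sub>M count_space ?A"
    unfolding measurable_count_space_eq_countable[OF cA]
  proof (intro conjI ballI)
    show "K \<in> clocks N \<rightarrow> ?A" by (auto simp: K_def)
    fix c assume c: "c \<in> ?A"
    have "K -` {c} \<inter> clocks N =
        {e \<in> clocks N. \<forall>p\<in>pairs N. \<lceil>real (Suc n) * e p\<rceil> = c p}"
    proof -
      have "K e = c \<longleftrightarrow> (\<forall>p\<in>pairs N. \<lceil>real (Suc n) * e p\<rceil> = c p)" for e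
      proof
        assume "K e = c"
        then show "\<forall>p\<in>pairs N. \<lceil>real (Suc n) * e p\<rceil> = c p" by (auto simp: K_def)
      next
        assume "\<forall>p\<in>pairs N. \<lceil>real (Suc n) * e p\<rceil> = c p"
        then show "K e = c" using c by (intro ext) (auto simp: K_def PiE_def extensional_def)
      qed
      then show ?thesis by auto
    qed
    also have "... \<in> sets (clock_space N)"
    proof (intro sets.sets_Collect_finite_All finite_pairs)
      fix p assume p: "p \<in> pairs N"
      have "(\<lambda>e. \<lceil>real (Suc n) * e p\<rceil>) \<in> clock_space N \<rightarrow>\<^sub>M count_space UNIV"
        by (rule measurable_compose[OF borel_measurable_times[OF borel_measurable_const measurable_clock_component[OF p]] measurable_real_ceiling])
      then have "(\<lambda>e. \<lceil>real (Suc n) * e p\<rceil>) -` {c p} \<inter> clocks N \<in> sets (clock_space N)"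
        by (rule measurable_sets) simp
      also have "(\<lambda>e. \<lceil>real (Suc n) * e p\<rceil>) -` {c p} \<inter> clocks N =
          {e \<in> clocks N. \<lceil>real (Suc n) * e p\<rceil> = c p}" by auto
      finally show "{e \<in> clocks N. \<lceil>real (Suc n) * e p\<rceil> = c p} \<in> sets (clock_space N)" .
    qed
    finally show "K -` {c} \<inter> clocks N \<in> sets (clock_space N)" .
  qed
  then have "(\<lambda>e. G (K e)) \<in> borel_measurable (clock_space N)"
    by (rule measurable_compose) (simp add: measurable_count_space_eq1)
  moreover have "G (K e) = F (nsol a N (rounded n e))" for e
  proof -
    have "nsol a N (\<lambda>p. of_int (K e p) / real (Suc n)) = nsol a N (rounded n e)"
      by (rule ext, rule nsol_cong) (auto simp: K_def rounded_def)
    then show ?thesis by (simp add: G_def)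
  qed
  ultimately show "(\<lambda>e. F (nsol a N (rounded n e))) \<in> borel_measurable (clock_space N)" by simp
qed

section \<open>The limit of the particle density\<close>

context
  fixes a :: "nat \<Rightarrow> real"
  assumes a: "filterlim a at_top sequentially" "(\<lambda>N. a N / real N) \<longlonglongrightarrow> 0"
    "(\<lambda>N. ln (real N) / a N) \<longlonglongrightarrow> 0"
begin

lemma history_bound_tendsto_0:
  assumes M: "M \<ge> 1" and h: "0 < h" "h < c"
  shows "(\<lambda>N. real (N + 1) * ((real M * real N * real N / h) powr (real N / a N) *
      exp ((h + 2 * a N * t / real N) * real N) * exp (- c * real N))) \<longlonglongrightarrow> 0"
proof -
  define K where "K = ln (real M / h)"
  \<comment> \<open>\<open>f N\<close> is the logarithm of the whole bound divided by
    \<open>N\<close>; it tends to \<open>h - c\<close>, which is negative.\<close>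
  define f where "f N = ln (real N + 1) / real N + (K * (1 / a N) + 2 * (ln (real N) / a N)) +
      h + 2 * t * (a N / real N) - c" for N :: nat
  have inv: "(\<lambda>N. 1 / a N) \<longlonglongrightarrow> 0"
    using tendsto_inverse_0_at_top[OF a(1)] by (simp add: inverse_eq_divide)
  have l: "(\<lambda>N::nat. ln (real N + 1) / real N) \<longlonglongrightarrow> 0" by real_asymp
  have "f \<longlonglongrightarrow> 0 + (K * 0 + 2 * 0) + h + 2 * t * 0 - c"
    unfolding f_def by (intro tendsto_intros l inv a)
  then have f: "f \<longlonglongrightarrow> h - c" by simp
  have "filterlim (\<lambda>N. f N * real N) at_bot sequentially"
    by (rule filterlim_tendsto_neg_mult_at_bot[OF f _ filterlim_real_sequentially]) (use h in simp)
  then have "(\<lambda>N. exp (f N * real N)) \<longlonglongrightarrow> 0" by (rule filterlim_compose[OF exp_at_bot])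
  moreover have "eventually (\<lambda>N. exp (f N * real N) = real (N + 1) * ((real M * real N * real N / h) powr (real N / a N) *
      exp ((h + 2 * a N * t / real N) * real N) * exp (- c * real N))) sequentially"
    using eventually_ge_at_top[of 1]
  proof eventually_elim
    case (elim N)
    then have N: "real N > 0" by simp
    have L: "0 < real M * real N * real N / h" using M N h by simp
    have "real M * real N * real N / h = real M / h * (real N * real N)" by simp
    moreover have "ln (real M / h * (real N * real N)) = K + 2 * ln (real N)"
      unfolding K_def using M N h by (subst ln_mult_pos) (simp_all add: ln_mult_pos)
    ultimately have "ln (real M * real N * real N / h) = K + 2 * ln (real N)" by (simp only:)
    moreover have "x powr y = exp (y * ln x)" if "0 < x" for x y :: real using that by (simp add: powr_def)
    ultimately have "(real M * real N * real N / h) powr (real N / a N) = exp (real N / a N * (K + 2 * ln (real N)))"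
      using L by simp
    moreover have "real (N + 1) = exp (ln (real N + 1))" using N by simp
    ultimately have "real (N + 1) * ((real M * real N * real N / h) powr (real N / a N) *
      exp ((h + 2 * a N * t / real N) * real N) * exp (- c * real N)) =
      exp (ln (real N + 1) + (real N / a N * (K + 2 * ln (real N)) + (h + 2 * a N * t / real N) * real N + - c * real N))"
      by (simp only: exp_add)
    also have "ln (real N + 1) + (real N / a N * (K + 2 * ln (real N)) + (h + 2 * a N * t / real N) * real N + - c * real N) = f N * real N"
    proof -
      have "f N * real N = ln (real N + 1) / real N * real N + (K * (1 / a N) * real N + 2 * (ln (real N) / a N) * real N) +
          h * real N + 2 * t * (a N / real N) * real N - c * real N"
        by (simp only: f_def distrib_right left_diff_distrib)
      then show ?thesis using N by (simp add: distrib_left distrib_right mult_ac)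
    qed
    finally show ?case by simp
  qed
  ultimately show ?thesis by (rule Lim_transform_eventually)
qed

text \<open>The history starts from all \<open>N\<close> particles, so the decay of
  \<open>U N N\<close> decides. A fixed grid with mesh below the rate \<open>c\<close> keeps the
  error exp (h N) smaller than the gain exp (- c N).\<close>

lemma sol_tail_tendsto_0:
  fixes F :: "nat \<Rightarrow> nat \<Rightarrow> bool"
  assumes t: "t > 0" and c: "c > 0"
    and U: "\<And>N k. 0 \<le> U N k" "\<And>N. U N N \<le> exp (- c * real N)"
    and base: "eventually (\<lambda>N. \<forall>S\<subseteq>{1..N}. \<forall>h M. real M * h = t \<longrightarrow>
      cprob N (hist (a N) h M (F N) 0 S) \<le> U N (card S)) sequentially"
    and step: "eventually (\<lambda>N. \<forall>k d u. k \<le> N \<longrightarrow> 1 \<le> d \<longrightarrow> d \<le> k \<longrightarrow> real d < 2 * a N \<longrightarrow> 0 < u \<longrightarrow> u \<le> t \<longrightarrow>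
      exp (- real d * entropy_gap (real k * u / real N)) * U N (k - d) \<le> U N k) sequentially"
  shows "(\<lambda>N. cprob N (\<lambda>e. F N (card (sol (a N) N e t)))) \<longlonglongrightarrow> 0"
proof -
  obtain M0 :: nat where M0: "t / (c / 2) < real M0" using reals_Archimedean2 by blast
  define M where "M = Suc M0"
  define h where "h = t / real M"
  have M: "M \<ge> 1" and Mt: "t = real M * h" by (auto simp: M_def h_def)
  have h: "0 < h" using t M by (simp add: h_def)
  have "t < real M * c"
  proof -
    have "t < real M0 * (c / 2)" using M0 c by (simp add: divide_less_eq)
    also have "... \<le> real M * c" using c by (intro mult_mono) (auto simp: M_def)
    finally show ?thesis .
  qed
  then have hc: "h < c" using M by (simp add: h_def divide_less_eq mult.commute)
  let ?b = "\<lambda>N. real (N + 1) * ((real M * real N * real N / h) powr (real N / a N) *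
      exp ((h + 2 * a N * t / real N) * real N) * exp (- c * real N))"
  have lim: "?b \<longlonglongrightarrow> 0" by (rule history_bound_tendsto_0[OF M h hc])
  have Linf: "filterlim (\<lambda>N. real M * real N * real N / h) at_top sequentially"
  proof -
    have "0 < real M / h" using M h by simp
    then have "filterlim (\<lambda>N. (real M / h) * (real N * real N)) at_top sequentially"
      by (intro filterlim_tendsto_pos_mult_at_top[OF tendsto_const]
          filterlim_at_top_mult_at_top filterlim_real_sequentially)
    then show ?thesis by (simp add: mult_ac)
  qed
  have "eventually (\<lambda>N. cprob N (\<lambda>e. F N (card (sol (a N) N e t))) \<le> ?b N) sequentially"
    using base step eventually_ge_at_top[of 1] filterlim_at_top_dense[THEN iffD1, OF a(1), rule_format, of 1]
      filterlim_at_top[THEN iffD1, OF Linf, rule_format, of 1]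
  proof eventually_elim
    case (elim N)
    have "cprob N (\<lambda>e. F N (card (sol (a N) N e t))) \<le>
      real (N + 1) * ((real M * real N * real N / h) powr (real N / a N) *
      exp ((h + 2 * a N * t / real N) * real N) * U N N)"
    proof (rule cprob_sol_le[where F = "F N" and U = "U N", OF elim(3,4) h Mt U(1)])
      show "cprob N (hist (a N) h M (F N) 0 S) \<le> U N (card S)" if "S \<subseteq> {1..N}" for S
        by (rule elim(1)[rule_format, OF that Mt[symmetric]])
      fix k d m assume kd: "k \<le> N" "1 \<le> d" "d \<le> k" "real d < 2 * a N" "m < M"
      have "real (Suc m) * h \<le> real M * h" using kd(5) h by (intro mult_right_mono) auto
      then have u: "0 < real (Suc m) * h" "real (Suc m) * h \<le> t" using h Mt by simp_all
      show "exp (- real d * entropy_gap (real k * (real (Suc m) * h) / real N)) * U N (k - d) \<le> U N k"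
        by (rule elim(2)[rule_format, OF kd(1-4) u])
    qed (rule elim(5))
    also have "... \<le> ?b N" by (intro mult_left_mono U(2)) auto
    finally show ?case .
  qed
  then show ?thesis
    by (intro tendsto_sandwich[OF _ _ tendsto_const lim]) auto
qed

text \<open>While \<open>k <= v2 N\<close>, the set is subcritical at all times
  \<open>u <= t\<close>, as \<open>k u / N <= v2 t < 1\<close>, so removing \<open>d\<close>
  particles costs exp (- c d) or more. The potential \<open>U\<close> charges this price between the
  levels \<open>v1 N\<close> and \<open>\<mu> N\<close>, in total exp (- c (v1 - \<mu>) N).\<close>

lemma sol_lower_tail:
  assumes t: "t > 0" and v: "v < n_limit t"
  shows "(\<lambda>N. cprob N (\<lambda>e. real (card (sol (a N) N e t)) \<le> v * real N)) \<longlonglongrightarrow> 0"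
proof -
  \<comment> \<open>Raising a negative \<open>v\<close> to 0 only enlarges the event and makes all
    levels nonnegative.\<close>
  define \<mu> where "\<mu> = max v 0"
  have \<mu>: "0 \<le> \<mu>" "v \<le> \<mu>" "\<mu> < n_limit t" using v n_limit_pos[of t] by (auto simp: \<mu>_def)
  obtain v1 where v1: "\<mu> < v1" "v1 < n_limit t" using \<mu>(3) dense by blast
  obtain v2 where v2: "v1 < v2" "v2 < n_limit t" using v1(2) dense by blast
  have v2t: "0 < v2 * t" "v2 * t < 1"
  proof -
    show "0 < v2 * t" using \<mu> v1 v2 t by simp
    show "v2 * t < 1"
    proof (cases "t \<le> 1")
      case True
      then have "v2 * t \<le> v2 * 1" using \<mu> v1 v2 by (intro mult_left_mono) auto
      then show ?thesis using v2 n_limit_le_1[of t] by simp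
    next
      case False
      then show ?thesis using v2 t by (simp add: n_limit_def less_divide_eq)
    qed
  qed
  define c where "c = entropy_gap (v2 * t)"
  have c: "0 < c" unfolding c_def using v2t by (intro entropy_gap_pos) auto
  define U where "U N k = exp (c * (\<mu> * real N - min (real k) (v1 * real N)))" for N k :: nat
  have v1_1: "v1 \<le> 1" using v1 n_limit_le_1[of t] by simp
  have lim: "(\<lambda>N. cprob N (\<lambda>e. real (card (sol (a N) N e t)) \<le> \<mu> * real N)) \<longlonglongrightarrow> 0"
  proof (rule sol_tail_tendsto_0[OF t, where U = U and c = "c * (v1 - \<mu>)"])
    show "0 < c * (v1 - \<mu>)" using c v1 by simp
    show "0 \<le> U N k" for N k by (simp add: U_def)
    show "U N N \<le> exp (- (c * (v1 - \<mu>)) * real N)" for N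
    proof -
      have "v1 * real N \<le> 1 * real N" by (rule mult_right_mono[OF v1_1]) simp
      then show ?thesis by (simp add: U_def min_def algebra_simps)
    qed
    show "eventually (\<lambda>N. \<forall>S\<subseteq>{1..N}. \<forall>h M. real M * h = t \<longrightarrow>
      cprob N (hist (a N) h M (\<lambda>k. real k \<le> \<mu> * real N) 0 S) \<le> U N (card S)) sequentially"
      using eventually_ge_at_top[of 1]
    proof eventually_elim
      case (elim N)
      show ?case
      proof (intro allI impI)
        fix S :: "nat set" and h M
        show "cprob N (hist (a N) h M (\<lambda>k. real k \<le> \<mu> * real N) 0 S) \<le> U N (card S)"
        proof (cases "real (card S) \<le> \<mu> * real N")
          case True
          then have "1 \<le> U N (card S)" using c by (simp add: U_def min_def)
          then show ?thesis by (rule order_trans[OF cprob_le_1[OF elim]])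
        qed (simp add: U_def)
      qed
    qed
    have "eventually (\<lambda>N. a N / real N < (v2 - v1) / 2) sequentially"
      using order_tendstoD(2)[OF a(2), of "(v2 - v1) / 2"] v2 by simp
    then show "eventually (\<lambda>N. \<forall>k d u. k \<le> N \<longrightarrow> 1 \<le> d \<longrightarrow> d \<le> k \<longrightarrow> real d < 2 * a N \<longrightarrow> 0 < u \<longrightarrow> u \<le> t \<longrightarrow>
      exp (- real d * entropy_gap (real k * u / real N)) * U N (k - d) \<le> U N k) sequentially"
      using eventually_ge_at_top[of 1]
    proof eventually_elim
      case (elim N)
      then have N: "0 < real N" and a_N: "2 * a N < (v2 - v1) * real N" by (simp_all add: divide_less_eq)
      show ?case
      proof (intro allI impI)
        fix k d :: nat and u :: real assume kd: "k \<le> N" "1 \<le> d" "d \<le> k" "real d < 2 * a N" and u: "0 < u" "u \<le> t"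
        let ?x = "real k * u / real N"
        let ?m = "\<lambda>k. min (real k) (v1 * real N)"
        have x: "0 < ?x" using kd u N by simp
        have "c * (?m k - ?m (k - d)) \<le> real d * entropy_gap ?x"
        proof (cases "v1 * real N \<le> real (k - d)")
          case True
          then have "v1 * real N \<le> real k" using kd by linarith
          then have "?m k - ?m (k - d) = 0" using True by simp
          then show ?thesis using entropy_gap_nonneg[OF x] by simp
        next
          case False
          then have "real k - real d < v1 * real N" using kd by (simp add: of_nat_diff)
          \<comment> \<open>A step removes fewer than \<open>2 a\<close> particles, eventually less
            than the margin (v2 - v1) N. So a step that ends below \<open>v1 N\<close> starts below
            \<open>v2 N\<close>.\<close>
          then have "real k \<le> v2 * real N" using kd(4) a_N by (simp add: algebra_simps)
          then have "real k * u \<le> (v2 * real N) * t" using u \<mu> v1 v2 by (intro mult_mono) auto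
          then have "?x \<le> v2 * t" using N by (simp add: divide_le_eq mult_ac)
          then have "c \<le> entropy_gap ?x" unfolding c_def
            using x v2t by (intro entropy_gap_antimono) auto
          moreover have "?m k - ?m (k - d) \<le> real d" using kd(3) by (simp add: of_nat_diff min_def)
          ultimately have "c * (?m k - ?m (k - d)) \<le> entropy_gap ?x * real d"
            using c kd by (intro mult_mono) (auto simp: min_def of_nat_diff)
          then show ?thesis by (simp add: mult.commute)
        qed
        then have "- real d * entropy_gap ?x + c * (\<mu> * real N - ?m (k - d)) \<le> c * (\<mu> * real N - ?m k)"
          by (simp add: algebra_simps)
        then show "exp (- real d * entropy_gap ?x) * U N (k - d) \<le> U N k"
          unfolding U_def exp_add[symmetric] by simp
      qed
    qed
  qed
  show ?thesis
  proof (rule tendsto_sandwich[OF _ _ tendsto_const lim])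
    show "eventually (\<lambda>N. cprob N (\<lambda>e. real (card (sol (a N) N e t)) \<le> v * real N) \<le>
        cprob N (\<lambda>e. real (card (sol (a N) N e t)) \<le> \<mu> * real N)) sequentially"
      using eventually_ge_at_top[of 1]
    proof eventually_elim
      case (elim N)
      have "v * real N \<le> \<mu> * real N" using \<mu> by (intro mult_right_mono) auto
      then show ?case
        by (intro cprob_mono[OF clock_event_sol[where R = "\<lambda>S. real (card S) \<le> \<mu> * real N"] _ elim]) auto
    qed
  qed auto
qed

text \<open>The gap is nonnegative, so steps need no payment and \<open>U\<close> is constant in
  \<open>k\<close>. The price is paid by the final set: it has more than (1 + \<delta>) N / t
  particles and no large component, which is exponentially unlikely by
  \<open>cprob_nolarge_le\<close>.\<close>

lemma sol_upper_tail:
  assumes t: "t > 1" and v: "1 / t < v"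
  shows "(\<lambda>N. cprob N (\<lambda>e. v * real N \<le> real (card (sol (a N) N e t)))) \<longlonglongrightarrow> 0"
proof -
  \<comment> \<open>Half of the excess, so that 1 < 1 + \<delta> < v t. Likewise \<open>c\<close>
    below is half of the gap, which leaves the other half for the error
    \<open>t a / N\<close>.\<close>
  define \<delta> where "\<delta> = (v * t - 1) / 2"
  have \<nu>t: "1 < v * t" using v t by (simp add: divide_less_eq)
  have \<delta>: "0 < \<delta>" using \<nu>t by (simp add: \<delta>_def)
  have "1 + \<delta> < v * t" using \<nu>t unfolding \<delta>_def by (simp add: field_simps)
  then have \<delta>v: "(1 + \<delta>) / t < v" using t by (simp add: divide_less_eq)
  define c where "c = entropy_gap (1 + \<delta>) / 2"
  have c: "0 < c" using entropy_gap_pos[of "1 + \<delta>"] \<delta> by (simp add: c_def)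
  define U where "U N k = exp (- (c * (v - (1 + \<delta>) / t)) * real N)" for N k :: nat
  show ?thesis
  proof (rule sol_tail_tendsto_0[where U = U and c = "c * (v - (1 + \<delta>) / t)"])
    show "0 < c * (v - (1 + \<delta>) / t)" using c \<delta>v by simp
    show "0 \<le> U N k" "U N N \<le> exp (- (c * (v - (1 + \<delta>) / t)) * real N)" for N k by (simp_all add: U_def)
    have "eventually (\<lambda>N. a N / real N < c / t) sequentially"
      using order_tendstoD(2)[OF a(2), of "c / t"] c t by simp
    then show "eventually (\<lambda>N. \<forall>S\<subseteq>{1..N}. \<forall>h M. real M * h = t \<longrightarrow>
      cprob N (hist (a N) h M (\<lambda>k. v * real N \<le> real k) 0 S) \<le> U N (card S)) sequentially"
      using eventually_ge_at_top[of 1] filterlim_at_top_dense[THEN iffD1, OF a(1), rule_format, of 0]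
    proof eventually_elim
      case (elim N)
      show ?case
      proof (intro allI impI)
        fix S :: "nat set" and h M assume S: "S \<subseteq> {1..N}" and M: "real M * h = t"
        show "cprob N (hist (a N) h M (\<lambda>k. v * real N \<le> real k) 0 S) \<le> U N (card S)"
        proof (cases "v * real N \<le> real (card S)")
          case True
          have "t * (a N / real N) \<le> t * (c / t)" using elim(1) t by (intro mult_left_mono) auto
          then have c': "c \<le> entropy_gap (1 + \<delta>) - t * a N / real N" using t by (simp add: c_def)
          have "cprob N (hist (a N) h M (\<lambda>k. v * real N \<le> real k) 0 S) = nolarge_prob N (a N) S t"
            using True M by simp
          also have "... \<le> exp (- c * (real (card S) - real N * (1 + \<delta>) / t))"
            by (rule cprob_nolarge_le[OF elim(2) _ elim(3) \<delta> c c' refl S]) (use t in simp)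
          also have "... \<le> U N (card S)"
          proof -
            have "c * (v * real N - real N * (1 + \<delta>) / t) \<le> c * (real (card S) - real N * (1 + \<delta>) / t)"
              using True c by (intro mult_left_mono) auto
            moreover have "c * (v * real N - real N * (1 + \<delta>) / t) = c * (v - (1 + \<delta>) / t) * real N"
              using t by (simp add: field_simps)
            ultimately show ?thesis by (simp add: U_def)
          qed
          finally show ?thesis .
        qed (simp add: U_def)
      qed
    qed
    show "eventually (\<lambda>N. \<forall>k d u. k \<le> N \<longrightarrow> 1 \<le> d \<longrightarrow> d \<le> k \<longrightarrow> real d < 2 * a N \<longrightarrow> 0 < u \<longrightarrow> u \<le> t \<longrightarrow>
      exp (- real d * entropy_gap (real k * u / real N)) * U N (k - d) \<le> U N k) sequentially"
      using eventually_ge_at_top[of 1]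
    proof eventually_elim
      case (elim N)
      show ?case
      proof (intro allI impI)
        fix k d :: nat and u :: real assume kd: "k \<le> N" "1 \<le> d" "d \<le> k" and u: "0 < u"
        have "0 \<le> entropy_gap (real k * u / real N)" by (rule entropy_gap_nonneg) (use kd u in simp)
        then have "exp (- real d * entropy_gap (real k * u / real N)) \<le> 1" by simp
        then show "exp (- real d * entropy_gap (real k * u / real N)) * U N (k - d) \<le> U N k"
          by (simp add: U_def)
      qed
    qed
  qed (use t in simp)
qed

lemma nsol_tendsto_in_probability:
  assumes t: "t > 0" and w: "w > 0"
  shows "(\<lambda>N. cprob N (\<lambda>e. w < \<bar>nsol (a N) N e t - n_limit t\<bar>)) \<longlonglongrightarrow> 0"
proof -
  let ?A = "\<lambda>N e. real (card (sol (a N) N e t)) \<le> (n_limit t - w) * real N"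
  let ?B = "\<lambda>N e. (n_limit t + w) * real N \<le> real (card (sol (a N) N e t))"
  have A: "(\<lambda>N. cprob N (?A N)) \<longlonglongrightarrow> 0" by (rule sol_lower_tail[OF t]) (use w in simp)
  have B: "(\<lambda>N. cprob N (?B N)) \<longlonglongrightarrow> 0"
  proof (cases "t > 1")
    case True
    then show ?thesis by (intro sol_upper_tail) (use w in \<open>auto simp: n_limit_def\<close>)
  next
    case False
    \<comment> \<open>For \<open>t <= 1\<close> the limit is 1, which the density never
      exceeds.\<close>
    have "eventually (\<lambda>N. cprob N (?B N) = 0) sequentially"
      using eventually_ge_at_top[of 1]
    proof eventually_elim
      case (elim N)
      have "\<not> ?B N e" for e
      proof -
        have "1 * real N < (1 + w) * real N" using elim w by (intro mult_strict_right_mono) auto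
        then show ?thesis using card_sol_le[of "a N" N e t] False by (simp add: n_limit_def)
      qed
      then show ?case by simp
    qed
    then show ?thesis by (rule tendsto_eventually)
  qed
  have AB: "(\<lambda>N. cprob N (?A N) + cprob N (?B N)) \<longlonglongrightarrow> 0" using tendsto_add[OF A B] by simp
  show ?thesis
  proof (rule tendsto_sandwich[OF _ _ tendsto_const AB])
    show "eventually (\<lambda>N. cprob N (\<lambda>e. w < \<bar>nsol (a N) N e t - n_limit t\<bar>) \<le> cprob N (?A N) + cprob N (?B N)) sequentially"
      using eventually_ge_at_top[of 1]
    proof eventually_elim
      case (elim N)
      interpret prob_space "clock_space N" by (rule prob_space_clock_space[OF elim])
      have evA: "{e \<in> clocks N. ?A N e} \<in> events" and evB: "{e \<in> clocks N. ?B N e} \<in> events"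
        by (rule clock_event_sets, rule clock_event_sol)+
      have N: "0 < real N" using elim by simp
      have "cprob N (\<lambda>e. w < \<bar>nsol (a N) N e t - n_limit t\<bar>) \<le>
          prob ({e \<in> clocks N. ?A N e} \<union> {e \<in> clocks N. ?B N e})"
      proof (rule finite_measure_mono)
        show "{e \<in> clocks N. w < \<bar>nsol (a N) N e t - n_limit t\<bar>} \<subseteq>
            {e \<in> clocks N. ?A N e} \<union> {e \<in> clocks N. ?B N e}"
        proof
          fix e assume e: "e \<in> {e \<in> clocks N. w < \<bar>nsol (a N) N e t - n_limit t\<bar>}"
          have ns: "real (card (sol (a N) N e t)) = nsol (a N) N e t * real N" using N by (simp add: nsol_def)
          consider "nsol (a N) N e t \<le> n_limit t - w" | "n_limit t + w \<le> nsol (a N) N e t"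
            using e by (auto simp: abs_if split: if_splits)
          then have "?A N e \<or> ?B N e" unfolding ns using N by cases (simp_all add: mult_right_mono)
          then show "e \<in> {e \<in> clocks N. ?A N e} \<union> {e \<in> clocks N. ?B N e}" using e by auto
        qed
      qed (use evA evB in auto)
      also have "... \<le> cprob N (?A N) + cprob N (?B N)" by (rule measure_Un_le[OF evA evB])
      finally show ?case .
    qed
  qed auto
qed

text \<open>Both \<open>nsol\<close> and its limit decrease in time, so closeness on a fine grid is uniform closeness.\<close>
lemma nsol_uniform_in_probability:
  assumes T: "T \<ge> 0" and w: "w > 0"
  obtains Bad where "\<And>N. clock_event N (pairs N) (Bad N)" "(\<lambda>N. cprob N (Bad N)) \<longlonglongrightarrow> 0"
    "\<forall>N e t. \<not> Bad N e \<longrightarrow> t \<in> {0..T} \<longrightarrow> \<bar>nsol (a N) N e t - n_limit t\<bar> \<le> w"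
proof -
  \<comment> \<open>Half of \<open>w\<close> is for the error at the grid points, half for the
    variation of the limit between them.\<close>
  define h where "h = w / 2"
  have h: "0 < h" using w by (simp add: h_def)
  obtain m :: nat where m: "T / h < real m" using reals_Archimedean2 by blast
  define g where "g i = real i * h" for i :: nat
  \<comment> \<open>The grid starts at index 1, since convergence in probability is available at
    positive times.\<close>
  define Bad where "Bad N e \<longleftrightarrow> (\<exists>i\<in>{1..m}. h < \<bar>nsol (a N) N e (g i) - n_limit (g i)\<bar>)" for N e
  have ev: "clock_event N (pairs N) (\<lambda>e. h < \<bar>nsol (a N) N e (g i) - n_limit (g i)\<bar>)" for N i
    unfolding nsol_def by (rule clock_event_sol)
  show thesis
  proof (rule that[of Bad])
    show "clock_event N (pairs N) (Bad N)" for N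
      unfolding Bad_def by (intro clock_event_Bex ev) simp
    have "(\<lambda>N. \<Sum>i\<in>{1..m}. cprob N (\<lambda>e. h < \<bar>nsol (a N) N e (g i) - n_limit (g i)\<bar>)) \<longlonglongrightarrow> (\<Sum>i\<in>{1..m}. 0)"
      by (intro tendsto_sum nsol_tendsto_in_probability) (use h in \<open>auto simp: g_def\<close>)
    then have lim: "(\<lambda>N. \<Sum>i\<in>{1..m}. cprob N (\<lambda>e. h < \<bar>nsol (a N) N e (g i) - n_limit (g i)\<bar>)) \<longlonglongrightarrow> 0" by simp
    show "(\<lambda>N. cprob N (Bad N)) \<longlonglongrightarrow> 0"
    proof (rule tendsto_sandwich[OF _ _ tendsto_const lim])
      show "eventually (\<lambda>N. cprob N (Bad N) \<le> (\<Sum>i\<in>{1..m}. cprob N (\<lambda>e. h < \<bar>nsol (a N) N e (g i) - n_limit (g i)\<bar>))) sequentially"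
        using eventually_ge_at_top[of 1]
        by eventually_elim (unfold Bad_def, rule cprob_Bex_le[OF _ _ ev], auto)
    qed auto
    show "\<forall>N e t. \<not> Bad N e \<longrightarrow> t \<in> {0..T} \<longrightarrow> \<bar>nsol (a N) N e t - n_limit t\<bar> \<le> w"
    proof (intro allI impI)
      fix N e t assume nb: "\<not> Bad N e" and t: "t \<in> {0..T}"
      have good: "\<bar>nsol (a N) N e (g i) - n_limit (g i)\<bar> \<le> h" if "i \<in> {1..m}" for i
        using nb that unfolding Bad_def by (auto simp: not_less)
      define i where "i = nat \<lfloor>t / h\<rfloor>"
      have th: "0 \<le> t / h" using t h by simp
      have i: "real i \<le> t / h" "t / h < real i + 1" using th by (simp_all add: i_def)
      have gi: "g i \<le> t" "t \<le> g (Suc i)" using i h by (simp_all add: g_def field_simps)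
      have "t / h \<le> T / h" using t h by (intro divide_right_mono) auto
      then have im: "Suc i \<le> m" using i m by linarith
      have gS: "g (Suc i) = g i + h" by (simp add: g_def algebra_simps)
      have g0: "0 \<le> g i" using h by (simp add: g_def)
      have t0: "0 \<le> t" using t by simp
      have wh: "w = 2 * h" by (simp add: h_def)
      have "\<bar>nsol (a N) N e (g (Suc i)) - n_limit (g (Suc i))\<bar> \<le> h" by (rule good) (use im in simp)
      then have "n_limit t - w \<le> nsol (a N) N e t"
        using nsol_antimono[OF gi(2), of "a N" N e] n_limit_Lipschitz[OF t0 gi(2)] gS gi wh by linarith
      moreover have "nsol (a N) N e t \<le> n_limit t + w"
      \<comment> \<open>In the first cell the trivial bound \<open>nsol <= 1\<close> takes the place
        of a grid point at time 0.\<close>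
      proof (cases "i = 0")
        case True
        have "1 \<le> n_limit t + h"
          using n_limit_Lipschitz[of 0 t] t0 gi gS True by (simp add: n_limit_def g_def split: if_splits)
        then show ?thesis using nsol_le_1[of "a N" N e t] h by (simp add: h_def)
      next
        case False
        then show ?thesis
          using good[of i] im nsol_antimono[OF gi(1), of "a N" N e] n_limit_Lipschitz[OF g0 gi(1)] gS gi wh
          by simp
      qed
      ultimately show "\<bar>nsol (a N) N e t - n_limit t\<bar> \<le> w" by (simp add: abs_le_iff)
    qed
  qed
qed

text \<open>Off the bad event the path is uniformly close to the limit on \<open>{0..T}\<close>, so
  \<open>F\<close> differs by less than half of the tolerance. On it the difference is at most
  \<open>2 * B\<close>, weighted by a vanishing probability.\<close>

lemma nsol_conv_distr:
  shows "conv_distr_D clock_space (\<lambda>N e t. nsol (a N) N e t) n_limit"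
  unfolding conv_distr_D_def
proof (intro allI impI)
  fix F :: "(real \<Rightarrow> real) \<Rightarrow> real" assume F: "bounded (range F) \<and> sk_continuous F"
  then obtain B where B: "\<And>x. \<bar>F x\<bar> \<le> B" by (auto simp: bounded_iff)
  have B0: "0 \<le> B" using B[of undefined] by linarith
  show "(\<lambda>N. integral\<^sup>L (clock_space N) (\<lambda>e. F (\<lambda>t. nsol (a N) N e t))) \<longlonglongrightarrow> F n_limit"
  proof (rule tendstoI)
    fix w :: real assume w: "w > 0"
    have sF: "sk_continuous F" and w2: "w / 2 > 0" using F w by simp_all
    obtain T \<delta> where T: "T \<ge> 0" and \<delta>: "\<delta> > 0" and close:
      "\<forall>y. cadlag y \<longrightarrow> (\<forall>t\<in>{0..T}. \<bar>y t - n_limit t\<bar> \<le> \<delta>) \<longrightarrow> \<bar>F y - F n_limit\<bar> < w / 2"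
      by (rule sk_continuous_uniform[OF sF cadlag_n_limit w2])
    obtain Bad where Bad: "\<And>N. clock_event N (pairs N) (Bad N)" "(\<lambda>N. cprob N (Bad N)) \<longlonglongrightarrow> 0"
      "\<forall>N e t. \<not> Bad N e \<longrightarrow> t \<in> {0..T} \<longrightarrow> \<bar>nsol (a N) N e t - n_limit t\<bar> \<le> \<delta>"
      by (rule nsol_uniform_in_probability[OF T \<delta>], rule that)
    have "(\<lambda>N. 2 * B * cprob N (Bad N)) \<longlonglongrightarrow> 2 * B * 0" by (intro tendsto_intros Bad(2))
    then have "eventually (\<lambda>N. 2 * B * cprob N (Bad N) < w / 2) sequentially"
      using w by (intro order_tendstoD(2)) auto
    then show "eventually (\<lambda>N. dist (integral\<^sup>L (clock_space N) (\<lambda>e. F (\<lambda>t. nsol (a N) N e t))) (F n_limit) < w) sequentially"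
      using eventually_ge_at_top[of 1]
    proof eventually_elim
      case (elim N)
      let ?M = "clock_space N"
      interpret prob_space ?M by (rule prob_space_clock_space[OF elim(2)])
      define X where "X e = F (nsol (a N) N e)" for e
      let ?S = "{e \<in> space ?M. Bad N e}"
      have S: "?S \<in> sets ?M" by (rule clock_event_sets[OF Bad(1)])
      have Xm: "X \<in> borel_measurable ?M" unfolding X_def using F by (intro measurable_functional_nsol) simp
      have iX: "integrable ?M X"
        by (rule integrable_const_bound[where B = B]) (use B Xm in \<open>auto simp: X_def\<close>)
      have iD: "integrable ?M (\<lambda>e. X e - F n_limit)" using iX by simp
      have iS: "integrable ?M (\<lambda>e. 2 * B * indicator ?S e)"
        by (intro integrable_mult_right integrable_real_indicator S) (simp add: emeasure_eq_measure)
      have iI: "integrable ?M (\<lambda>e. w / 2 + 2 * B * indicator ?S e)"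
        by (intro Bochner_Integration.integrable_add iS) simp
      have "\<bar>expectation X - F n_limit\<bar> = \<bar>expectation (\<lambda>e. X e - F n_limit)\<bar>"
        using iX by (simp add: prob_space)
      also have "... \<le> expectation (\<lambda>e. \<bar>X e - F n_limit\<bar>)" by (rule integral_abs_bound)
      also have "... \<le> expectation (\<lambda>e. w / 2 + 2 * B * indicator ?S e)"
      proof (rule integral_mono[OF integrable_abs[OF iD] iI])
        fix e assume e: "e \<in> space ?M"
        show "\<bar>X e - F n_limit\<bar> \<le> w / 2 + 2 * B * indicator ?S e"
        proof (cases "Bad N e")
          case True
          have "\<bar>X e - F n_limit\<bar> \<le> 2 * B" using B[of "nsol (a N) N e"] B[of n_limit] by (simp add: X_def)
          then show ?thesis using True e w by simp
        next
          case False
          have "\<bar>X e - F n_limit\<bar> < w / 2" unfolding X_def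
            by (rule close[rule_format, OF cadlag_nsol]) (rule Bad(3)[rule_format, OF False])
          then show ?thesis using False by simp
        qed
      qed
      also have "... = w / 2 + 2 * B * prob ?S"
        using S by (subst Bochner_Integration.integral_add[OF _ iS]) (simp_all add: prob_space Int_absorb2 subset_eq)
      finally show ?case using elim(1) by (simp add: dist_real_def X_def[abs_def])
    qed
  qed
qed

end

text \<open>Once ln N is at least 1, so is its power in the hypothesis; hence \<open>a N\<close> is
  eventually at least N^(2/3), which dominates ln N.\<close>

lemma ln_over_alpha_tendsto_0:
  fixes a :: "nat \<Rightarrow> real"
  assumes \<gamma>: "\<gamma> > 0" and a: "filterlim (\<lambda>N. a N / (real N powr (2/3) * ln (real N) powr \<gamma>)) at_top sequentially"
  shows "(\<lambda>N. ln (real N) / a N) \<longlonglongrightarrow> 0"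
proof -
  have lim: "(\<lambda>N::nat. ln (real N) / real N powr (2/3)) \<longlonglongrightarrow> 0" by real_asymp
  have ge1: "eventually (\<lambda>N::nat. 1 \<le> ln (real N)) sequentially" by real_asymp
  have "eventually (\<lambda>N. 1 \<le> a N / (real N powr (2/3) * ln (real N) powr \<gamma>)) sequentially"
    using filterlim_at_top[THEN iffD1, OF a] by blast
  with ge1 have "eventually (\<lambda>N. 0 \<le> ln (real N) / a N \<and> ln (real N) / a N \<le> ln (real N) / real N powr (2/3)) sequentially"
    using eventually_ge_at_top[of 1]
  proof eventually_elim
    case (elim N)
    have N: "0 < real N powr (2/3)" using elim(3) by simp
    have l: "1 \<le> ln (real N) powr \<gamma>" using elim(1) \<gamma> by (simp add: ge_one_powr_ge_zero)
    have "real N powr (2/3) * 1 \<le> real N powr (2/3) * ln (real N) powr \<gamma>"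
      using l N by (intro mult_left_mono) auto
    also have "... \<le> a N"
    proof -
      have "0 < real N powr (2/3) * ln (real N) powr \<gamma>" using N l by (intro mult_pos_pos) auto
      then show ?thesis using elim(2) by (simp only: le_divide_eq_1_pos)
    qed
    finally have *: "real N powr (2/3) \<le> a N" by simp
    then have "ln (real N) / a N \<le> ln (real N) / real N powr (2/3)"
      using N elim(1) mult_pos_pos[of "a N" "real N powr (2/3)"] by (intro divide_left_mono) linarith+
    moreover have "0 \<le> ln (real N) / a N" using * N elim(1) by (intro divide_nonneg_nonneg) linarith+
    ultimately show ?case by simp
  qed
  then show ?thesis
    by (intro tendsto_sandwich[OF _ _ tendsto_const lim]) (auto elim: eventually_mono)
qed

theorem theorem1p2:
  fixes \<alpha> :: "nat \<Rightarrow> real"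
  assumes alpha_inf: "filterlim \<alpha> at_top sequentially"
    and alpha_small: "(\<lambda>N. \<alpha> N / real N) \<longlonglongrightarrow> 0"
  shows "(\<forall>N\<ge>2. \<forall>t\<ge>0. \<forall>k::nat.
            measure (clock_space N)
              {e \<in> space (clock_space N). real N * nsol (\<alpha> N) N e t = real k} > 0 \<longrightarrow>
            (\<forall>Q. iso_invariant Q \<longrightarrow>
               measure (clock_space N)
                 {e \<in> space (clock_space N). Q (config (\<alpha> N) N e t) \<and>
                                             real N * nsol (\<alpha> N) N e t = real k}
               / measure (clock_space N)
                 {e \<in> space (clock_space N). real N * nsol (\<alpha> N) N e t = real k}
               = measure_pmf.prob (ER k (psol N t)) {G. Q G \<and> no_large_comp (\<alpha> N) G}
                 / measure_pmf.prob (ER k (psol N t)) {G. no_large_comp (\<alpha> N) G}))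
       \<and> ((\<exists>\<gamma>>1/3. filterlim (\<lambda>N. \<alpha> N / (real N powr (2/3) * ln (real N) powr \<gamma>))
                              at_top sequentially)
          \<longrightarrow> conv_distr_D clock_space (\<lambda>N e t. nsol (\<alpha> N) N e t) n_limit)"
proof (rule conjI, goal_cases)
  case 1
  show ?case by (intro allI impI config_law) auto
next
  case 2
  show ?case
  proof
    assume "\<exists>\<gamma>>1/3. filterlim (\<lambda>N. \<alpha> N / (real N powr (2/3) * ln (real N) powr \<gamma>)) at_top sequentially"
    then obtain \<gamma> where \<gamma>: "\<gamma> > 1/3"
      "filterlim (\<lambda>N. \<alpha> N / (real N powr (2/3) * ln (real N) powr \<gamma>)) at_top sequentially" by blast
    have "(\<lambda>N. ln (real N) / \<alpha> N) \<longlonglongrightarrow> 0"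
      by (rule ln_over_alpha_tendsto_0[OF _ \<gamma>(2)]) (use \<gamma>(1) in simp)
    then show "conv_distr_D clock_space (\<lambda>N e t. nsol (\<alpha> N) N e t) n_limit"
      by (rule nsol_conv_distr[OF alpha_inf alpha_small])
  qed
qed

end
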